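(* Let $d\ge 2$ and let $\Omega$ be a bounded domain in $\mathbb R^d$ such that $\lim_{h\to0^+}\frac{|\omega_h|}{h}=|\partial\Omega|$, with Dirichlet Laplacian eigenvalues $\lambda_1\le\lambda_2\le\dots$. Then for all $0<t\leq r_{\Omega}^2$, $$\sum_{j=1}^{\infty}e^{-\lambda_jt}\geq \frac{|\Omega|}{(4\pi t)^{\frac{d}{2}}}-\frac{2|\partial\Omega|\,t^{\frac{1}{2}}}{(4\pi t)^{\frac{d}{2}}}+R(t),\qquad R(t):=2\,\frac{t^{\frac{1}{2}}|\partial\Omega|-|\omega_{t^{1/2}}|}{(4\pi t)^{\frac{d}{2}}},$$ and $R(t)=o(t^{\frac{1-d}{2}})$ as $t\to 0^+$.
   Context: The eigenvalues are those of the (nonnegative) Dirichlet Laplacian $-\Delta_\Omega^D$ in $L^2(\Omega)$, repeated according to multiplicity. For $h>0$, $\omega_h:=\{x\in\Omega:\operatorname{dist}(x,\partial\Omega)\le h\}$. The inradius is $r_{\Omega}:=\max_{x\in\Omega}\min_{y\in\partial\Omega}|x-y|$. $|\Omega|$, $|\omega_h|$ are Lebesgue measures and $|\partial\Omega|$ is the $(d-1)$-dimensional Hausdorff measure of the boundary (finite by the assumption). *)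

theory Defs
  imports "HOL-Analysis.Analysis" "HOL-Library.Landau_Symbols"
begin

section \<open>Geometry of the domain\<close>

definition bounded_domain :: "'a::euclidean_space set \<Rightarrow> bool" where
  "bounded_domain \<Omega> \<longleftrightarrow> open \<Omega> \<and> connected \<Omega> \<and> \<Omega> \<noteq> {} \<and> bounded \<Omega>"

definition boundary_collar :: "'a::euclidean_space set \<Rightarrow> real \<Rightarrow> 'a set" where
  "boundary_collar \<Omega> h = {x \<in> \<Omega>. infdist x (frontier \<Omega>) \<le> h}"

definition inradius :: "'a::euclidean_space set \<Rightarrow> real" where
  "inradius \<Omega> = (SUP x\<in>\<Omega>. infdist x (frontier \<Omega>))"

text \<open>
  The \<open>k\<close>-dimensional Hausdorff measure is normalised by the volume of the
  \<open>k\<close>-dimensional unit ball, so that it agrees with surface measure on smooth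
  hypersurfaces.  The case distinction on the empty set only matters for \<open>k = 0\<close>,
  because of \<open>0 ^ 0 = 1\<close>.
\<close>

definition hausdorff_gauge :: "nat \<Rightarrow> 'a::metric_space set \<Rightarrow> real" where
  "hausdorff_gauge k U =
     (if U = {} then 0 else unit_ball_vol (real k) * (diameter U / 2) ^ k)"

definition hausdorff_premeasure :: "nat \<Rightarrow> real \<Rightarrow> 'a::metric_space set \<Rightarrow> ennreal" where
  "hausdorff_premeasure k \<delta> A =
     (INF U \<in> {U :: nat \<Rightarrow> 'a set. A \<subseteq> (\<Union>i. U i) \<and> (\<forall>i. bounded (U i) \<and> diameter (U i) \<le> \<delta>)}.
        (\<Sum>i. ennreal (hausdorff_gauge k (U i))))"

definition hausdorff_measure :: "nat \<Rightarrow> 'a::metric_space set \<Rightarrow> ennreal" where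
  "hausdorff_measure k A = (SUP \<delta> \<in> {0<..}. hausdorff_premeasure k \<delta> A)"

definition boundary_measure :: "'a::euclidean_space set \<Rightarrow> ennreal" where
  "boundary_measure \<Omega> = hausdorff_measure (DIM('a) - 1) (frontier \<Omega>)"


section \<open>Sobolev spaces\<close>

text \<open>
  Functions on \<open>\<Omega>\<close> are represented by functions on the whole space whose values
  outside \<open>\<Omega>\<close> are irrelevant, and elements of \<open>L\<^sup>2(\<Omega>)\<close> by representatives
  rather than by classes modulo equality almost everywhere.
\<close>

definition square_integrable_on ::
    "'a::euclidean_space set \<Rightarrow> ('a \<Rightarrow> 'b::euclidean_space) \<Rightarrow> bool" where
  "square_integrable_on \<Omega> f \<longleftrightarrow>
     f \<in> borel_measurable (lebesgue_on \<Omega>) \<and> integrable (lebesgue_on \<Omega>) (\<lambda>x. (norm (f x))\<^sup>2)"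

primrec C_k :: "nat \<Rightarrow> ('a::euclidean_space \<Rightarrow> real) \<Rightarrow> bool" where
  "C_k 0 f \<longleftrightarrow> continuous_on UNIV f"
| "C_k (Suc k) f \<longleftrightarrow> (\<forall>x. f differentiable (at x)) \<and>
     (\<forall>b\<in>Basis. C_k k (\<lambda>x. frechet_derivative f (at x) b))"

text \<open>The space \<open>C\<^sub>c\<^sup>\<infinity>(\<Omega>)\<close>, its elements being extended by zero.\<close>

definition test_function :: "'a::euclidean_space set \<Rightarrow> ('a \<Rightarrow> real) \<Rightarrow> bool" where
  "test_function \<Omega> \<phi> \<longleftrightarrow> (\<forall>k. C_k k \<phi>) \<and>
     compact (closure {x. \<phi> x \<noteq> 0}) \<and> closure {x. \<phi> x \<noteq> 0} \<subseteq> \<Omega>"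

definition gradient :: "('a::euclidean_space \<Rightarrow> real) \<Rightarrow> 'a \<Rightarrow> 'a" where
  "gradient f x = (\<Sum>b\<in>Basis. frechet_derivative f (at x) b *\<^sub>R b)"

definition is_weak_gradient ::
    "'a::euclidean_space set \<Rightarrow> ('a \<Rightarrow> real) \<Rightarrow> ('a \<Rightarrow> 'a) \<Rightarrow> bool" where
  "is_weak_gradient \<Omega> u g \<longleftrightarrow>
     (\<forall>\<phi>. test_function \<Omega> \<phi> \<longrightarrow>
        (LINT x|lebesgue_on \<Omega>. u x *\<^sub>R gradient \<phi> x) = - (LINT x|lebesgue_on \<Omega>. \<phi> x *\<^sub>R g x))"

definition H1 :: "'a::euclidean_space set \<Rightarrow> ('a \<Rightarrow> real) set" where
  "H1 \<Omega> = {u. square_integrable_on \<Omega> u \<and>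
     (\<exists>g. square_integrable_on \<Omega> g \<and> is_weak_gradient \<Omega> u g)}"

text \<open>Unique up to equality almost everywhere for \<open>u \<in> H1 \<Omega>\<close>, \<open>\<Omega>\<close> open.\<close>

definition weak_gradient :: "'a::euclidean_space set \<Rightarrow> ('a \<Rightarrow> real) \<Rightarrow> 'a \<Rightarrow> 'a" where
  "weak_gradient \<Omega> u = (SOME g. square_integrable_on \<Omega> g \<and> is_weak_gradient \<Omega> u g)"

text \<open>\<open>H\<^sub>0\<^sup>1(\<Omega>)\<close> is the closure of \<open>C\<^sub>c\<^sup>\<infinity>(\<Omega>)\<close> with respect to the norm of \<open>H\<^sup>1(\<Omega>)\<close>.\<close>

definition H10 :: "'a::euclidean_space set \<Rightarrow> ('a \<Rightarrow> real) set" where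
  "H10 \<Omega> = {u \<in> H1 \<Omega>. \<exists>\<phi> :: nat \<Rightarrow> 'a \<Rightarrow> real. (\<forall>k. test_function \<Omega> (\<phi> k)) \<and>
     (\<lambda>k. (LINT x|lebesgue_on \<Omega>. (\<phi> k x - u x)\<^sup>2) +
          (LINT x|lebesgue_on \<Omega>. (norm (gradient (\<phi> k) x - weak_gradient \<Omega> u x))\<^sup>2))
       \<longlonglongrightarrow> 0}"


section \<open>The Dirichlet Laplacian and its eigenvalues\<close>

text \<open>
  \<open>dirichlet_laplacian \<Omega> u f\<close> means that \<open>u\<close> lies in the domain of the self-adjoint
  operator on \<open>L\<^sup>2(\<Omega>)\<close> associated with the closed quadratic form
  \<open>u \<mapsto> \<integral>\<^sub>\<Omega> |\<nabla>u|\<^sup>2\<close> on \<open>H\<^sub>0\<^sup>1(\<Omega>)\<close>, and that this operator, the nonnegative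
  Dirichlet Laplacian, maps \<open>u\<close> to \<open>f\<close>.
  Real-valued functions suffice: the operator is the complexification of its real part, so the
  eigenvalues and their multiplicities are the same over both fields.
\<close>

definition dirichlet_laplacian ::
    "'a::euclidean_space set \<Rightarrow> ('a \<Rightarrow> real) \<Rightarrow> ('a \<Rightarrow> real) \<Rightarrow> bool" where
  "dirichlet_laplacian \<Omega> u f \<longleftrightarrow> u \<in> H10 \<Omega> \<and> square_integrable_on \<Omega> f \<and>
     (\<forall>v\<in>H10 \<Omega>. (LINT x|lebesgue_on \<Omega>. weak_gradient \<Omega> u x \<bullet> weak_gradient \<Omega> v x) =
        (LINT x|lebesgue_on \<Omega>. f x * v x))"

definition dirichlet_eigenspace :: "'a::euclidean_space set \<Rightarrow> real \<Rightarrow> ('a \<Rightarrow> real) set" where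
  "dirichlet_eigenspace \<Omega> \<mu> = {u. dirichlet_laplacian \<Omega> u (\<lambda>x. \<mu> * u x)}"

text \<open>
  Finite dimension of a space of functions modulo equality almost everywhere:
  existence of a basis with \<open>n\<close> elements.
\<close>

definition has_dimension_ae :: "'a measure \<Rightarrow> ('a \<Rightarrow> real) set \<Rightarrow> nat \<Rightarrow> bool" where
  "has_dimension_ae M E n \<longleftrightarrow> (\<exists>e :: nat \<Rightarrow> 'a \<Rightarrow> real.
     (\<forall>i<n. e i \<in> E) \<and>
     (\<forall>c :: nat \<Rightarrow> real. (AE x in M. (\<Sum>i<n. c i * e i x) = 0) \<longrightarrow> (\<forall>i<n. c i = 0)) \<and>
     (\<forall>u\<in>E. \<exists>c :: nat \<Rightarrow> real. AE x in M. u x = (\<Sum>i<n. c i * e i x)))"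

text \<open>
  \<open>ev 0 \<le> ev 1 \<le> \<dots>\<close> lists all eigenvalues, each as often as its multiplicity; the index
  starts at \<open>0\<close>, so \<open>ev j\<close> is the eigenvalue usually written \<open>\<lambda>\<^sub>j\<^sub>+\<^sub>1\<close>.
  A number \<open>\<mu>\<close> that is not an eigenvalue has a zero-dimensional eigenspace and is
  therefore not listed.
\<close>

definition dirichlet_eigenvalues :: "'a::euclidean_space set \<Rightarrow> (nat \<Rightarrow> real) \<Rightarrow> bool" where
  "dirichlet_eigenvalues \<Omega> ev \<longleftrightarrow> mono ev \<and>
     (\<forall>\<mu>. finite {j. ev j = \<mu>} \<and>
        has_dimension_ae (lebesgue_on \<Omega>) (dirichlet_eigenspace \<Omega> \<mu>) (card {j. ev j = \<mu>}))"

end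

theory Submission
  imports Defs "HOL-Complex_Analysis.Great_Picard" "HOL-Real_Asymp.Real_Asymp"
    "HOL-Library.Function_Algebras" "HOL-Probability.Distributions"
begin

text \<open>
  Test the heat semigroup with the coherent states \<open>\<phi>\<close> \<open>e\<^sup>i\<^sup>p\<^sup>x\<close>, where \<open>p\<close> runs through the dual lattice
  of a large cube of side \<open>L\<close> and \<open>0 \<le> \<phi> \<le> 1\<close> is a test function.  Expanding in eigenfunctions \<open>u\<^sub>j\<close>,
  Bessel's inequality bounds \<open>\<Sum>\<^sub>p |\<langle>\<phi> e\<^sup>i\<^sup>p\<^sup>x, u\<^sub>j\<rangle>|\<^sup>2\<close> by \<open>L\<^sup>d\<close>, while the tangent inequality
  \<open>e\<^sup>-\<^sup>t\<^sup>\<lambda> \<ge> e\<^sup>-\<^sup>t\<^sup>\<mu> (1 + t\<mu> - t\<lambda>)\<close> at \<open>\<mu> = |p|\<^sup>2\<close> together with \<open>\<integral>|\<nabla>(\<phi> e\<^sup>i\<^sup>p\<^sup>x)|\<^sup>2 = \<integral>|\<nabla>\<phi>|\<^sup>2 + |p|\<^sup>2 \<integral>\<phi>\<^sup>2\<close>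
  bounds the matrix elements of the semigroup below.  Summing over \<open>p\<close> and letting \<open>L \<rightarrow> \<infinity>\<close> gives
  \<open>\<Sum>\<^sub>j e\<^sup>-\<^sup>t\<^sup>\<lambda>\<^sub>j \<ge> (4\<pi>t)\<^sup>-\<^sup>d\<^sup>/\<^sup>2 (\<integral>\<phi>\<^sup>2 - t \<integral>|\<nabla>\<phi>|\<^sup>2)\<close>; the choice of a smoothed \<open>min 1 (dist(x, \<partial>\<Omega>) / t\<^sup>1\<^sup>/\<^sup>2)\<close>
  turns the bracket into \<open>|\<Omega>| - 2 |\<omega>\<^sub>h|\<close> with \<open>h = t\<^sup>1\<^sup>/\<^sup>2\<close>.

  Completeness of the eigenfunctions and the growth of the eigenvalues both follow from one estimate:
  averages over a grid of \<open>N\<^sup>d\<close> cubes approximate \<open>u\<close> in mean square up to \<open>C N\<^sup>-\<^sup>2 \<integral>|\<nabla>u|\<^sup>2\<close>.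
\<close>

section \<open>Semi-inner products\<close>

text \<open>The list \<open>ev\<close> is known only level by level: each number occurs as often as
  the dimension of its eigenspace. The trace bound consumes one consequence,
  \<open>ev n * ip w w \<le> en w w\<close> for \<open>w\<close> orthogonal to the first
  \<open>n\<close> eigenvectors. A minimiser of the Rayleigh quotient on that complement is itself
  an eigenvector, so its eigenvalue must be listed, with an index not below \<open>n\<close>. The
  semigroup is then never constructed: finite sums over \<open>j < n\<close> replace it, with an
  error of order \<open>1 / ev n\<close> that disappears in the limit. The tangent point |p|^2 is
  the energy of the phase alone; with this choice all terms in |p|^2 cancel. A lattice of momenta in
  place of an integral over p reduces Plancherel to a finite Bessel inequality, and the Gaussian
  integral to Riemann sums. The slope 1/h of the cutoff costs one collar in mass and t/h^2 collars
  in energy. If the collar measure is about h times the boundary measure, the loss is proportional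
  to h + t/h, which is least at h = \<open>sqrt t\<close>; there both losses are equal, whence the
  factor 2.\<close>

lemma span_image_sum:
  fixes e :: "'i \<Rightarrow> 'v::real_vector"
  assumes "finite I" "x \<in> span (e ` I)"
  shows "\<exists>c. x = (\<Sum>i\<in>I. c i *\<^sub>R e i)"
  using assms(2)
proof (induction rule: span_induct_alt)
  case base
  show ?case by (rule exI[of _ "\<lambda>_. 0"]) simp
next
  case (step a x y)
  then obtain i c where i: "i \<in> I" "x = e i" and c: "y = (\<Sum>i\<in>I. c i *\<^sub>R e i)" by auto
  \<comment> \<open>Only the coefficient at one chosen index changes, so \<open>e\<close> may repeat
    vectors on \<open>I\<close>.\<close>
  have "(\<Sum>k\<in>I. (c k + (if k = i then a else 0)) *\<^sub>R e k)
      = y + (\<Sum>k\<in>I. if k = i then a *\<^sub>R e k else 0)"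
    unfolding c sum.distrib[symmetric] by (rule sum.cong) (auto simp: scaleR_add_left)
  also have "\<dots> = a *\<^sub>R x + y" using i assms(1) by (simp add: sum.delta)
  finally show ?case by (intro exI[of _ "\<lambda>k. c k + (if k = i then a else 0)"]) simp
qed

text \<open>Semidefinite rather than definite, because functions are representatives and a nonzero
  function may vanish almost everywhere. The algebraic laws are demanded on \<open>V\<close> only:
  for functions that are not integrable the integral takes a default value and is not
  additive.\<close>

locale psd_form =
  fixes V :: "'v::real_vector set" and b :: "'v \<Rightarrow> 'v \<Rightarrow> real"
  assumes subspace_V: "subspace V"
    and add_left: "\<lbrakk>u \<in> V; v \<in> V; w \<in> V\<rbrakk> \<Longrightarrow> b (u + v) w = b u w + b v w"
    and scale_left: "\<lbrakk>u \<in> V; w \<in> V\<rbrakk> \<Longrightarrow> b (c *\<^sub>R u) w = c * b u w"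
    and sym: "\<lbrakk>u \<in> V; w \<in> V\<rbrakk> \<Longrightarrow> b u w = b w u"
    and nonneg: "u \<in> V \<Longrightarrow> 0 \<le> b u u"
begin

lemma closed [simp]:
  "0 \<in> V" "\<lbrakk>u \<in> V; v \<in> V\<rbrakk> \<Longrightarrow> u + v \<in> V" "\<lbrakk>u \<in> V; v \<in> V\<rbrakk> \<Longrightarrow> u - v \<in> V"
  "u \<in> V \<Longrightarrow> c *\<^sub>R u \<in> V" "(\<And>i. i \<in> I \<Longrightarrow> f i \<in> V) \<Longrightarrow> (\<Sum>i\<in>I. f i) \<in> V"
  using subspace_V by (auto simp: subspace_0 subspace_add subspace_diff subspace_scale subspace_sum)

lemma add_right: "\<lbrakk>u \<in> V; v \<in> V; w \<in> V\<rbrakk> \<Longrightarrow> b w (u + v) = b w u + b w v"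
  by (simp add: sym[of w] add_left)

lemma scale_right: "\<lbrakk>u \<in> V; w \<in> V\<rbrakk> \<Longrightarrow> b w (c *\<^sub>R u) = c * b w u"
  by (simp add: sym[of w] scale_left)

lemma diff_left: "\<lbrakk>u \<in> V; v \<in> V; w \<in> V\<rbrakk> \<Longrightarrow> b (u - v) w = b u w - b v w"
  using add_left[of "u - v" v w] by simp

lemma diff_right: "\<lbrakk>u \<in> V; v \<in> V; w \<in> V\<rbrakk> \<Longrightarrow> b w (u - v) = b w u - b w v"
  using add_right[of "u - v" v w] by simp

lemma zero_left [simp]: "w \<in> V \<Longrightarrow> b 0 w = 0"
  using diff_left[of w w w] by simp

lemma zero_right [simp]: "w \<in> V \<Longrightarrow> b w 0 = 0"
  using diff_right[of w w w] by simp

lemma sum_left: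
  "\<lbrakk>\<And>i. i \<in> I \<Longrightarrow> f i \<in> V; w \<in> V\<rbrakk> \<Longrightarrow> b (\<Sum>i\<in>I. f i) w = (\<Sum>i\<in>I. b (f i) w)"
proof (induction I rule: infinite_finite_induct)
  case (insert x F)
  then show ?case by (simp add: add_left)
qed auto

lemma sum_right:
  "\<lbrakk>\<And>i. i \<in> I \<Longrightarrow> f i \<in> V; w \<in> V\<rbrakk> \<Longrightarrow> b w (\<Sum>i\<in>I. f i) = (\<Sum>i\<in>I. b w (f i))"
  by (simp add: sym[of w] sum_left) 

lemma square_add: "\<lbrakk>u \<in> V; v \<in> V\<rbrakk> \<Longrightarrow> b (u + v) (u + v) = b u u + 2 * b u v + b v v"
  using sym[of u v] by (simp add: add_left add_right)

lemma square_diff: "\<lbrakk>u \<in> V; v \<in> V\<rbrakk> \<Longrightarrow> b (u - v) (u - v) = b u u - 2 * b u v + b v v"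
  using sym[of u v] by (simp add: diff_left diff_right)

lemma cauchy_schwarz:
  assumes "u \<in> V" "v \<in> V"
  shows "(b u v)\<^sup>2 \<le> b u u * b v v"
proof -
  have q: "0 \<le> b u u + 2 * c * b u v + c\<^sup>2 * b v v" for c
    using nonneg[of "u + c *\<^sub>R v"] assms
    by (simp add: square_add scale_left scale_right power2_eq_square mult.assoc)
  show ?thesis
  proof (cases "b v v = 0")
    case True
    \<comment> \<open>For a null \<open>v\<close> the quadratic \<open>q\<close> is affine in
      \<open>c\<close>; a nonzero slope would allow it the value -1.\<close>
    have "b u v = 0"
    proof (rule ccontr)
      assume "b u v \<noteq> 0"
      then show False
        using q[of "- (b u u + 1) / (2 * b u v)"] True by (simp add: field_simps)
    qed
    then show ?thesis using True by simp
  next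
    case False
    then have "b v v > 0" using nonneg[OF assms(2)] by simp
    then show ?thesis using q[of "- b u v / b v v"]
      by (simp add: field_simps power2_eq_square)
  qed
qed

lemma null_left: "\<lbrakk>u \<in> V; v \<in> V; b u u = 0\<rbrakk> \<Longrightarrow> b u v = 0"
  using cauchy_schwarz[of u v] by simp

lemma null_right: "\<lbrakk>u \<in> V; v \<in> V; b v v = 0\<rbrakk> \<Longrightarrow> b u v = 0"
  using cauchy_schwarz[of u v] by simp

lemma tendsto_left:
  assumes "\<And>n. x n \<in> V" "y \<in> V" "z \<in> V" "(\<lambda>n. b (x n - y) (x n - y)) \<longlonglongrightarrow> 0"
  shows "(\<lambda>n. b (x n) z) \<longlonglongrightarrow> b y z"
proof -
  have "(\<lambda>n. sqrt (b (x n - y) (x n - y) * b z z)) \<longlonglongrightarrow> sqrt (0 * b z z)"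
    by (intro tendsto_intros assms)
  then have *: "(\<lambda>n. sqrt (b (x n - y) (x n - y) * b z z)) \<longlonglongrightarrow> 0" by simp
  have "(\<lambda>n. b (x n) z - b y z) \<longlonglongrightarrow> 0"
  proof (rule Lim_null_comparison[OF always_eventually *], rule allI)
    fix n
    have "b (x n) z - b y z = b (x n - y) z" using assms by (simp add: diff_left)
    then show "norm (b (x n) z - b y z) \<le> sqrt (b (x n - y) (x n - y) * b z z)"
      using cauchy_schwarz[of "x n - y" z] assms by (simp add: real_le_rsqrt)
  qed
  then show ?thesis by (simp add: LIM_zero_iff)
qed

lemma tendsto_square:
  assumes "\<And>n. x n \<in> V" "y \<in> V" "(\<lambda>n. b (x n - y) (x n - y)) \<longlonglongrightarrow> 0"
  shows "(\<lambda>n. b (x n) (x n)) \<longlonglongrightarrow> b y y"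
proof -
  have "(\<lambda>n. b (x n - y) (x n - y) + 2 * b (x n) y - b y y) \<longlonglongrightarrow> 0 + 2 * b y y - b y y"
    by (intro tendsto_intros assms tendsto_left)
  moreover have "b (x n - y) (x n - y) + 2 * b (x n) y - b y y = b (x n) (x n)" for n
    using assms by (simp add: square_diff)
  ultimately show ?thesis by simp
qed

definition orthonormal :: "('i \<Rightarrow> 'v) \<Rightarrow> 'i set \<Rightarrow> bool" where
  "orthonormal f I \<longleftrightarrow> (\<forall>i\<in>I. f i \<in> V) \<and> (\<forall>i\<in>I. \<forall>j\<in>I. b (f i) (f j) = of_bool (i = j))"

definition residual :: "('i \<Rightarrow> 'v) \<Rightarrow> 'i set \<Rightarrow> 'v \<Rightarrow> 'v" where
  "residual f I v = v - (\<Sum>i\<in>I. b v (f i) *\<^sub>R f i)"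

lemma residual_in: "\<lbrakk>orthonormal f I; v \<in> V\<rbrakk> \<Longrightarrow> residual f I v \<in> V"
  by (auto simp: residual_def orthonormal_def)

lemma residual_orth:
  assumes "orthonormal f I" "finite I" "v \<in> V" "j \<in> I"
  shows "b (residual f I v) (f j) = 0"
proof -
  have "b (\<Sum>i\<in>I. b v (f i) *\<^sub>R f i) (f j) = (\<Sum>i\<in>I. if i = j then b v (f i) else 0)"
    using assms by (subst sum_left) (auto simp: orthonormal_def scale_left intro!: sum.cong)
  also have "\<dots> = b v (f j)" using assms by simp
  finally show ?thesis using assms
    by (auto simp: residual_def diff_left orthonormal_def)
qed

lemma residual_square:
  assumes "orthonormal f I" "finite I" "v \<in> V"
  shows "b (residual f I v) (residual f I v) = b v v - (\<Sum>i\<in>I. (b v (f i))\<^sup>2)"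
proof -
  let ?r = "residual f I v" and ?s = "\<Sum>i\<in>I. b v (f i) *\<^sub>R f i"
  have fV: "f i \<in> V" if "i \<in> I" for i using assms that by (auto simp: orthonormal_def)
  then have sV: "?s \<in> V" by auto
  have rV: "?r \<in> V" using residual_in assms by blast
  have r: "?r = v - ?s" by (simp add: residual_def)
  have "b ?r ?s = (\<Sum>i\<in>I. b v (f i) * b ?r (f i))"
    using fV rV by (subst sum_right) (auto simp: scale_right)
  also have "\<dots> = 0" using residual_orth[OF assms] by simp
  finally have "b ?r ?r = b ?r v"
    by (metis diff_right[OF assms(3) sV rV] diff_zero r)
  also have "\<dots> = b v v - b ?s v" unfolding r using diff_left assms sV by blast
  also have "b ?s v = (\<Sum>i\<in>I. b v (f i) * b (f i) v)"
    using fV assms by (subst sum_left) (auto simp: scale_left)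
  also have "\<dots> = (\<Sum>i\<in>I. (b v (f i))\<^sup>2)"
    using fV assms(3) sym by (intro sum.cong) (auto simp: power2_eq_square)
  finally show ?thesis .
qed

lemma bessel:
  assumes "orthonormal f I" "finite I" "v \<in> V"
  shows "(\<Sum>i\<in>I. (b v (f i))\<^sup>2) \<le> b v v"
  using residual_square[OF assms] nonneg[OF residual_in[OF assms(1,3)]] by simp

text \<open>Independence is assumed modulo null vectors: a combination of vanishing square has zero
  coefficients. This makes each residual normalisable, although a nonzero vector may have square
  zero.\<close>

lemma gram_schmidt:
  fixes n :: nat
  assumes "\<And>i. i < n \<Longrightarrow> e i \<in> V"
    and "\<And>c i. b (\<Sum>i<n. c i *\<^sub>R e i) (\<Sum>i<n. c i *\<^sub>R e i) = 0 \<Longrightarrow> i < n \<Longrightarrow> c i = 0"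
  shows "\<exists>f. orthonormal f {..<n} \<and> f ` {..<n} \<subseteq> span (e ` {..<n}) \<and> e ` {..<n} \<subseteq> span (f ` {..<n})"
  using assms
proof (induction n)
  case 0
  then show ?case by (auto simp: orthonormal_def)
next
  case (Suc n)
  have "c i = 0" if "b (\<Sum>i<n. c i *\<^sub>R e i) (\<Sum>i<n. c i *\<^sub>R e i) = 0" "i < n" for c i
  proof -
    let ?c = "\<lambda>i. if i < n then c i else 0"
    have "(\<Sum>i<Suc n. ?c i *\<^sub>R e i) = (\<Sum>i<n. c i *\<^sub>R e i)" by simp
    then show ?thesis using Suc.prems(2)[of ?c i] that by simp
  qed
  then have "\<exists>f. orthonormal f {..<n} \<and> f ` {..<n} \<subseteq> span (e ` {..<n}) \<and> e ` {..<n} \<subseteq> span (f ` {..<n})"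
    using Suc.prems(1) by (intro Suc.IH) auto
  then obtain f where f: "orthonormal f {..<n}" "f ` {..<n} \<subseteq> span (e ` {..<n})"
      "e ` {..<n} \<subseteq> span (f ` {..<n})" by blast
  define r where "r = residual f {..<n} (e n)"
  have rV: "r \<in> V" unfolding r_def using f Suc.prems by (intro residual_in) auto
  have "(\<Sum>i<n. b (e n) (f i) *\<^sub>R f i) \<in> span (e ` {..<n})"
    using f(2) by (intro span_sum span_scale) auto
  then obtain c where c: "(\<Sum>i<n. b (e n) (f i) *\<^sub>R f i) = (\<Sum>i<n. c i *\<^sub>R e i)"
    using span_image_sum[of "{..<n}"] by blast
  \<comment> \<open>The coefficient of \<open>e n\<close> in \<open>r\<close> is 1, so a null
    \<open>r\<close> would contradict independence.\<close>
  have "r = (\<Sum>i<Suc n. (if i = n then 1 else - c i) *\<^sub>R e i)"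
    by (simp add: r_def residual_def c sum_negf)
  then have r0: "b r r \<noteq> 0" using Suc.prems(2)[of "\<lambda>i. if i = n then 1 else - c i" n] by auto
  then have rp: "b r r > 0" using nonneg[OF rV] by simp
  define f' where "f' = f(n := (1 / sqrt (b r r)) *\<^sub>R r)"
  have rf: "b r (f j) = 0" "b (f j) r = 0" if "j < n" for j
    using residual_orth[OF f(1), of "e n" j] that Suc.prems sym f(1) rV
    by (auto simp: r_def orthonormal_def)
  have rr: "b (f' n) (f' n) = 1" using rV rp by (simp add: f'_def scale_left scale_right)
  have 1: "orthonormal f' {..<Suc n}"
    unfolding orthonormal_def
  proof (intro conjI ballI)
    fix i j assume "i \<in> {..<Suc n}" "j \<in> {..<Suc n}"
    then have "i < n \<or> i = n" "j < n \<or> j = n" by auto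
    then show "b (f' i) (f' j) = of_bool (i = j)"
      using f(1) rf rr rV by (auto simp: f'_def orthonormal_def scale_left scale_right)
  qed (use f(1) rV in \<open>auto simp: f'_def orthonormal_def less_Suc_eq\<close>)
  have en: "span (e ` {..<n}) \<subseteq> span (e ` {..<Suc n})" by (intro span_mono) auto
  have fn: "span (f ` {..<n}) \<subseteq> span (f' ` {..<Suc n})"
    by (intro span_mono) (auto simp: f'_def)
  have "r \<in> span (e ` {..<Suc n})" unfolding r_def residual_def
    using f(2) en by (intro span_diff span_sum span_scale) (auto intro: span_base)
  then have 2: "f' ` {..<Suc n} \<subseteq> span (e ` {..<Suc n})"
    using f(2) en by (fastforce simp del: lessThan_Suc simp: f'_def less_Suc_eq intro: span_scale)
  have "r = sqrt (b r r) *\<^sub>R f' n" using rp by (simp add: f'_def)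
  then have "r \<in> span (f' ` {..<Suc n})" by (metis (no_types) lessThan_iff lessI image_eqI span_base span_scale)
  moreover have "e n = r + (\<Sum>i<n. b (e n) (f i) *\<^sub>R f i)" by (simp add: r_def residual_def)
  moreover have "(\<Sum>i<n. b (e n) (f i) *\<^sub>R f i) \<in> span (f' ` {..<Suc n})"
    using fn by (intro span_sum span_scale) (auto intro: span_base)
  ultimately have "e n \<in> span (f' ` {..<Suc n})" by (metis span_add)
  then have 3: "e ` {..<Suc n} \<subseteq> span (f' ` {..<Suc n})"
    using f(3) fn by (fastforce simp del: lessThan_Suc simp: less_Suc_eq)
  show ?case using 1 2 3 by blast
qed

end

section \<open>Eigenvalues of a form with finite-rank approximation\<close>

text \<open>\<open>approx\<close> is compactness of the embedding in quantitative form: up to an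
  energy error of order 1/N^2, \<open>N ^ d\<close> functionals control the square. Because the rank
  is explicit, the same assumption serves both for extracting subsequences and for counting
  eigenvalues. \<open>complete\<close> expresses that the form is closed.\<close>

locale compact_form = ip: psd_form L ip + en: psd_form H en
  for L H :: "'v::real_vector set" and ip en :: "'v \<Rightarrow> 'v \<Rightarrow> real" +
  fixes C :: real and d :: nat
  assumes H_subset: "H \<subseteq> L"
    and complete: "\<lbrakk>\<And>n::nat. w n \<in> H;
        \<And>e. e > 0 \<Longrightarrow> \<exists>N. \<forall>m\<ge>N. \<forall>n\<ge>N. ip (w m - w n) (w m - w n) + en (w m - w n) (w m - w n) < e\<rbrakk>
      \<Longrightarrow> \<exists>u\<in>H. (\<lambda>n. ip (w n - u) (w n - u) + en (w n - u) (w n - u)) \<longlonglongrightarrow> 0"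
    and approx: "N > 0 \<Longrightarrow> \<exists>g :: nat \<Rightarrow> 'v. (\<forall>i<N ^ d. g i \<in> L \<and> ip (g i) (g i) \<le> 1) \<and>
        (\<forall>u\<in>H. ip u u \<le> (\<Sum>i<N ^ d. (ip u (g i))\<^sup>2) + C / (real N)\<^sup>2 * en u u)"
    and C_pos: "C > 0"
begin

section \<open>Compactness and minimisation of the Rayleigh quotient\<close>

lemma H_in_L [simp]: "u \<in> H \<Longrightarrow> u \<in> L"
  using H_subset by blast

text \<open>The coefficients against all \<open>g N i\<close>, for every \<open>N\<close> at once,
  form a bounded family over a countable index set, so a diagonal subsequence makes all of them
  converge. Then \<open>approx\<close> at a single large \<open>N\<close> bounds the square of a
  difference by finitely many convergent coefficients and a small energy term.\<close>

lemma rellich: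
  fixes w :: "nat \<Rightarrow> 'v"
  assumes w: "\<And>n. w n \<in> H" and B: "\<And>n. ip (w n) (w n) \<le> B" "\<And>n. en (w n) (w n) \<le> B"
  obtains r :: "nat \<Rightarrow> nat" where "strict_mono r"
    "\<And>e. e > 0 \<Longrightarrow> \<exists>M. \<forall>m\<ge>M. \<forall>n\<ge>M. ip (w (r m) - w (r n)) (w (r m) - w (r n)) < e"
proof -
  have B0: "0 \<le> B" using en.nonneg[OF w] B(2) order_trans by blast
  obtain g where g: "\<And>N i. N > 0 \<Longrightarrow> i < N ^ d \<Longrightarrow> g N i \<in> L \<and> ip (g N i) (g N i) \<le> 1"
    and ap: "\<And>N u. N > 0 \<Longrightarrow> u \<in> H \<Longrightarrow>
        ip u u \<le> (\<Sum>i<N ^ d. (ip u (g N i))\<^sup>2) + C / (real N)\<^sup>2 * en u u"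
  proof -
    from approx have "\<forall>N. \<exists>g :: nat \<Rightarrow> 'v. N > 0 \<longrightarrow> (\<forall>i<N ^ d. g i \<in> L \<and> ip (g i) (g i) \<le> 1) \<and>
        (\<forall>u\<in>H. ip u u \<le> (\<Sum>i<N ^ d. (ip u (g i))\<^sup>2) + C / (real N)\<^sup>2 * en u u)" by blast
    from choice[OF this] that show thesis by blast
  qed
  define f where "f n = (\<lambda>(N, i). if N > 0 \<and> i < N ^ d then ip (w n) (g N i) else 0)" for n
  have fB: "norm (f n x) \<le> sqrt B" for n x
  proof (cases x)
    case (Pair N i)
    show ?thesis
    proof (cases "N > 0 \<and> i < N ^ d")
      case True
      have "(ip (w n) (g N i))\<^sup>2 \<le> ip (w n) (w n) * ip (g N i) (g N i)"
        using True g w by (intro ip.cauchy_schwarz) auto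
      also have "\<dots> \<le> B * 1" using True g w B B0 ip.nonneg by (intro mult_mono) auto
      finally show ?thesis using True Pair by (auto simp: f_def intro: real_le_rsqrt)
    qed (use Pair B0 in \<open>auto simp: f_def\<close>)
  qed
  obtain r :: "nat \<Rightarrow> nat" where r: "strict_mono r"
    "\<And>x. x \<in> UNIV \<Longrightarrow> \<exists>l. (\<lambda>n. f (r n) x) \<longlonglongrightarrow> l"
    by (rule function_convergent_subsequence[of UNIV f "sqrt B", OF _ fB]) auto
  show thesis
  proof (rule that[OF r(1)])
    fix e :: real assume e: "e > 0"
    \<comment> \<open>The energy of a difference will be at most \<open>4 * B\<close>; as
      \<open>N\<close> is at most its square, this choice keeps the energy term of
      \<open>approx\<close> below \<open>e / 2\<close>.\<close>
    obtain N :: nat where N: "N > 8 * C * B / e" "N > 0"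
      using reals_Archimedean2[of "max 1 (8 * C * B / e)"] by auto
    have "real N \<le> (real N)\<^sup>2" using N(2) by (simp add: power2_eq_square)
    then have "8 * C * B / e < (real N)\<^sup>2" using N by linarith
    then have N2: "C / (real N)\<^sup>2 * (4 * B) < e / 2" using e N(2) by (simp add: field_simps)
    from r(2) have "\<forall>i. \<exists>l. (\<lambda>n. f (r n) (N, i)) \<longlonglongrightarrow> l" by blast
    from choice[OF this] obtain l where l: "\<And>i. (\<lambda>n. f (r n) (N, i)) \<longlonglongrightarrow> l i" by blast
    have "(\<lambda>n. \<Sum>i<N ^ d. (f (r n) (N, i) - l i)\<^sup>2) \<longlonglongrightarrow> (\<Sum>i<N ^ d. (l i - l i)\<^sup>2)"
      by (intro tendsto_intros l)
    then have "(\<lambda>n. \<Sum>i<N ^ d. (f (r n) (N, i) - l i)\<^sup>2) \<longlonglongrightarrow> 0" by simp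
    then have "eventually (\<lambda>n. (\<Sum>i<N ^ d. (f (r n) (N, i) - l i)\<^sup>2) < e / 8) sequentially"
      using e by (intro order_tendstoD) auto
    then obtain M where M: "\<And>n. n \<ge> M \<Longrightarrow> (\<Sum>i<N ^ d. (f (r n) (N, i) - l i)\<^sup>2) < e / 8"
      unfolding eventually_sequentially by blast
    have "ip (w (r m) - w (r n)) (w (r m) - w (r n)) < e" if mn: "m \<ge> M" "n \<ge> M" for m n
    proof -
      let ?u = "w (r m) - w (r n)"
      have uH: "?u \<in> H" using w by auto
      \<comment> \<open>Adding the energy of the sum brings in the parallelogram law and removes the
        cross term.\<close>
      have "en ?u ?u \<le> en ?u ?u + en (w (r m) + w (r n)) (w (r m) + w (r n))"
        using en.nonneg w by auto
      also have "\<dots> = 2 * en (w (r m)) (w (r m)) + 2 * en (w (r n)) (w (r n))"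
        using w by (simp add: en.square_diff en.square_add)
      also have "\<dots> \<le> 4 * B" using B(2)[of "r m"] B(2)[of "r n"] by simp
      finally have enu: "en ?u ?u \<le> 4 * B" .
      have 1: "C / (real N)\<^sup>2 * en ?u ?u < e / 2"
        by (rule le_less_trans[OF mult_left_mono[OF enu] N2]) (use C_pos in simp)
      have "(\<Sum>i<N ^ d. (ip ?u (g N i))\<^sup>2)
          \<le> (\<Sum>i<N ^ d. 2 * (f (r m) (N, i) - l i)\<^sup>2 + 2 * (f (r n) (N, i) - l i)\<^sup>2)"
      proof (rule sum_mono)
        fix i assume i: "i \<in> {..<N ^ d}"
        have *: "ip ?u (g N i) = (f (r m) (N, i) - l i) - (f (r n) (N, i) - l i)"
          using i g N(2) w by (simp add: f_def ip.diff_left)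
        have "(a - b)\<^sup>2 \<le> 2 * a\<^sup>2 + 2 * b\<^sup>2" for a b :: real
          using sum_squares_bound[of a "- b"] by (simp add: power2_diff)
        then show "(ip ?u (g N i))\<^sup>2 \<le> 2 * (f (r m) (N, i) - l i)\<^sup>2 + 2 * (f (r n) (N, i) - l i)\<^sup>2"
          unfolding * .
      qed
      also have "\<dots> < 2 * (e / 8) + 2 * (e / 8)"
        using M[OF mn(1)] M[OF mn(2)] by (simp add: sum.distrib sum_distrib_left[symmetric])
      finally show ?thesis using 1 ap[OF N(2) uH] by linarith
    qed
    then show "\<exists>M. \<forall>m\<ge>M. \<forall>n\<ge>M. ip (w (r m) - w (r n)) (w (r m) - w (r n)) < e" by blast
  qed
qed

text \<open>Direct method. A minimising sequence has a subsequence that is Cauchy for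
  \<open>ip\<close> by \<open>rellich\<close>; minimality upgrades this to the energy norm, so
  \<open>complete\<close> yields a limit. The bound is homogeneous in \<open>v\<close> so that null
  vectors are covered too.\<close>

lemma minimiser:
  assumes V: "subspace V" "V \<subseteq> H"
    and V_closed: "\<And>x y. (\<And>n::nat. x n \<in> V) \<Longrightarrow> y \<in> H \<Longrightarrow> (\<lambda>n. ip (x n - y) (x n - y)) \<longlonglongrightarrow> 0 \<Longrightarrow> y \<in> V"
    and w0: "w0 \<in> V" "ip w0 w0 \<noteq> 0"
  shows "\<exists>w\<in>V. ip w w = 1 \<and> (\<forall>v\<in>V. en w w * ip v v \<le> en v v)"
proof -
  have VH: "v \<in> H" if "v \<in> V" for v using that V by blast
  have Vc: "u + v \<in> V" "u - v \<in> V" "c *\<^sub>R u \<in> V" if "u \<in> V" "v \<in> V" for u v c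
    using that V(1) by (auto simp: subspace_add subspace_diff subspace_scale)
  define A where "A = {en w w |w. w \<in> V \<and> ip w w = 1}"
  have scale: "\<exists>a\<in>A. en v v = ip v v * a" if v: "v \<in> V" "ip v v \<noteq> 0" for v
  proof -
    have p: "ip v v > 0" using ip.nonneg[of v] v VH by auto
    let ?u = "(1 / sqrt (ip v v)) *\<^sub>R v"
    have "ip ?u ?u = 1" "en v v = ip v v * en ?u ?u" "?u \<in> V"
      using p v VH[OF v(1)] Vc
      by (auto simp: ip.scale_left ip.scale_right en.scale_left en.scale_right)
    then show ?thesis unfolding A_def by blast
  qed
  have A0: "A \<noteq> {}" using scale[OF w0] by auto
  have bdd: "bdd_below A" unfolding A_def using en.nonneg VH by (intro bdd_belowI[of _ 0]) auto
  define m where "m = Inf A"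
  have mle: "m * ip v v \<le> en v v" if v: "v \<in> V" for v
  proof (cases "ip v v = 0")
    case True
    then show ?thesis using en.nonneg VH[OF v] by simp
  next
    case False
    then obtain a where "a \<in> A" "en v v = ip v v * a" using scale v by blast
    moreover have "m \<le> a" unfolding m_def using bdd \<open>a \<in> A\<close> by (rule cInf_lower[rotated])
    ultimately show ?thesis using ip.nonneg[of v] VH[OF v]
      by (metis H_in_L mult.commute mult_left_mono)
  qed
  have "\<exists>w. w \<in> V \<and> ip w w = 1 \<and> en w w < m + 1 / real (Suc k)" for k
    using cInf_lessD[OF A0, of "m + 1 / real (Suc k)"] unfolding m_def[symmetric]
    by (auto simp: A_def)
  then obtain w where w: "\<And>k. w k \<in> V" "\<And>k. ip (w k) (w k) = 1"
      "\<And>k. en (w k) (w k) < m + 1 / real (Suc k)" by metis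
  have m0: "0 \<le> m" unfolding m_def
    using A0 en.nonneg VH by (intro cInf_greatest) (auto simp: A_def)
  have "en (w k) (w k) \<le> m + 1" for k
    using w(3)[of k] by (smt (verit) divide_le_eq_1_pos of_nat_0_less_iff zero_less_Suc of_nat_Suc of_nat_0_le_iff)
  then obtain r :: "nat \<Rightarrow> nat" where r: "strict_mono r"
    and rc: "\<And>e. e > 0 \<Longrightarrow> \<exists>M. \<forall>m\<ge>M. \<forall>n\<ge>M. ip (w (r m) - w (r n)) (w (r m) - w (r n)) < e"
    using rellich[of w "m + 1"] w m0 VH by auto
  define x where "x = (\<lambda>k. w (r k))"
  have x: "x k \<in> V" "x k \<in> H" "x k \<in> L" "ip (x k) (x k) = 1" "en (x k) (x k) \<le> m + 1 / real (Suc k)" for k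
  proof -
    have "1 / real (Suc (r k)) \<le> 1 / real (Suc k)"
      using seq_suble[OF r, of k] by (intro divide_left_mono) auto
    then show "en (x k) (x k) \<le> m + 1 / real (Suc k)"
      using w(3)[of "r k"] by (simp add: x_def)
  qed (use w VH in \<open>auto simp: x_def\<close>)
  have cauchy: "\<exists>N. \<forall>j\<ge>N. \<forall>k\<ge>N. ip (x j - x k) (x j - x k) + en (x j - x k) (x j - x k) < e"
    if e: "e > 0" for e
  proof -
    \<comment> \<open>The factor \<open>m + 1\<close> is what will multiply the square of the
      difference: 1 from the mass and \<open>m\<close> from the energy.\<close>
    obtain M where M: "\<And>j k. j \<ge> M \<Longrightarrow> k \<ge> M \<Longrightarrow> ip (x j - x k) (x j - x k) < e / (2 * (m + 1))"
      using rc[of "e / (2 * (m + 1))"] e m0 by (auto simp: x_def)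
    obtain K :: nat where K: "K > 8 / e" using reals_Archimedean2 by blast
    have "ip (x j - x k) (x j - x k) + en (x j - x k) (x j - x k) < e"
      if jk: "j \<ge> max M K" "k \<ge> max M K" for j k
    proof -
      have K': "1 / real (Suc i) < e / 8" if "i \<ge> K" for i
      proof -
        have "real (Suc i) > 8 / e" using K that by simp
        then show ?thesis using e by (simp add: field_simps)
      qed
      \<comment> \<open>Both energies are close to the infimum \<open>m\<close>, and the sum has
        energy at least \<open>m\<close> times its square, which is close to 4; so little energy is
        left for the difference.\<close>
      have "en (x j - x k) (x j - x k)
          = 2 * en (x j) (x j) + 2 * en (x k) (x k) - en (x j + x k) (x j + x k)"
        using x by (simp add: en.square_diff en.square_add)
      also have "\<dots> \<le> 2 * (m + 1 / real (Suc j)) + 2 * (m + 1 / real (Suc k)) - m * ip (x j + x k) (x j + x k)"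
        using x mle[of "x j + x k"] Vc[of "x j" "x k"] by (smt (verit))
      also have "ip (x j + x k) (x j + x k) = 4 - ip (x j - x k) (x j - x k)"
        using x by (simp add: ip.square_diff ip.square_add)
      finally have "ip (x j - x k) (x j - x k) + en (x j - x k) (x j - x k)
          \<le> 2 * (1 / real (Suc j)) + 2 * (1 / real (Suc k)) + (m + 1) * ip (x j - x k) (x j - x k)"
        by (simp add: algebra_simps)
      also have "\<dots> < 2 * (e / 8) + 2 * (e / 8) + (m + 1) * (e / (2 * (m + 1)))"
        using K'[of j] K'[of k] M[of j k] jk m0
        by (intro add_strict_mono mult_strict_left_mono) auto
      also have "\<dots> = e" using m0 by (simp add: field_simps)
      finally show ?thesis .
    qed
    then show ?thesis by blast
  qed
  obtain y where y: "y \<in> H" "(\<lambda>n. ip (x n - y) (x n - y) + en (x n - y) (x n - y)) \<longlonglongrightarrow> 0"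
    using complete[OF x(2) cauchy] by blast
  have yi: "(\<lambda>n. ip (x n - y) (x n - y)) \<longlonglongrightarrow> 0"
    by (rule tendsto_sandwich[OF _ _ tendsto_const y(2)])
      (use x y ip.nonneg en.nonneg in \<open>auto intro!: always_eventually\<close>)
  have ye: "(\<lambda>n. en (x n - y) (x n - y)) \<longlonglongrightarrow> 0"
    by (rule tendsto_sandwich[OF _ _ tendsto_const y(2)])
      (use x y ip.nonneg en.nonneg in \<open>auto intro!: always_eventually\<close>)
  have yV: "y \<in> V" using V_closed x(1) y(1) yi by blast
  have "(\<lambda>n. ip (x n) (x n)) \<longlonglongrightarrow> ip y y" using x y(1) yi by (intro ip.tendsto_square) auto
  then have y1: "ip y y = 1" using x(4) by (simp add: LIMSEQ_const_iff)
  have "(\<lambda>n. en (x n) (x n)) \<longlonglongrightarrow> en y y" using x y(1) ye by (intro en.tendsto_square) auto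
  moreover have "(\<lambda>n. m + 1 / real (Suc n)) \<longlonglongrightarrow> m + 0"
    by (intro tendsto_intros LIMSEQ_Suc lim_1_over_n)
  ultimately have "en y y \<le> m + 0" using x(5) by (intro LIMSEQ_le) blast+
  then show ?thesis using y1 yV mle ip.nonneg VH
    by (intro bexI[of _ y]) (auto intro: order_trans[OF mult_right_mono])
qed

definition eigenspace :: "real \<Rightarrow> 'v set" where
  "eigenspace \<mu> = {u \<in> H. \<forall>v\<in>H. en u v = \<mu> * ip u v}"

text \<open>With \<open>\<lambda>\<close> the minimal energy, the form
  \<open>en - \<lambda> * ip\<close> is semidefinite on the complement and vanishes at the
  minimiser, so Cauchy--Schwarz kills its pairing with every vector there. Against each
  \<open>u j\<close> both forms vanish because \<open>u j\<close> is an eigenvector; the weak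
  equation therefore holds on all of \<open>H\<close>.\<close>

lemma minimiser_orthogonal_eigen:
  fixes u :: "nat \<Rightarrow> 'v"
  assumes on: "ip.orthonormal u {..<n}" and eig: "\<And>j. j < n \<Longrightarrow> u j \<in> eigenspace (l j)"
    and w0: "w0 \<in> H" "\<And>j. j < n \<Longrightarrow> ip w0 (u j) = 0" "ip w0 w0 \<noteq> 0"
  obtains w where "w \<in> eigenspace (en w w)" "\<And>j. j < n \<Longrightarrow> ip w (u j) = 0" "ip w w = 1"
    "en w w * ip w0 w0 \<le> en w0 w0"
proof -
  define V where "V = {w \<in> H. \<forall>j<n. ip w (u j) = 0}"
  have uH: "u j \<in> H" if "j < n" for j using eig[OF that] by (auto simp: eigenspace_def)
  have sV: "subspace V"
    unfolding subspace_def V_def using uH by (auto simp: ip.add_left ip.scale_left)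
  have "y \<in> V" if x: "\<And>n::nat. x n \<in> V" and y: "y \<in> H" "(\<lambda>n. ip (x n - y) (x n - y)) \<longlonglongrightarrow> 0" for x y
  proof -
    have "ip y (u j) = 0" if j: "j < n" for j
    proof -
      have "(\<lambda>n. ip (x n) (u j)) \<longlonglongrightarrow> ip y (u j)"
        using x y uH[OF j] by (intro ip.tendsto_left) (auto simp: V_def)
      then show ?thesis using x j by (simp add: V_def LIMSEQ_const_iff)
    qed
    then show ?thesis using y by (simp add: V_def)
  qed
  with minimiser[of V w0] sV w0 obtain w where w: "w \<in> V" "ip w w = 1" "\<And>v. v \<in> V \<Longrightarrow> en w w * ip v v \<le> en v v"
    by (auto simp: V_def)
  have wH: "w \<in> H" using w by (auto simp: V_def)
  let ?b = "\<lambda>u v. en u v - en w w * ip u v"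
  interpret q: psd_form V ?b
  proof
    show "?b u w = ?b w u" if "u \<in> V" "w \<in> V" for u w
      using that en.sym[of u w] ip.sym[of u w] by (simp add: V_def)
  qed (use sV w(3) in \<open>auto simp: V_def en.add_left ip.add_left en.scale_left ip.scale_left algebra_simps\<close>)
  have "w \<in> eigenspace (en w w)"
    unfolding eigenspace_def
  proof (intro CollectI conjI ballI wH)
    fix v assume v: "v \<in> H"
    let ?v = "ip.residual u {..<n} v"
    let ?s = "\<Sum>i<n. ip v (u i) *\<^sub>R u i"
    have sH: "?s \<in> H" using uH by (intro en.closed(5) en.closed(4)) auto
    have vs: "v = ?v + ?s" by (simp add: ip.residual_def)
    have vH: "?v \<in> H" unfolding ip.residual_def using v sH by (rule en.closed(3))
    have "?v \<in> V" unfolding V_def using v vH ip.residual_orth[OF on, of v] by auto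
    moreover have "?b w w = 0" using w(2) by simp
    ultimately have "?b w ?v = 0" using q.null_left w(1) by blast
    moreover have bj: "en w (u j) = en w w * ip w (u j)" if "j < n" for j
      using that w eig[OF that] en.sym[OF wH uH[OF that]] ip.sym[of w "u j"] wH uH[OF that]
      by (auto simp: eigenspace_def V_def)
    moreover have e1: "en w v = en w ?v + en w ?s"
      using arg_cong[OF vs, of "en w"] en.add_right[OF vH sH wH] by (rule trans)
    moreover have i1: "ip w v = ip w ?v + ip w ?s"
      using arg_cong[OF vs, of "ip w"] ip.add_right[OF H_in_L[OF vH] H_in_L[OF sH] H_in_L[OF wH]]
      by (rule trans)
    moreover have e2: "en w ?s = (\<Sum>i<n. ip v (u i) * en w (u i))"
      using uH wH by (subst en.sum_right) (auto simp: en.scale_right)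
    moreover have i2: "ip w ?s = (\<Sum>i<n. ip v (u i) * ip w (u i))"
      using uH wH by (subst ip.sum_right) (auto simp: ip.scale_right)
    moreover have "(\<Sum>i<n. ip v (u i) * en w (u i)) = en w w * (\<Sum>i<n. ip v (u i) * ip w (u i))"
      unfolding sum_distrib_left using bj by (intro sum.cong) auto
    ultimately show "en w v = en w w * ip w v"
      by (simp add: algebra_simps)
  qed
  then show thesis using that w w0 by (auto simp: V_def)
qed

end

section \<open>Complete eigenbases, eigenvalue growth and the truncated trace\<close>

lemma polynomial_le_exp:
  fixes t C :: real
  assumes "t > 0" "C > 0"
  obtains K where "K > 0" "\<And>\<Lambda>. \<Lambda> \<ge> 0 \<Longrightarrow> (2 + sqrt (2 * C * \<Lambda>)) ^ k \<le> K * exp (t * \<Lambda>)"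
proof -
  have "((\<lambda>x. (2 + sqrt (2 * C * x)) ^ k * exp (- (t * x))) \<longlongrightarrow> 0) at_top"
    using assms by real_asymp
  then have "eventually (\<lambda>x. (2 + sqrt (2 * C * x)) ^ k * exp (- (t * x)) < 1) at_top"
    by (rule order_tendstoD) simp
  then obtain M where M: "\<And>x. x \<ge> M \<Longrightarrow> (2 + sqrt (2 * C * x)) ^ k * exp (- (t * x)) < 1"
    unfolding eventually_at_top_linorder by blast
  \<comment> \<open>The second entry covers arguments up to \<open>M\<close>, where monotonicity
    bounds the power; the 1 covers the tail beyond \<open>M\<close>.\<close>
  define K where "K = max 1 ((2 + sqrt (2 * C * max M 0)) ^ k)"
  then have K1: "K \<ge> 1" by simp
  show thesis
  proof (rule that[of K])
    fix x :: real assume x: "x \<ge> 0"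
    show "(2 + sqrt (2 * C * x)) ^ k \<le> K * exp (t * x)"
    proof (cases "x \<ge> M")
      case True
      from M[OF True] have "(2 + sqrt (2 * C * x)) ^ k \<le> exp (t * x)"
        by (simp add: exp_minus field_simps)
      also have "\<dots> \<le> K * exp (t * x)" using K1 by simp
      finally show ?thesis .
    next
      case False
      have "(2 + sqrt (2 * C * x)) ^ k \<le> (2 + sqrt (2 * C * max M 0)) ^ k"
        using False x assms by (intro power_mono add_left_mono real_sqrt_le_mono mult_left_mono) auto
      also have "\<dots> \<le> K" by (simp add: K_def)
      also have "\<dots> \<le> K * exp (t * x)" using mult_left_mono[of 1 "exp (t * x)" K] x assms K1 by simp
      finally show ?thesis .
    qed
  qed (use K1 in simp)
qed

text \<open>\<open>level_basis\<close> is \<open>has_dimension_ae\<close> in abstract form: equality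
  almost everywhere becomes a difference of vanishing square. Only these level-wise facts about
  \<open>ev\<close> are assumed; unboundedness and the Rayleigh bounds are consequences.\<close>

locale compact_form_listing = compact_form L H ip en C d
  for L H :: "'v::real_vector set" and ip en :: "'v \<Rightarrow> 'v \<Rightarrow> real" and C :: real and d :: nat +
  fixes ev :: "nat \<Rightarrow> real"
  assumes mono_ev: "mono ev"
    and finite_level: "finite {j. ev j = \<mu>}"
    and level_basis: "\<exists>e :: nat \<Rightarrow> 'v. (\<forall>i<card {j. ev j = \<mu>}. e i \<in> eigenspace \<mu>) \<and>
      (\<forall>c. (let s = \<Sum>i<card {j. ev j = \<mu>}. c i *\<^sub>R e i in ip s s = 0) \<longrightarrow> (\<forall>i<card {j. ev j = \<mu>}. c i = 0)) \<and>
      (\<forall>u\<in>eigenspace \<mu>. \<exists>c. let s = u - (\<Sum>i<card {j. ev j = \<mu>}. c i *\<^sub>R e i) in ip s s = 0)"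
begin

lemma eigenspace_H: "u \<in> eigenspace \<mu> \<Longrightarrow> u \<in> H"
  by (simp add: eigenspace_def)

lemma subspace_eigenspace: "subspace (eigenspace \<mu>)"
  unfolding subspace_def eigenspace_def
  by (auto simp: en.add_left ip.add_left en.scale_left ip.scale_left algebra_simps)

lemma eigenspace_orthogonal:
  assumes "u \<in> eigenspace \<mu>" "v \<in> eigenspace \<nu>" "\<mu> \<noteq> \<nu>"
  shows "ip u v = 0"
proof -
  have uv: "u \<in> H" "v \<in> H" using assms eigenspace_H by auto
  have "\<mu> * ip u v = \<nu> * ip u v"
    using assms uv en.sym[OF uv] ip.sym[of u v] by (auto simp: eigenspace_def)
  then show ?thesis using assms(3) by simp
qed

text \<open>The bijection \<open>h\<close> transports a Gram--Schmidt basis of the eigenspace to the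
  very indices \<open>j\<close> with \<open>ev j = \<mu>\<close>, so that the bases of all levels
  fit together into one sequence.\<close>

lemma level_orthonormal_basis:
  "\<exists>f :: nat \<Rightarrow> 'v. ip.orthonormal f {j. ev j = \<mu>} \<and> (\<forall>j. ev j = \<mu> \<longrightarrow> f j \<in> eigenspace \<mu>) \<and>
     (\<forall>u\<in>eigenspace \<mu>. (\<forall>j. ev j = \<mu> \<longrightarrow> ip u (f j) = 0) \<longrightarrow> ip u u = 0)"
proof -
  let ?n = "card {j. ev j = \<mu>}"
  obtain e :: "nat \<Rightarrow> 'v" where e: "\<And>i. i < ?n \<Longrightarrow> e i \<in> eigenspace \<mu>"
    and ind: "\<And>c i. ip (\<Sum>i<?n. c i *\<^sub>R e i) (\<Sum>i<?n. c i *\<^sub>R e i) = 0 \<Longrightarrow> i < ?n \<Longrightarrow> c i = 0"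
    and spn: "\<And>u. u \<in> eigenspace \<mu> \<Longrightarrow> \<exists>c. ip (u - (\<Sum>i<?n. c i *\<^sub>R e i)) (u - (\<Sum>i<?n. c i *\<^sub>R e i)) = 0"
    using level_basis[of \<mu>] unfolding Let_def by blast
  obtain f where f: "ip.orthonormal f {..<?n}" "f ` {..<?n} \<subseteq> span (e ` {..<?n})"
      "e ` {..<?n} \<subseteq> span (f ` {..<?n})"
  proof -
    have "\<exists>f. ip.orthonormal f {..<?n} \<and> f ` {..<?n} \<subseteq> span (e ` {..<?n}) \<and> e ` {..<?n} \<subseteq> span (f ` {..<?n})"
    proof (rule ip.gram_schmidt)
      fix c i assume "ip (\<Sum>i<?n. c i *\<^sub>R e i) (\<Sum>i<?n. c i *\<^sub>R e i) = 0" "i < ?n"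
      then show "c i = 0" using ind[of c i] by blast
    qed (use H_in_L[OF eigenspace_H[OF e]] in blast)
    then show thesis using that by blast
  qed
  have fE: "f i \<in> eigenspace \<mu>" if "i < ?n" for i
    using f(2) that e subspace_eigenspace span_minimal[of "e ` {..<?n}" "eigenspace \<mu>"] by blast
  obtain h where h: "bij_betw h {j. ev j = \<mu>} {..<?n}"
    using ex_bij_betw_finite_nat[OF finite_level] by (metis atLeast0LessThan)
  show ?thesis
  proof (intro exI[of _ "f \<circ> h"] conjI allI impI ballI)
    show "ip.orthonormal (f \<circ> h) {j. ev j = \<mu>}"
      unfolding ip.orthonormal_def
    proof (intro conjI ballI)
      fix i j assume ij: "i \<in> {j. ev j = \<mu>}" "j \<in> {j. ev j = \<mu>}"
      then have "h i \<in> {..<?n}" "h j \<in> {..<?n}" "h i = h j \<longleftrightarrow> i = j"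
        using h by (auto simp: bij_betw_def inj_on_def)
      then show "ip ((f \<circ> h) i) ((f \<circ> h) j) = of_bool (i = j)"
        using f(1) by (simp add: ip.orthonormal_def)
    next
      fix i assume "i \<in> {j. ev j = \<mu>}"
      then show "(f \<circ> h) i \<in> L" using h f(1) by (auto simp: bij_betw_def ip.orthonormal_def)
    qed
    show "(f \<circ> h) j \<in> eigenspace \<mu>" if "ev j = \<mu>" for j
      using that h fE by (auto simp: bij_betw_def)
    fix u assume u: "u \<in> eigenspace \<mu>" and o: "\<forall>j. ev j = \<mu> \<longrightarrow> ip u ((f \<circ> h) j) = 0"
    have uL: "u \<in> L" using H_in_L[OF eigenspace_H[OF u]] .
    have of: "ip u (f i) = 0" if "i < ?n" for i
    proof -
      obtain j where "ev j = \<mu>" "i = h j" using h \<open>i < ?n\<close> unfolding bij_betw_def by blast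
      then show ?thesis using o by simp
    qed
    obtain c where c: "ip (u - (\<Sum>i<?n. c i *\<^sub>R e i)) (u - (\<Sum>i<?n. c i *\<^sub>R e i)) = 0"
      using spn[OF u] by blast
    let ?s = "\<Sum>i<?n. c i *\<^sub>R e i"
    have "?s \<in> span (f ` {..<?n})" using f(3) by (intro span_sum span_scale) auto
    then obtain c' where c': "?s = (\<Sum>i<?n. c' i *\<^sub>R f i)"
      using span_image_sum[of "{..<?n}"] by blast
    have fL: "f i \<in> L" if "i < ?n" for i using H_in_L[OF eigenspace_H[OF fE[OF that]]] .
    have sL: "?s \<in> L" using H_in_L[OF eigenspace_H[OF e]] by (intro ip.closed(5) ip.closed(4)) auto
    have "ip u ?s = 0" unfolding c'
      using fL uL of by (subst ip.sum_right) (auto simp: ip.scale_right)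
    moreover have "ip u (u - ?s) = 0" by (rule ip.null_right[OF uL ip.closed(3)[OF uL sL] c])
    ultimately show "ip u u = 0" using ip.diff_right[OF uL sL uL] by linarith
  qed
qed

text \<open>The choice depends on \<open>j\<close> only through \<open>ev j\<close>. Indices of
  equal eigenvalue therefore read off one and the same family, which makes them orthogonal to each
  other.\<close>

definition eigenbasis :: "nat \<Rightarrow> 'v" where
  "eigenbasis j = (SOME f. ip.orthonormal f {i. ev i = ev j} \<and> (\<forall>i. ev i = ev j \<longrightarrow> f i \<in> eigenspace (ev j)) \<and>
     (\<forall>u\<in>eigenspace (ev j). (\<forall>i. ev i = ev j \<longrightarrow> ip u (f i) = 0) \<longrightarrow> ip u u = 0)) j"

lemma eigenbasis_eigen: "eigenbasis j \<in> eigenspace (ev j)"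
  using someI_ex[OF level_orthonormal_basis[of "ev j"]] unfolding eigenbasis_def by blast

lemma eigenbasis_H [simp]: "eigenbasis j \<in> H"
  using eigenbasis_eigen eigenspace_H by blast

lemma eigenbasis_orthonormal: "ip.orthonormal eigenbasis A"
  unfolding ip.orthonormal_def
proof (intro conjI ballI)
  fix i j
  show "ip (eigenbasis i) (eigenbasis j) = of_bool (i = j)"
  proof (cases "ev i = ev j")
    case True
    then show ?thesis using someI_ex[OF level_orthonormal_basis[of "ev j"]]
      unfolding eigenbasis_def ip.orthonormal_def by auto
  next
    case False
    then show ?thesis
      using eigenspace_orthogonal[OF eigenbasis_eigen eigenbasis_eigen, of i j] by auto
  qed
qed auto

text \<open>This includes a number that \<open>ev\<close> never takes: the second premise is then
  empty and the eigenspace consists of null vectors. Hence no eigenvalue is missing from the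
  list.\<close>

lemma eigenbasis_complete:
  assumes u: "u \<in> eigenspace \<mu>" and o: "\<And>j. ev j = \<mu> \<Longrightarrow> ip u (eigenbasis j) = 0"
  shows "ip u u = 0"
proof -
  let ?P = "\<lambda>f. ip.orthonormal f {i. ev i = \<mu>} \<and> (\<forall>i. ev i = \<mu> \<longrightarrow> f i \<in> eigenspace \<mu>) \<and>
     (\<forall>u\<in>eigenspace \<mu>. (\<forall>i. ev i = \<mu> \<longrightarrow> ip u (f i) = 0) \<longrightarrow> ip u u = 0)"
  have "eigenbasis j = (SOME f. ?P f) j" if "ev j = \<mu>" for j
    using that by (simp add: eigenbasis_def)
  then show ?thesis using someI_ex[OF level_orthonormal_basis[of \<mu>]] u o by auto
qed

lemma ev_eq: "en (eigenbasis j) (eigenbasis j) = ev j"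
  using eigenbasis_eigen[of j] eigenbasis_orthonormal[of UNIV]
  by (auto simp: eigenspace_def ip.orthonormal_def)

lemma ev_nonneg: "0 \<le> ev j"
  using en.nonneg[of "eigenbasis j"] by (simp add: ev_eq)

text \<open>The minimiser on the complement is an eigenvector. Were its eigenvalue below
  \<open>ev n\<close>, monotonicity would place all indices of that level before \<open>n\<close>,
  and orthogonality to them would make it null.\<close>

lemma rayleigh_lower:
  assumes w: "w \<in> H" "\<And>j. j < n \<Longrightarrow> ip w (eigenbasis j) = 0"
  shows "ev n * ip w w \<le> en w w"
proof (cases "ip w w = 0")
  case False
  obtain v where v: "v \<in> eigenspace (en v v)" "\<And>j. j < n \<Longrightarrow> ip v (eigenbasis j) = 0" "ip v v = 1"
      "en v v * ip w w \<le> en w w"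
    using minimiser_orthogonal_eigen[OF eigenbasis_orthonormal eigenbasis_eigen w(1,2) False]
    by blast
  have "ev n \<le> en v v"
  proof (rule ccontr)
    assume "\<not> ev n \<le> en v v"
    then have "j < n" if "ev j = en v v" for j
      using monoD[OF mono_ev, of n j] that by linarith
    then have "ip v v = 0" using v(1,2) eigenbasis_complete by blast
    then show False using v(3) by simp
  qed
  then have "ev n * ip w w \<le> en v v * ip w w" using ip.nonneg[of w] w by (intro mult_right_mono) auto
  then show ?thesis using v(4) by simp
qed (use en.nonneg[OF w(1)] in simp)

text \<open>Sum \<open>approx\<close> over the first \<open>n + 1\<close> eigenvectors. By Bessel
  each \<open>g i\<close> contributes at most 1, and each energy term is at most 1/2, so
  \<open>n + 1\<close> is at most \<open>N ^ d\<close> plus half of itself.\<close>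

lemma count_le:
  assumes N: "N > 0" "2 * C * ev n \<le> (real N)\<^sup>2"
  shows "real (Suc n) \<le> 2 * real N ^ d"
proof -
  obtain g :: "nat \<Rightarrow> 'v" where g: "\<And>i. i < N ^ d \<Longrightarrow> g i \<in> L \<and> ip (g i) (g i) \<le> 1"
    and ap: "\<And>u. u \<in> H \<Longrightarrow> ip u u \<le> (\<Sum>i<N ^ d. (ip u (g i))\<^sup>2) + C / (real N)\<^sup>2 * en u u"
    using approx[OF N(1)] by blast
  have "ip (eigenbasis j) (eigenbasis j) \<le> (\<Sum>i<N ^ d. (ip (eigenbasis j) (g i))\<^sup>2) + 1 / 2" if j: "j \<in> {..n}" for j
  proof -
    have "ev j \<le> ev n" using j mono_ev by (auto dest: monoD)
    then have "2 * C * ev j \<le> (real N)\<^sup>2" using N(2) C_pos by (smt (verit) mult_left_mono)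
    then have "C / (real N)\<^sup>2 * ev j \<le> 1 / 2" using N(1) by (simp add: field_simps)
    moreover have "ip (eigenbasis j) (eigenbasis j) \<le> (\<Sum>i<N ^ d. (ip (eigenbasis j) (g i))\<^sup>2) + C / (real N)\<^sup>2 * ev j"
      using ap[of "eigenbasis j"] ev_eq[of j] by simp
    ultimately show ?thesis by linarith
  qed
  then have "(\<Sum>j\<le>n. ip (eigenbasis j) (eigenbasis j)) \<le> (\<Sum>j\<le>n. (\<Sum>i<N ^ d. (ip (eigenbasis j) (g i))\<^sup>2) + 1 / 2)"
    by (rule sum_mono)
  also have "\<dots> = (\<Sum>i<N ^ d. \<Sum>j\<le>n. (ip (eigenbasis j) (g i))\<^sup>2) + real (Suc n) / 2"
    by (subst sum.swap) (simp add: sum.distrib)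
  also have "(\<Sum>i<N ^ d. \<Sum>j\<le>n. (ip (eigenbasis j) (g i))\<^sup>2) \<le> (\<Sum>i<N ^ d. 1)"
  proof (rule sum_mono)
    fix i assume i: "i \<in> {..<N ^ d}"
    have "(\<Sum>j\<le>n. (ip (eigenbasis j) (g i))\<^sup>2) = (\<Sum>j\<le>n. (ip (g i) (eigenbasis j))\<^sup>2)"
      using g i by (intro sum.cong) (auto simp: ip.sym)
    also have "\<dots> \<le> ip (g i) (g i)" using g i by (intro ip.bessel[OF eigenbasis_orthonormal]) auto
    finally show "(\<Sum>j\<le>n. (ip (eigenbasis j) (g i))\<^sup>2) \<le> 1" using g i by fastforce
  qed
  finally have "(\<Sum>j\<le>n. ip (eigenbasis j) (eigenbasis j)) \<le> real N ^ d + real (Suc n) / 2" by simp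
  moreover have "ip (eigenbasis j) (eigenbasis j) = 1" for j
    using eigenbasis_orthonormal[of UNIV] by (simp add: ip.orthonormal_def)
  ultimately have "real (Suc n) \<le> real N ^ d + real (Suc n) / 2" by simp
  then show ?thesis by (simp add: field_simps del: of_nat_Suc)
qed

lemma growth: "real (Suc n) \<le> 2 * (2 + sqrt (2 * C * ev n)) ^ d"
proof -
  \<comment> \<open>The added 1 keeps \<open>N\<close> positive even if the root is 0.\<close>
  define N where "N = nat \<lceil>sqrt (2 * C * ev n)\<rceil> + 1"
  have q: "0 \<le> 2 * C * ev n" using C_pos ev_nonneg[of n] by simp
  have N: "sqrt (2 * C * ev n) \<le> real N" "real N \<le> 2 + sqrt (2 * C * ev n)"
    unfolding N_def using q by (auto simp: of_nat_nat) linarith+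
  have "(sqrt (2 * C * ev n))\<^sup>2 \<le> (real N)\<^sup>2" using N q by (intro power_mono) auto
  then have "real (Suc n) \<le> 2 * real N ^ d" using q by (intro count_le) (auto simp: N_def)
  also have "\<dots> \<le> 2 * (2 + sqrt (2 * C * ev n)) ^ d" using N by (intro mult_left_mono power_mono) auto
  finally show ?thesis .
qed

text \<open>Squaring \<open>growth\<close> and comparing with the exponential gives terms of order
  1/(j+1)^2; hence the exponent \<open>d * 2\<close>.\<close>

lemma summable_exp:
  assumes "t > 0"
  shows "summable (\<lambda>j. exp (- ev j * t))"
proof -
  obtain K where K: "K > 0" "\<And>\<Lambda>. \<Lambda> \<ge> 0 \<Longrightarrow> (2 + sqrt (2 * C * \<Lambda>)) ^ (d * 2) \<le> K * exp (t * \<Lambda>)"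
    using polynomial_le_exp[OF assms C_pos] by blast
  have "summable (\<lambda>j. 4 * K * (1 / real (Suc j) ^ 2))"
    using summable_Suc_iff[of "\<lambda>n. 1 / real n ^ 2"] inverse_power_summable[of 2, where 'a = real]
    by (intro summable_mult) (simp add: inverse_eq_divide)
  moreover have "norm (exp (- ev j * t)) \<le> 4 * K * (1 / real (Suc j) ^ 2)" for j
  proof -
    have "(real (Suc j))\<^sup>2 \<le> (2 * (2 + sqrt (2 * C * ev j)) ^ d)\<^sup>2"
      using growth[of j] by (intro power_mono) auto
    also have "\<dots> \<le> 4 * (K * exp (t * ev j))"
      using K(2)[OF ev_nonneg[of j]] by (simp add: power_mult power_mult_distrib)
    finally have "(real (Suc j))\<^sup>2 \<le> 4 * (K * exp (t * ev j))" .
    then have "1 * (real (Suc j))\<^sup>2 * exp (- (t * ev j)) \<le> 4 * K * (exp (t * ev j) * exp (- (t * ev j)))"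
      using mult_right_mono[of _ _ "exp (- (t * ev j))"] by (simp add: mult.assoc)
    then show ?thesis by (simp add: exp_minus field_simps del: of_nat_Suc)
  qed
  ultimately show ?thesis by (rule summable_comparison_test'[where N = 0])
qed

lemma ev_at_top: "filterlim ev at_top sequentially"
proof -
  have "\<exists>n. ev n > B" for B
  proof (rule ccontr)
    assume "\<nexists>n. ev n > B"
    then have B: "ev n \<le> B" for n by (meson not_le)
    obtain n :: nat where "real n > 2 * (2 + sqrt (2 * C * B)) ^ d" using reals_Archimedean2 by blast
    moreover have "2 * (2 + sqrt (2 * C * ev n)) ^ d \<le> 2 * (2 + sqrt (2 * C * B)) ^ d"
      using B[of n] C_pos ev_nonneg[of n]
      by (intro mult_left_mono power_mono add_left_mono real_sqrt_le_mono add_nonneg_nonneg) auto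
    ultimately show False using growth[of n] by simp
  qed
  then show ?thesis unfolding filterlim_at_top_dense eventually_sequentially
    using mono_ev by (meson less_le_trans monoD)
qed

text \<open>Finite form of the semigroup estimate for one vector. The part of \<open>\<psi>\<close>
  beyond the first \<open>n\<close> eigenvectors has energy at most \<open>en \<psi> \<psi>\<close>,
  so by \<open>rayleigh_lower\<close> its square is at most
  \<open>en \<psi> \<psi> / ev n\<close>.\<close>

theorem trace_term_lower:
  assumes \<psi>: "\<psi> \<in> H" and t: "t \<ge> 0" and \<mu>: "\<mu> \<ge> 0" and n: "ev n > 0"
  shows "(\<Sum>j<n. exp (- ev j * t) * (ip \<psi> (eigenbasis j))\<^sup>2)
    \<ge> exp (- \<mu> * t) * ((1 + t * \<mu>) * (ip \<psi> \<psi> - en \<psi> \<psi> / ev n) - t * en \<psi> \<psi>)"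
proof -
  let ?u = eigenbasis and ?c = "\<lambda>j. ip \<psi> (eigenbasis j)"
  let ?r = "ip.residual eigenbasis {..<n} \<psi>"
  have rH: "?r \<in> H" using \<psi> by (auto simp: ip.residual_def)
  have r0: "ip ?r (?u j) = 0" if "j < n" for j
    using ip.residual_orth[OF eigenbasis_orthonormal] \<psi> that by auto
  have eu: "en v (?u j) = ev j * ip v (?u j)" if "v \<in> H" for v j
    using eigenbasis_eigen[of j] that en.sym[of v "?u j"] ip.sym[of v "?u j"]
    by (auto simp: eigenspace_def)
  have dec: "\<psi> = ?r + (\<Sum>j<n. ?c j *\<^sub>R ?u j)" by (simp add: ip.residual_def)
  have 1: "ip ?r ?r = ip \<psi> \<psi> - (\<Sum>j<n. (?c j)\<^sup>2)"
    using ip.residual_square[OF eigenbasis_orthonormal] \<psi> by auto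
  have "en ?r ?r = en ?r \<psi> - en ?r (\<Sum>j<n. ?c j *\<^sub>R ?u j)"
    by (subst (2) ip.residual_def) (use rH \<psi> in \<open>auto simp: en.diff_right\<close>)
  also have "en ?r (\<Sum>j<n. ?c j *\<^sub>R ?u j) = 0"
    using rH r0 by (subst en.sum_right) (auto simp: en.scale_right eu)
  also have "en ?r \<psi> = en \<psi> \<psi> - en (\<Sum>j<n. ?c j *\<^sub>R ?u j) \<psi>"
    by (subst ip.residual_def) (use \<psi> in \<open>auto simp: en.diff_left\<close>)
  also have "en (\<Sum>j<n. ?c j *\<^sub>R ?u j) \<psi> = (\<Sum>j<n. ev j * (?c j)\<^sup>2)"
    using \<psi> eu[OF \<psi>] en.sym[OF _ \<psi>, of "?u _"]
    by (subst en.sum_left) (auto simp: en.scale_left power2_eq_square intro!: sum.cong)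
  finally have 2: "en ?r ?r = en \<psi> \<psi> - (\<Sum>j<n. ev j * (?c j)\<^sup>2)" by simp
  have e_le: "(\<Sum>j<n. ev j * (?c j)\<^sup>2) \<le> en \<psi> \<psi>" using 2 en.nonneg[OF rH] by simp
  have "0 \<le> (\<Sum>j<n. ev j * (?c j)\<^sup>2)" using ev_nonneg by (intro sum_nonneg) auto
  then have "ev n * ip ?r ?r \<le> en \<psi> \<psi>" using rayleigh_lower[OF rH r0, of n] 2 by linarith
  then have c_ge: "ip \<psi> \<psi> - en \<psi> \<psi> / ev n \<le> (\<Sum>j<n. (?c j)\<^sup>2)"
    using n 1 by (simp add: field_simps)
  have tangent: "exp (- ev j * t) \<ge> exp (- \<mu> * t) * (1 + t * \<mu> - t * ev j)" for j
  proof -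
    have "exp (- ev j * t) = exp (- \<mu> * t) * exp (t * \<mu> - t * ev j)"
      by (simp add: exp_add[symmetric] algebra_simps)
    also have "\<dots> \<ge> exp (- \<mu> * t) * (1 + (t * \<mu> - t * ev j))"
      by (intro mult_left_mono exp_ge_add_one_self) auto
    finally show ?thesis by (simp only: add_diff_eq)
  qed
  \<comment> \<open>The signs decide which bound enters: \<open>1 + t * \<mu>\<close> multiplies the
    mass, which is bounded below, and \<open>- t\<close> the energy, which is bounded above.\<close>
  have "exp (- \<mu> * t) * ((1 + t * \<mu>) * (ip \<psi> \<psi> - en \<psi> \<psi> / ev n) - t * en \<psi> \<psi>)
      \<le> exp (- \<mu> * t) * ((1 + t * \<mu>) * (\<Sum>j<n. (?c j)\<^sup>2) - t * (\<Sum>j<n. ev j * (?c j)\<^sup>2))"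
    using c_ge e_le t \<mu> by (intro mult_left_mono diff_mono) auto
  also have "\<dots> = (\<Sum>j<n. exp (- \<mu> * t) * (1 + t * \<mu> - t * ev j) * (?c j)\<^sup>2)"
    by (simp add: sum_distrib_left sum_subtractf[symmetric] algebra_simps)
  also have "\<dots> \<le> (\<Sum>j<n. exp (- ev j * t) * (?c j)\<^sup>2)"
    using tangent by (intro sum_mono mult_right_mono) auto
  finally show ?thesis .
qed

end

section \<open>Smooth functions and test functions\<close>

lemma frechet_derivative_eq: "(f has_derivative D) (at x) \<Longrightarrow> frechet_derivative f (at x) = D"
  using frechet_derivative_at by metis

lemma C_k_SucI:
  assumes "\<And>x. (f has_derivative D x) (at x)" "\<And>b. b \<in> Basis \<Longrightarrow> C_k k (\<lambda>x. D x b)"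
  shows "C_k (Suc k) f"
  using assms frechet_derivative_eq[OF assms(1)] by (auto simp: differentiable_def)

lemma C_k_Suc_has_derivative:
  "C_k (Suc k) f \<Longrightarrow> (f has_derivative frechet_derivative f (at x)) (at x)"
  using frechet_derivative_works by auto

lemma C_k_Suc_D: "C_k (Suc k) f \<Longrightarrow> C_k k f"
proof (induction k arbitrary: f)
  case 0
  then show ?case
    by (auto intro!: differentiable_imp_continuous_on simp: differentiable_on_def)
next
  case (Suc k)
  then show ?case by auto
qed

lemma C_k_const: "C_k k (\<lambda>x. c)"
proof (induction k arbitrary: c)
  case (Suc k)
  show ?case by (rule C_k_SucI[where D = "\<lambda>_ _. 0"]) (auto intro: Suc derivative_intros)
qed auto

lemma C_k_add: "C_k k f \<Longrightarrow> C_k k g \<Longrightarrow> C_k k (\<lambda>x. f x + g x)"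
proof (induction k arbitrary: f g)
  case (Suc k)
  note d = C_k_Suc_has_derivative[OF Suc.prems(1)] C_k_Suc_has_derivative[OF Suc.prems(2)]
  show ?case by (rule C_k_SucI[OF has_derivative_add[OF d]]) (use Suc in auto)
qed (auto intro: continuous_intros)

lemma C_k_mult: "C_k k f \<Longrightarrow> C_k k g \<Longrightarrow> C_k k (\<lambda>x. f x * g x)"
proof (induction k arbitrary: f g)
  case (Suc k)
  note d = C_k_Suc_has_derivative[OF Suc.prems(1)] C_k_Suc_has_derivative[OF Suc.prems(2)]
  show ?case
    by (rule C_k_SucI[OF has_derivative_mult[OF d]])
      (use Suc C_k_Suc_D[OF Suc.prems(1)] C_k_Suc_D[OF Suc.prems(2)] in \<open>auto intro!: C_k_add\<close>)
qed (auto intro: continuous_intros)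

section \<open>Closure properties of smooth functions\<close>

definition smooth :: "('a::euclidean_space \<Rightarrow> real) \<Rightarrow> bool" where
  "smooth f \<longleftrightarrow> (\<forall>k. C_k k f)"

named_theorems smooth_intros

lemma smooth_const [smooth_intros]: "smooth (\<lambda>x. c)"
  by (simp add: smooth_def C_k_const)

lemma smooth_add [smooth_intros]: "smooth f \<Longrightarrow> smooth g \<Longrightarrow> smooth (\<lambda>x. f x + g x)"
  by (simp add: smooth_def C_k_add)

lemma smooth_mult [smooth_intros]: "smooth f \<Longrightarrow> smooth g \<Longrightarrow> smooth (\<lambda>x. f x * g x)"
  by (simp add: smooth_def C_k_mult)

lemma smooth_minus [smooth_intros]: "smooth f \<Longrightarrow> smooth (\<lambda>x. - f x)"
  using smooth_mult[OF smooth_const[of "-1"]] by simp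

lemma smooth_diff [smooth_intros]: "smooth f \<Longrightarrow> smooth g \<Longrightarrow> smooth (\<lambda>x. f x - g x)"
  using smooth_add[OF _ smooth_minus, of f g] by simp

lemma smooth_power [smooth_intros]: "smooth f \<Longrightarrow> smooth (\<lambda>x. f x ^ n)"
  by (induction n) (auto intro: smooth_intros)

lemma smooth_sum [smooth_intros]: "(\<And>i. i \<in> I \<Longrightarrow> smooth (f i)) \<Longrightarrow> smooth (\<lambda>x. \<Sum>i\<in>I. f i x)"
  by (induction I rule: infinite_finite_induct) (auto intro: smooth_intros)

lemma smooth_prod [smooth_intros]: "(\<And>i. i \<in> I \<Longrightarrow> smooth (f i)) \<Longrightarrow> smooth (\<lambda>x. \<Prod>i\<in>I. f i x)"
  by (induction I rule: infinite_finite_induct) (auto intro: smooth_intros)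

lemma smooth_inner [smooth_intros]: "smooth (\<lambda>x. x \<bullet> p)"
  unfolding smooth_def
proof
  fix k show "C_k k (\<lambda>x. x \<bullet> p)"
  proof (cases k)
    case (Suc l)
    show ?thesis unfolding Suc
      by (rule C_k_SucI[where D = "\<lambda>_ h. h \<bullet> p"]) (auto intro!: derivative_eq_intros C_k_const)
  qed (auto intro: continuous_intros)
qed

text \<open>Each \<open>h i\<close> differentiates to a combination of members of the family, so an
  induction on \<open>k\<close> for all members at once never leaves it. It serves for cosine
  together with sine, and for \<open>flat_exp\<close>.\<close>

lemma C_k_compose_family:
  assumes "\<And>i y. i \<in> I \<Longrightarrow> (h i has_field_derivative (\<Sum>j\<in>J i. c i j * h j y)) (at y)"
    and "\<And>i. i \<in> I \<Longrightarrow> J i \<subseteq> I" and q: "smooth q" and "i \<in> I"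
  shows "C_k k (\<lambda>x. h i (q x))"
  using assms(4)
proof (induction k arbitrary: i)
  case 0
  have "continuous_on UNIV (h i)"
    using assms(1)[OF 0] by (meson DERIV_isCont continuous_at_imp_continuous_on)
  moreover have "continuous_on UNIV q" using q C_k.simps(1) unfolding smooth_def by blast
  ultimately show ?case by (auto intro: continuous_on_compose2)
next
  case (Suc k)
  have qd: "(q has_derivative frechet_derivative q (at x)) (at x)" for x
    using q C_k_Suc_has_derivative unfolding smooth_def by blast
  have qk: "C_k k (\<lambda>x. frechet_derivative q (at x) b)" if "b \<in> Basis" for b
    using q that C_k.simps(2) unfolding smooth_def by blast
  have sum: "C_k k (\<lambda>x. \<Sum>j\<in>J'. c i j * h j (q x))" if "J' \<subseteq> J i" for J'
    using that
  proof (induction J' rule: infinite_finite_induct)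
    case (insert j F)
    then have "C_k k (\<lambda>x. h j (q x))" using Suc assms(2) by blast
    then show ?case using insert by (auto intro!: C_k_add C_k_mult C_k_const)
  qed (auto intro: C_k_const)
  show ?case
  proof (rule C_k_SucI)
    show "((\<lambda>x. h i (q x)) has_derivative
        (\<lambda>v. (\<Sum>j\<in>J i. c i j * h j (q x)) * frechet_derivative q (at x) v)) (at x)" for x
      using has_derivative_compose[OF qd assms(1)[OF Suc.prems, unfolded has_field_derivative_def]]
      by simp
    show "C_k k (\<lambda>x. (\<Sum>j\<in>J i. c i j * h j (q x)) * frechet_derivative q (at x) b)"
      if "b \<in> Basis" for b
      by (intro C_k_mult qk that sum) auto
  qed
qed

lemma smooth_cos_sin:
  assumes "smooth q"
  shows "smooth (\<lambda>x. cos (q x))" "smooth (\<lambda>x. sin (q x))"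
proof -
  let ?h = "\<lambda>i::bool. if i then cos else (sin :: real \<Rightarrow> real)"
  have "C_k k (\<lambda>x. ?h i (q x))" for k i
    by (rule C_k_compose_family[where I = UNIV and J = "\<lambda>i. {\<not> i}" and c = "\<lambda>i _. if i then - 1 else 1"])
      (auto intro!: assms derivative_eq_intros)
  from this[of _ True] this[of _ False] show "smooth (\<lambda>x. cos (q x))" "smooth (\<lambda>x. sin (q x))"
    by (auto simp: smooth_def)
qed

section \<open>Flat functions and smooth bumps\<close>

definition flat_exp :: "nat \<Rightarrow> real \<Rightarrow> real" where
  "flat_exp m s = (if s > 0 then exp (- 1 / s) / s ^ m else 0)"

lemma power_le_fact_exp: "0 \<le> y \<Longrightarrow> y ^ n \<le> fact n * exp (y :: real)"
proof -
  assume y: "0 \<le> y"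
  have "(\<Sum>k\<in>{n}. y ^ k /\<^sub>R fact k) \<le> (\<Sum>k. y ^ k /\<^sub>R fact k)"
    using y by (intro sum_le_suminf summable_exp_generic) auto
  then show ?thesis by (simp add: exp_def field_simps)
qed

text \<open>A quadratic bound makes the difference quotient at 0 vanish. It comes from
  \<open>power_le_fact_exp\<close> at \<open>1 / s\<close> with exponent \<open>m + 2\<close>, two
  powers more than the denominator takes.\<close>

lemma flat_exp_le: "\<bar>flat_exp m s\<bar> \<le> fact (m + 2) * s\<^sup>2"
proof (cases "s > 0")
  case True
  define F :: real where "F = fact (m + 2)"
  have "(1 / s) ^ (m + 2) \<le> F * exp (1 / s)" unfolding F_def using True by (intro power_le_fact_exp) auto
  then have "1 / s ^ m \<le> F * exp (1 / s) * s\<^sup>2"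
    using True by (simp add: field_simps power_add power2_eq_square)
  then have "exp (- 1 / s) * (1 / s ^ m) \<le> exp (- 1 / s) * (F * exp (1 / s) * s\<^sup>2)"
    by (intro mult_left_mono) auto
  also have "\<dots> = F * s\<^sup>2" by (simp add: exp_minus field_simps)
  finally show ?thesis using True unfolding F_def[symmetric] by (simp add: flat_exp_def)
qed (simp add: flat_exp_def)

text \<open>The denominators \<open>s ^ m\<close> belong to the family precisely so that it is
  closed under differentiation, as \<open>C_k_compose_family\<close> requires.\<close>

lemma flat_exp_deriv:
  "(flat_exp m has_field_derivative (flat_exp (m + 2) s - real m * flat_exp (m + 1) s)) (at s)"
proof -
  consider "s > 0" | "s < 0" | "s = 0" by linarith
  then show ?thesis
  proof cases
    case 1
    have "((\<lambda>s. exp (- 1 / s) / s ^ m) has_field_derivative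
        (exp (- 1 / s) / s ^ (m + 2) - real m * (exp (- 1 / s) / s ^ (m + 1)))) (at s)"
      using 1 by (auto intro!: derivative_eq_intros simp: field_simps power_add power2_eq_square)
        (cases m; simp add: field_simps)
    then have "(flat_exp m has_field_derivative
        (exp (- 1 / s) / s ^ (m + 2) - real m * (exp (- 1 / s) / s ^ (m + 1)))) (at s)"
      by (rule has_field_derivative_transform_within_open[of _ _ _ "{0<..}"])
        (use 1 in \<open>auto simp: flat_exp_def\<close>)
    then show ?thesis using 1 by (simp add: flat_exp_def)
  next
    case 2
    have "((\<lambda>s. 0) has_field_derivative 0) (at s)" by simp
    then have "(flat_exp m has_field_derivative 0) (at s)"
      by (rule has_field_derivative_transform_within_open[of _ _ _ "{..<0}"])
        (use 2 in \<open>auto simp: flat_exp_def\<close>)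
    then show ?thesis using 2 by (simp add: flat_exp_def)
  next
    case 3
    define F :: real where "F = fact (m + 2)"
    have "(\<lambda>h. \<bar>h\<bar> * F) \<midarrow>0\<rightarrow> \<bar>0\<bar> * F" by (intro tendsto_intros)
    then have "(\<lambda>h. \<bar>h\<bar> * F) \<midarrow>0\<rightarrow> 0" by simp
    then have "(\<lambda>h. flat_exp m h / h) \<midarrow>0\<rightarrow> 0"
    proof (rule Lim_null_comparison[rotated], intro always_eventually allI)
      fix h
      have "\<bar>flat_exp m h\<bar> \<le> \<bar>h\<bar> * F * \<bar>h\<bar>"
        using flat_exp_le[of m h, folded F_def] by (simp add: power2_eq_square mult.commute mult.left_commute)
      then show "norm (flat_exp m h / h) \<le> \<bar>h\<bar> * F"
        by (cases "h = 0") (auto simp: divide_le_eq)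
    qed
    then show ?thesis using 3 by (simp add: DERIV_def flat_exp_def)
  qed
qed

lemma smooth_flat_exp [smooth_intros]:
  assumes "smooth q"
  shows "smooth (\<lambda>x. flat_exp m (q x))"
  unfolding smooth_def
proof
  fix k
  show "C_k k (\<lambda>x. flat_exp m (q x))"
    by (rule C_k_compose_family[where I = UNIV and J = "\<lambda>m. {m + 2, m + 1}"
          and c = "\<lambda>m j. if j = m + 2 then 1 else - real m"])
      (auto intro!: assms flat_exp_deriv[THEN DERIV_cong])
qed

text \<open>The squared norm is a polynomial in the coordinates, so the centre of the ball needs no
  separate treatment.\<close>

definition ball_bump :: "'a::euclidean_space \<Rightarrow> real \<Rightarrow> 'a \<Rightarrow> real" where
  "ball_bump a r x = flat_exp 0 (r\<^sup>2 - (norm (x - a))\<^sup>2)"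

lemma smooth_ball_bump [smooth_intros]: "smooth (ball_bump a r)"
proof -
  have "ball_bump a r = (\<lambda>x. flat_exp 0 (r\<^sup>2 - (\<Sum>b\<in>Basis. (x \<bullet> b - a \<bullet> b)\<^sup>2)))"
    by (rule ext, simp only: ball_bump_def power2_norm_eq_inner euclidean_inner[of "x - a" "x - a" for x])
      (simp add: inner_diff_left power2_eq_square)
  then show ?thesis by (auto intro!: smooth_intros)
qed

lemma ball_bump_nonneg: "0 \<le> ball_bump a r x"
  by (simp add: ball_bump_def flat_exp_def)

lemma ball_bump_less_1: "ball_bump a r x < 1"
  by (simp add: ball_bump_def flat_exp_def)

lemma ball_bump_pos_iff: "r > 0 \<Longrightarrow> 0 < ball_bump a r x \<longleftrightarrow> x \<in> ball a r"
  using power2_less_imp_less[of "norm (x - a)" r] power_strict_mono[of "norm (x - a)" r 2]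
  by (auto simp: ball_bump_def flat_exp_def dist_norm norm_minus_commute)

section \<open>Gradients of smooth functions\<close>

lemma smooth_has_derivative:
  "smooth f \<Longrightarrow> (f has_derivative (\<lambda>v. gradient f x \<bullet> v)) (at x)"
proof -
  assume "smooth f"
  then have d: "(f has_derivative frechet_derivative f (at x)) (at x)"
    using C_k_Suc_has_derivative unfolding smooth_def by blast
  then have "linear (frechet_derivative f (at x))" by (rule has_derivative_linear)
  then have "frechet_derivative f (at x) v = gradient f x \<bullet> v" for v
    unfolding gradient_def inner_sum_left
    by (subst (1) euclidean_representation[of v, symmetric])
      (simp add: linear_sum linear_scale inner_commute mult.commute)
  then have "frechet_derivative f (at x) = (\<lambda>v. gradient f x \<bullet> v)" by (rule ext)
  with d show ?thesis by simp
qed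

lemma smooth_line_derivative:
  assumes "smooth f"
  shows "((\<lambda>t. f (x + t *\<^sub>R z)) has_field_derivative gradient f (x + t *\<^sub>R z) \<bullet> z) (at t)"
proof -
  have "((\<lambda>t. f (x + t *\<^sub>R z)) has_derivative (\<lambda>s. gradient f (x + t *\<^sub>R z) \<bullet> (s *\<^sub>R z))) (at t)"
    by (rule has_derivative_compose[of "\<lambda>t. x + t *\<^sub>R z", OF _ smooth_has_derivative[OF assms]])
      (auto intro!: derivative_eq_intros)
  then show ?thesis
    unfolding has_field_derivative_def by (rule has_derivative_eq_rhs) (auto simp: mult.commute)
qed

lemma gradient_unique:
  assumes "(f has_derivative (\<lambda>v. g \<bullet> v)) (at x)"
  shows "gradient f x = g"
  unfolding gradient_def frechet_derivative_eq[OF assms] by (rule euclidean_representation)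

lemma smooth_continuous: "smooth f \<Longrightarrow> continuous_on UNIV f"
  using C_k.simps(1) unfolding smooth_def by blast

lemma smooth_gradient_inner: "smooth f \<Longrightarrow> b \<in> Basis \<Longrightarrow> smooth (\<lambda>x. gradient f x \<bullet> b)"
  using frechet_derivative_eq[OF smooth_has_derivative[of f]]
  unfolding smooth_def by (metis (no_types, lifting) C_k.simps(2) ext)

lemma continuous_gradient: "smooth f \<Longrightarrow> continuous_on UNIV (gradient f)"
  using smooth_continuous[OF smooth_gradient_inner]
  by (subst continuous_on_componentwise) auto

lemma smooth_borel: "smooth f \<Longrightarrow> f \<in> borel_measurable borel"
  by (intro borel_measurable_continuous_onI smooth_continuous)

lemma gradient_borel: "smooth f \<Longrightarrow> gradient f \<in> borel_measurable borel"
  by (intro borel_measurable_continuous_onI continuous_gradient)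

lemma gradient_add: "smooth f \<Longrightarrow> smooth g \<Longrightarrow> gradient (\<lambda>x. f x + g x) x = gradient f x + gradient g x"
  by (rule gradient_unique)
    (auto intro!: derivative_eq_intros smooth_has_derivative simp: inner_add_left)

lemma gradient_mult:
  "smooth f \<Longrightarrow> smooth g \<Longrightarrow> gradient (\<lambda>x. f x * g x) x = f x *\<^sub>R gradient g x + g x *\<^sub>R gradient f x"
  by (rule gradient_unique)
    (auto intro!: derivative_eq_intros smooth_has_derivative simp: inner_add_left)

lemma gradient_cmult: "smooth f \<Longrightarrow> gradient (\<lambda>x. c * f x) x = c *\<^sub>R gradient f x"
  by (rule gradient_unique) (auto intro!: derivative_eq_intros smooth_has_derivative)

lemma gradient_eq_0_open:
  assumes "open U" "x \<in> U" "\<And>y. y \<in> U \<Longrightarrow> f y = c"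
  shows "gradient f x = 0"
proof (rule gradient_unique)
  have "((\<lambda>y. c) has_derivative (\<lambda>v. 0 \<bullet> v)) (at x)" by simp
  then show "(f has_derivative (\<lambda>v. 0 \<bullet> v)) (at x)"
    by (rule has_derivative_transform_within_open[OF _ assms(1,2)]) (simp add: assms(3))
qed

section \<open>Test functions vanishing outside a freely chosen compact set\<close>

lemma test_function_iff:
  "test_function \<Omega> \<phi> \<longleftrightarrow> smooth \<phi> \<and> (\<exists>K. compact K \<and> K \<subseteq> \<Omega> \<and> (\<forall>x. x \<notin> K \<longrightarrow> \<phi> x = 0))"
proof
  assume "test_function \<Omega> \<phi>"
  then show "smooth \<phi> \<and> (\<exists>K. compact K \<and> K \<subseteq> \<Omega> \<and> (\<forall>x. x \<notin> K \<longrightarrow> \<phi> x = 0))"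
    using closure_subset[of "{x. \<phi> x \<noteq> 0}"] unfolding test_function_def smooth_def by blast
next
  assume R: "smooth \<phi> \<and> (\<exists>K. compact K \<and> K \<subseteq> \<Omega> \<and> (\<forall>x. x \<notin> K \<longrightarrow> \<phi> x = 0))"
  then obtain K where K: "compact K" "K \<subseteq> \<Omega>" "\<And>x. x \<notin> K \<Longrightarrow> \<phi> x = 0" by blast
  then have "closure {x. \<phi> x \<noteq> 0} \<subseteq> K"
    by (intro closure_minimal compact_imp_closed) auto
  with K R show "test_function \<Omega> \<phi>"
    using compact_closure bounded_subset[OF compact_imp_bounded[OF K(1)]] closure_subset
    unfolding test_function_def smooth_def by (meson dual_order.trans)
qed

lemma test_functionI:
  "\<lbrakk>smooth \<phi>; compact K; K \<subseteq> \<Omega>; \<And>x. x \<notin> K \<Longrightarrow> \<phi> x = 0\<rbrakk> \<Longrightarrow> test_function \<Omega> \<phi>"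
  unfolding test_function_iff by blast

lemma test_functionE:
  assumes "test_function \<Omega> \<phi>"
  obtains K where "smooth \<phi>" "compact K" "K \<subseteq> \<Omega>" "\<And>x. x \<notin> K \<Longrightarrow> \<phi> x = 0"
    "\<And>x. x \<notin> K \<Longrightarrow> gradient \<phi> x = 0"
proof -
  obtain K where K: "smooth \<phi>" "compact K" "K \<subseteq> \<Omega>" "\<And>x. x \<notin> K \<Longrightarrow> \<phi> x = 0"
    using assms unfolding test_function_iff by blast
  moreover have "gradient \<phi> x = 0" if "x \<notin> K" for x
    by (rule gradient_eq_0_open[of "- K"]) (use that K compact_imp_closed in auto)
  ultimately show thesis using that by blast
qed

lemma test_function_smooth: "test_function \<Omega> \<phi> \<Longrightarrow> smooth \<phi>"
  by (simp add: test_function_iff)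

lemma test_function_smooth_mult:
  "test_function \<Omega> \<phi> \<Longrightarrow> smooth f \<Longrightarrow> test_function \<Omega> (\<lambda>x. \<phi> x * f x)"
  by (auto simp: test_function_iff intro: smooth_mult)

lemma test_function_cmult: "test_function \<Omega> \<phi> \<Longrightarrow> test_function \<Omega> (\<lambda>x. c * \<phi> x)"
  by (auto simp: test_function_iff intro: smooth_mult smooth_const)

lemma test_function_0: "test_function \<Omega> (\<lambda>x. 0)"
  unfolding test_function_iff by (intro conjI exI[of _ "{}"]) (auto intro: smooth_const)

lemma test_function_add:
  assumes "test_function \<Omega> \<phi>" "test_function \<Omega> \<psi>"
  shows "test_function \<Omega> (\<lambda>x. \<phi> x + \<psi> x)"
proof -
  obtain K L where "compact K" "K \<subseteq> \<Omega>" "\<And>x. x \<notin> K \<Longrightarrow> \<phi> x = 0"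
    "compact L" "L \<subseteq> \<Omega>" "\<And>x. x \<notin> L \<Longrightarrow> \<psi> x = 0" "smooth \<phi>" "smooth \<psi>"
    using assms unfolding test_function_iff by blast
  then show ?thesis by (intro test_functionI[of _ "K \<union> L"]) (auto intro: smooth_add)
qed

section \<open>Square integrable functions\<close>

definition L2 :: "'a measure \<Rightarrow> ('a \<Rightarrow> 'b::euclidean_space) set" where
  "L2 M = {f \<in> borel_measurable M. integrable M (\<lambda>x. (norm (f x))\<^sup>2)}"

lemma L2_measurable [measurable_dest]: "f \<in> L2 M \<Longrightarrow> f \<in> borel_measurable M"
  by (simp add: L2_def)

lemma L2_integrable_norm: "f \<in> L2 M \<Longrightarrow> integrable M (\<lambda>x. (norm (f x))\<^sup>2)"
  by (simp add: L2_def)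

lemma L2_integrable_inner:
  assumes "f \<in> L2 M" "g \<in> L2 M"
  shows "integrable M (\<lambda>x. f x \<bullet> g x)"
proof (rule Bochner_Integration.integrable_bound)
  show "integrable M (\<lambda>x. (norm (f x))\<^sup>2 + (norm (g x))\<^sup>2)"
    using assms by (auto simp: L2_def)
  show "(\<lambda>x. f x \<bullet> g x) \<in> borel_measurable M" using assms by (auto simp: L2_def)
  have "\<bar>f x \<bullet> g x\<bar> \<le> (norm (f x))\<^sup>2 + (norm (g x))\<^sup>2" for x
    using Cauchy_Schwarz_ineq2[of "f x" "g x"] sum_squares_bound[of "norm (f x)" "norm (g x)"]
      mult_nonneg_nonneg[OF norm_ge_zero[of "f x"] norm_ge_zero[of "g x"]] by linarith
  then show "AE x in M. norm (f x \<bullet> g x) \<le> norm ((norm (f x))\<^sup>2 + (norm (g x))\<^sup>2)" by auto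
qed

lemma L2_add:
  assumes "f \<in> L2 M" "g \<in> L2 M"
  shows "(\<lambda>x. f x + g x) \<in> L2 M"
proof -
  have "integrable M (\<lambda>x. (norm (f x))\<^sup>2 + 2 * (f x \<bullet> g x) + (norm (g x))\<^sup>2)"
    using assms L2_integrable_inner[OF assms] by (auto simp: L2_def)
  also have "(\<lambda>x. (norm (f x))\<^sup>2 + 2 * (f x \<bullet> g x) + (norm (g x))\<^sup>2) = (\<lambda>x. (norm (f x + g x))\<^sup>2)"
    by (simp add: power2_norm_eq_inner inner_add_left inner_add_right inner_commute algebra_simps)
  finally show ?thesis using assms by (auto simp: L2_def)
qed

lemma L2_scaleR: "f \<in> L2 M \<Longrightarrow> (\<lambda>x. c *\<^sub>R f x) \<in> L2 M"
  by (auto simp: L2_def power_mult_distrib)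

lemma L2_diff:
  assumes "f \<in> L2 M" "g \<in> L2 M"
  shows "(\<lambda>x. f x - g x) \<in> L2 M"
  using L2_add[OF assms(1) L2_scaleR[OF assms(2), of "-1"]] by simp

lemma L2_zero: "(\<lambda>x. 0) \<in> L2 M"
  by (simp add: L2_def)

text \<open>Squared distance: convergence to 0 can be stated without a root, at the price of the
  factor 2 in \<open>dist2_triangle\<close>.\<close>

definition dist2 :: "'a measure \<Rightarrow> ('a \<Rightarrow> 'b::euclidean_space) \<Rightarrow> ('a \<Rightarrow> 'b) \<Rightarrow> real" where
  "dist2 M f g = (LINT x|M. (norm (f x - g x))\<^sup>2)"

lemma dist2_nonneg: "0 \<le> dist2 M f g"
  by (simp add: dist2_def)

lemma dist2_triangle:
  assumes "f \<in> L2 M" "g \<in> L2 M" "h \<in> L2 M"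
  shows "dist2 M f h \<le> 2 * dist2 M f g + 2 * dist2 M g h"
proof -
  have i: "integrable M (\<lambda>x. (norm (u x - v x))\<^sup>2)" if "u \<in> L2 M" "v \<in> L2 M" for u v :: "'a \<Rightarrow> 'b"
    using L2_diff[OF that] by (simp add: L2_def)
  have "(norm (f x - h x))\<^sup>2 \<le> 2 * (norm (f x - g x))\<^sup>2 + 2 * (norm (g x - h x))\<^sup>2" for x
  proof -
    have "norm (f x - h x) \<le> norm (f x - g x) + norm (g x - h x)"
      using norm_triangle_ineq[of "f x - g x" "g x - h x"] by simp
    then have "(norm (f x - h x))\<^sup>2 \<le> (norm (f x - g x) + norm (g x - h x))\<^sup>2" by (intro power_mono) auto
    also have "\<dots> \<le> 2 * (norm (f x - g x))\<^sup>2 + 2 * (norm (g x - h x))\<^sup>2"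
      using sum_squares_bound[of "norm (f x - g x)" "norm (g x - h x)"] by (simp add: power2_sum)
    finally show ?thesis .
  qed
  then have "dist2 M f h \<le> (LINT x|M. 2 * (norm (f x - g x))\<^sup>2 + 2 * (norm (g x - h x))\<^sup>2)"
    unfolding dist2_def using assms by (intro integral_mono) (auto intro!: i)
  also have "\<dots> = 2 * dist2 M f g + 2 * dist2 M g h"
    unfolding dist2_def using assms i by (subst Bochner_Integration.integral_add) auto
  finally show ?thesis .
qed

lemma L2_cauchy_schwarz:
  assumes "f \<in> L2 M" "g \<in> L2 M"
  shows "(LINT x|M. f x \<bullet> g x)\<^sup>2 \<le> (LINT x|M. (norm (f x))\<^sup>2) * (LINT x|M. (norm (g x))\<^sup>2)"
proof -
  let ?a = "LINT x|M. (norm (f x))\<^sup>2" and ?b = "LINT x|M. f x \<bullet> g x" and ?c = "LINT x|M. (norm (g x))\<^sup>2"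
  have q: "0 \<le> ?a + 2 * s * ?b + s\<^sup>2 * ?c" for s
  proof -
    have "0 \<le> (LINT x|M. (norm (f x + s *\<^sub>R g x))\<^sup>2)" by simp
    also have "(\<lambda>x. (norm (f x + s *\<^sub>R g x))\<^sup>2) = (\<lambda>x. (norm (f x))\<^sup>2 + 2 * s * (f x \<bullet> g x) + s\<^sup>2 * (norm (g x))\<^sup>2)"
      unfolding power2_norm_eq_inner
      by (simp add: inner_add_left inner_add_right inner_commute algebra_simps power2_eq_square)
    also have "(LINT x|M. \<dots> x) = ?a + 2 * s * ?b + s\<^sup>2 * ?c"
      using L2_integrable_inner[OF assms] assms[THEN L2_integrable_norm] by simp
    finally show ?thesis .
  qed
  show ?thesis
  proof (cases "?c = 0")
    case True
    have "?b = 0"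
    proof (rule ccontr)
      assume "?b \<noteq> 0"
      then show False using q[of "- (?a + 1) / (2 * ?b)"] True by (simp add: field_simps)
    qed
    then show ?thesis using True by simp
  next
    case False
    moreover have "?c \<ge> 0" by simp
    ultimately have "?c > 0" by linarith
    then show ?thesis using q[of "- ?b / ?c"] by (simp add: field_simps power2_eq_square)
  qed
qed

lemma dist2_zero_iff:
  assumes "f \<in> L2 M" "g \<in> L2 M"
  shows "dist2 M f g = 0 \<longleftrightarrow> (AE x in M. f x = g x)"
  unfolding dist2_def using L2_diff[OF assms]
  by (subst integral_nonneg_eq_0_iff_AE) (auto simp: L2_def)

lemma L2_tendsto_inner:
  assumes "\<And>n. f n \<in> L2 M" "f' \<in> L2 M" "g \<in> L2 M" "(\<lambda>n. dist2 M (f n) f') \<longlonglongrightarrow> 0"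
  shows "(\<lambda>n. LINT x|M. f n x \<bullet> g x) \<longlonglongrightarrow> (LINT x|M. f' x \<bullet> g x)"
proof -
  let ?c = "LINT x|M. (norm (g x))\<^sup>2"
  have "(\<lambda>n. sqrt (dist2 M (f n) f' * ?c)) \<longlonglongrightarrow> sqrt (0 * ?c)" by (intro tendsto_intros assms)
  then have *: "(\<lambda>n. sqrt (dist2 M (f n) f' * ?c)) \<longlonglongrightarrow> 0" by simp
  have "(\<lambda>n. (LINT x|M. f n x \<bullet> g x) - (LINT x|M. f' x \<bullet> g x)) \<longlonglongrightarrow> 0"
  proof (rule Lim_null_comparison[OF always_eventually *], rule allI)
    fix n
    have "(LINT x|M. f n x \<bullet> g x) - (LINT x|M. f' x \<bullet> g x) = (LINT x|M. (f n x - f' x) \<bullet> g x)"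
      using L2_integrable_inner[OF assms(1)[of n] assms(3)] L2_integrable_inner[OF assms(2,3)]
      by (simp add: inner_diff_left)
    then show "norm ((LINT x|M. f n x \<bullet> g x) - (LINT x|M. f' x \<bullet> g x)) \<le> sqrt (dist2 M (f n) f' * ?c)"
      using L2_cauchy_schwarz[OF L2_diff[OF assms(1)[of n] assms(2)] assms(3)]
      by (simp add: dist2_def real_le_rsqrt)
  qed
  then show ?thesis by (simp add: LIM_zero_iff)
qed

lemma L2_tendsto_norm:
  assumes "\<And>n. f n \<in> L2 M" "g \<in> L2 M" "(\<lambda>n. dist2 M (f n) g) \<longlonglongrightarrow> 0"
  shows "(\<lambda>n. LINT x|M. (norm (f n x))\<^sup>2) \<longlonglongrightarrow> (LINT x|M. (norm (g x))\<^sup>2)"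
proof -
  have "(LINT x|M. (norm (f n x))\<^sup>2) = dist2 M (f n) g + 2 * (LINT x|M. f n x \<bullet> g x) - (LINT x|M. g x \<bullet> g x)" for n
  proof -
    have "(LINT x|M. (norm (f n x - g x))\<^sup>2)
        = (LINT x|M. (norm (f n x))\<^sup>2 - 2 * (f n x \<bullet> g x) + g x \<bullet> g x)"
      by (rule Bochner_Integration.integral_cong)
        (auto simp: power2_norm_eq_inner inner_diff_left inner_diff_right inner_commute)
    also have "\<dots> = (LINT x|M. (norm (f n x))\<^sup>2) - 2 * (LINT x|M. f n x \<bullet> g x) + (LINT x|M. g x \<bullet> g x)"
      using L2_integrable_inner[OF assms(1)[of n] assms(2)] L2_integrable_inner[OF assms(2) assms(2)]
        L2_integrable_norm[OF assms(1)[of n]] by simp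
    finally show ?thesis unfolding dist2_def by simp
  qed
  moreover have "(\<lambda>n. dist2 M (f n) g + 2 * (LINT x|M. f n x \<bullet> g x) - (LINT x|M. g x \<bullet> g x))
      \<longlonglongrightarrow> 0 + 2 * (LINT x|M. g x \<bullet> g x) - (LINT x|M. g x \<bullet> g x)"
    using assms by (intro tendsto_intros L2_tendsto_inner)
  ultimately show ?thesis by (simp add: power2_norm_eq_inner)
qed

text \<open>Riesz--Fischer: a subsequence with \<open>\<Sum>\<^sub>n 4\<^sup>n \<parallel>f\<^sub>n\<^sub>+\<^sub>1 - f\<^sub>n\<parallel>\<^sup>2 < \<infinity>\<close> converges almost everywhere, and Fatou's
  lemma identifies its limit as the limit in mean square.\<close>

lemma L2_complete:
  fixes f :: "nat \<Rightarrow> 'a \<Rightarrow> 'b::euclidean_space"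
  assumes f: "\<And>n. f n \<in> L2 M"
    and cauchy: "\<And>e. e > 0 \<Longrightarrow> \<exists>N. \<forall>m\<ge>N. \<forall>n\<ge>N. dist2 M (f m) (f n) < e"
  obtains g where "g \<in> L2 M" "(\<lambda>n. dist2 M (f n) g) \<longlonglongrightarrow> 0"
proof -
  note [measurable] = L2_measurable[OF f]
  have "\<exists>N. \<forall>m\<ge>N. \<forall>n\<ge>N. dist2 M (f m) (f n) < (1 / 4) ^ k / 2 ^ k" for k :: nat
    by (intro cauchy) auto
  then obtain N where N: "\<And>k m n. m \<ge> N k \<Longrightarrow> n \<ge> N k \<Longrightarrow> dist2 M (f m) (f n) < (1 / 4) ^ k / 2 ^ k" by metis
  \<comment> \<open>Being a partial sum, \<open>r\<close> dominates \<open>N k\<close> at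
    \<open>k\<close> and at the next index; the added \<open>k\<close> drives it to infinity, as the
    Fatou step needs.\<close>
  define r where "r k = (\<Sum>i\<le>k. N i) + k" for k
  have rN: "r k \<ge> N k" for k unfolding r_def by (intro trans_le_add1 member_le_sum) auto
  have rS: "r (Suc k) \<ge> N k" for k using rN[of k] by (simp add: r_def)
  have rk: "r k \<ge> k" for k by (simp add: r_def)
  let ?d = "\<lambda>k x. norm (f (r (Suc k)) x - f (r k) x)"
  have dI: "integrable M (\<lambda>x. (?d k x)\<^sup>2)" for k
    using L2_diff[OF f f] by (simp add: L2_def)
  have dn: "(\<integral>\<^sup>+x. ennreal ((?d k x)\<^sup>2) \<partial>M) \<le> ennreal ((1 / 4) ^ k / 2 ^ k)" for k
    using N[OF rS rN, of k] by (subst nn_integral_eq_integral[OF dI]) (auto simp: dist2_def intro: ennreal_leI)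
  have "(\<integral>\<^sup>+x. (\<Sum>k. ennreal (4 ^ k * (?d k x)\<^sup>2)) \<partial>M) = (\<Sum>k. \<integral>\<^sup>+x. ennreal (4 ^ k * (?d k x)\<^sup>2) \<partial>M)"
    by (intro nn_integral_suminf) measurable
  also have "\<dots> \<le> (\<Sum>k. ennreal ((1 / 2) ^ k))"
  proof (intro suminf_le allI)
    fix k :: nat
    have "(\<integral>\<^sup>+x. ennreal (4 ^ k * (?d k x)\<^sup>2) \<partial>M) = ennreal (4 ^ k) * (\<integral>\<^sup>+x. ennreal ((?d k x)\<^sup>2) \<partial>M)"
      by (simp add: ennreal_mult nn_integral_cmult)
    also have "\<dots> \<le> ennreal (4 ^ k) * ennreal ((1 / 4) ^ k / 2 ^ k)"
      by (intro mult_left_mono dn) simp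
    also have "\<dots> = ennreal ((1 / 2) ^ k)"
      by (simp add: ennreal_mult[symmetric] power_divide)
    finally show "(\<integral>\<^sup>+x. ennreal (4 ^ k * (?d k x)\<^sup>2) \<partial>M) \<le> ennreal ((1 / 2) ^ k)" .
  qed auto
  also have "\<dots> < \<infinity>"
    by (subst suminf_ennreal2) (auto intro: summable_geometric)
  finally have "AE x in M. (\<Sum>k. ennreal (4 ^ k * (?d k x)\<^sup>2)) \<noteq> \<infinity>"
    by (intro nn_integral_noteq_infinite) auto
  then have "AE x in M. convergent (\<lambda>k. f (r k) x)"
  proof eventually_elim
    case (elim x)
    then have s: "summable (\<lambda>k. 4 ^ k * (?d k x)\<^sup>2)"
      by (intro summable_suminf_not_top) auto
    then have "(\<lambda>k. 4 ^ k * (?d k x)\<^sup>2) \<longlonglongrightarrow> 0" by (rule summable_LIMSEQ_zero)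
    then have "eventually (\<lambda>k. 4 ^ k * (?d k x)\<^sup>2 < 1) sequentially" by (rule order_tendstoD) simp
    then have "eventually (\<lambda>k. norm (?d k x) \<le> (1 / 2) ^ k) sequentially"
    proof eventually_elim
      case (elim k)
      then have "(2 ^ k * ?d k x)\<^sup>2 \<le> 1\<^sup>2" by (simp add: power_mult_distrib power_mult[symmetric] mult.commute[of k] power_mult)
      then have "2 ^ k * ?d k x \<le> 1" by (rule power2_le_imp_le) simp
      then show ?case by (simp add: power_divide field_simps)
    qed
    then have "summable (\<lambda>k. ?d k x)"
      by (rule summable_comparison_test_ev) (simp add: summable_geometric)
    then have "summable (\<lambda>k. f (r (Suc k)) x - f (r k) x)" by (rule summable_norm_cancel)
    then have "convergent (\<lambda>n. \<Sum>k<n. f (r (Suc k)) x - f (r k) x)" by (simp add: summable_iff_convergent)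
    then have "convergent (\<lambda>n. (\<Sum>k<n. f (r (Suc k)) x - f (r k) x) + f (r 0) x)"
      by (intro convergent_add convergent_const)
    moreover have "(\<Sum>k<n. f (r (Suc k)) x - f (r k) x) + f (r 0) x = f (r n) x" for n
      using sum_lessThan_telescope[of "\<lambda>k. f (r k) x" n] by simp
    ultimately show ?case by simp
  qed
  define g where "g x = lim (\<lambda>k. f (r k) x)" for x
  have gm [measurable]: "g \<in> borel_measurable M" unfolding g_def by measurable
  have glim: "AE x in M. (\<lambda>k. f (r k) x) \<longlonglongrightarrow> g x"
    using \<open>AE x in M. convergent (\<lambda>k. f (r k) x)\<close> by eventually_elim (simp add: g_def convergent_LIMSEQ_iff)
  \<comment> \<open>Stated with nonnegative integrals because square integrability of
    \<open>f m - g\<close> is only deduced from it.\<close>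
  have fatou: "(\<integral>\<^sup>+x. ennreal ((norm (f m x - g x))\<^sup>2) \<partial>M) \<le> ennreal e"
    if e: "\<And>n. n \<ge> K \<Longrightarrow> dist2 M (f m) (f n) \<le> e" for m e K
  proof -
    have "(\<integral>\<^sup>+x. ennreal ((norm (f m x - g x))\<^sup>2) \<partial>M)
        \<le> (\<integral>\<^sup>+x. liminf (\<lambda>k. ennreal ((norm (f m x - f (r k) x))\<^sup>2)) \<partial>M)"
    proof (rule nn_integral_mono_AE, use glim in eventually_elim)
      case (elim x)
      then have "(\<lambda>k. ennreal ((norm (f m x - f (r k) x))\<^sup>2)) \<longlonglongrightarrow> ennreal ((norm (f m x - g x))\<^sup>2)"
        by (intro tendsto_intros tendsto_ennrealI)
      then show ?case by (intro eq_refl lim_imp_Liminf[symmetric]) auto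
    qed
    also have "\<dots> \<le> liminf (\<lambda>k. \<integral>\<^sup>+x. ennreal ((norm (f m x - f (r k) x))\<^sup>2) \<partial>M)"
      by (intro nn_integral_liminf) measurable
    also have "\<dots> \<le> liminf (\<lambda>k. ennreal e)"
    proof (intro Liminf_mono eventually_sequentiallyI[of K])
      fix k assume "K \<le> k"
      then have "dist2 M (f m) (f (r k)) \<le> e" using e rk order_trans by blast
      moreover have "integrable M (\<lambda>x. (norm (f m x - f (r k) x))\<^sup>2)"
        using L2_diff[OF f f] by (simp add: L2_def)
      ultimately show "(\<integral>\<^sup>+x. ennreal ((norm (f m x - f (r k) x))\<^sup>2) \<partial>M) \<le> ennreal e"
        by (subst nn_integral_eq_integral) (auto simp: dist2_def intro: ennreal_leI)
    qed
    also have "\<dots> = ennreal e" by (simp add: Liminf_const)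
    finally show ?thesis .
  qed
  have diffL2: "(\<lambda>x. f m x - g x) \<in> L2 M" if "\<And>n. n \<ge> K \<Longrightarrow> dist2 M (f m) (f n) \<le> e" for m e K
  proof -
    have "(\<integral>\<^sup>+x. ennreal (norm ((norm (f m x - g x))\<^sup>2)) \<partial>M) < \<infinity>"
      using le_less_trans[OF fatou[of K m e, OF that] ennreal_less_top] by simp
    then show ?thesis by (auto simp: L2_def intro!: integrableI_bounded)
  qed
  have gL2: "g \<in> L2 M"
  proof -
    obtain K where K: "\<And>m n. m \<ge> K \<Longrightarrow> n \<ge> K \<Longrightarrow> dist2 M (f m) (f n) < 1" using cauchy[of 1] by auto
    have "(\<lambda>x. f K x - g x) \<in> L2 M" by (rule diffL2[of K K 1]) (use K in \<open>auto intro: less_imp_le\<close>)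
    from L2_diff[OF f[of K] this] show ?thesis by simp
  qed
  moreover have "(\<lambda>n. dist2 M (f n) g) \<longlonglongrightarrow> 0"
  proof (rule LIMSEQ_I)
    fix e :: real assume e: "e > 0"
    obtain K where K: "\<And>m n. m \<ge> K \<Longrightarrow> n \<ge> K \<Longrightarrow> dist2 M (f m) (f n) < e / 2" using cauchy[of "e / 2"] e by auto
    have "dist2 M (f m) g \<le> e / 2" if "m \<ge> K" for m
    proof -
      have i: "integrable M (\<lambda>x. (norm (f m x - g x))\<^sup>2)" using L2_diff[OF f gL2] by (simp add: L2_def)
      have "ennreal (dist2 M (f m) g) \<le> ennreal (e / 2)"
        using fatou[of K m "e / 2"] K that e nn_integral_eq_integral[OF i]
        by (auto simp: dist2_def intro: less_imp_le)
      then show ?thesis using e by (subst (asm) ennreal_le_iff) auto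
    qed
    moreover have "norm (dist2 M (f m) g - 0) = dist2 M (f m) g" for m
      using dist2_nonneg[of M "f m" g] by simp
    ultimately show "\<exists>K. \<forall>m\<ge>K. norm (dist2 M (f m) g - 0) < e"
      using e by (intro exI[of _ K] allI impI) (metis field_sum_of_halves less_add_same_cancel1 half_gt_zero order.strict_trans1)
  qed
  ultimately show thesis using that by blast
qed

section \<open>Integration by parts and the fundamental lemma\<close>

lemma lborel_integral_translate:
  fixes f :: "'a::euclidean_space \<Rightarrow> 'b::euclidean_space"
  assumes [measurable]: "f \<in> borel_measurable borel"
  shows "(LINT x|lborel. f (x + c)) = (LINT x|lborel. f x)"
proof -
  have "(LINT x|lborel. f x) = (LINT x|distr lborel borel ((+) c). f x)" by (simp add: lborel_distr_plus)
  also have "\<dots> = (LINT x|lborel. f (c + x))" by (rule integral_distr) auto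
  finally show ?thesis by (simp add: add.commute)
qed

lemma lebesgue_on_integral_eq:
  fixes f :: "'a::euclidean_space \<Rightarrow> 'b::euclidean_space"
  assumes "f \<in> borel_measurable borel" "\<Omega> \<in> sets lebesgue" "\<And>x. x \<notin> \<Omega> \<Longrightarrow> f x = 0"
  shows "(LINT x|lebesgue_on \<Omega>. f x) = (LINT x|lborel. f x)"
    and "integrable (lebesgue_on \<Omega>) f \<longleftrightarrow> integrable lborel f"
proof -
  have "(\<lambda>x. indicator \<Omega> x *\<^sub>R f x) = f" using assms(3) by (auto simp: indicator_def)
  then show "(LINT x|lebesgue_on \<Omega>. f x) = (LINT x|lborel. f x)"
    "integrable (lebesgue_on \<Omega>) f \<longleftrightarrow> integrable lborel f"
    using assms by (simp_all add: integral_restrict_space integrable_restrict_space integral_completion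
        integrable_completion)
qed

lemma compact_support_integrable:
  fixes f :: "'a::euclidean_space \<Rightarrow> 'b::euclidean_space"
  assumes "continuous_on UNIV f" "compact K" "\<And>x. x \<notin> K \<Longrightarrow> f x = 0"
  shows "integrable lborel f"
proof -
  have "integrable lborel (\<lambda>x. indicator K x *\<^sub>R f x)"
    using assms by (intro borel_integrable_compact) (auto intro: continuous_on_subset)
  moreover have "(\<lambda>x. indicator K x *\<^sub>R f x) = f" using assms(3) by (auto simp: indicator_def)
  ultimately show ?thesis by simp
qed

lemma compact_support_bounded:
  fixes f :: "'a::euclidean_space \<Rightarrow> 'b::euclidean_space"
  assumes "continuous_on UNIV f" "compact K" "\<And>x. x \<notin> K \<Longrightarrow> f x = 0"
  obtains B where "B > 0" "\<And>x. norm (f x) \<le> B"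
proof -
  have "compact (f ` K)" using assms by (intro compact_continuous_image) (auto intro: continuous_on_subset)
  then obtain B where "B > 0" "\<forall>y\<in>f ` K. norm y \<le> B" by (meson bounded_pos compact_imp_bounded)
  then show thesis using that[of B] assms(3) by (metis imageI less_imp_le norm_zero)
qed

lemma smooth_mean_value:
  assumes "smooth f" "\<And>x. norm (gradient f x) \<le> B"
  shows "\<bar>f x - f y\<bar> \<le> B * norm (x - y)"
proof -
  have "norm (f x - f y) \<le> B * norm (x - y)"
  proof (rule differentiable_bound[of UNIV f "\<lambda>x v. gradient f x \<bullet> v"])
    fix x
    show "(f has_derivative (\<lambda>v. gradient f x \<bullet> v)) (at x within UNIV)"
      using smooth_has_derivative[OF assms(1)] by simp
    show "onorm (\<lambda>v. gradient f x \<bullet> v) \<le> B"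
    proof (rule onorm_le)
      fix v
      show "norm (gradient f x \<bullet> v) \<le> B * norm v"
        using Cauchy_Schwarz_ineq2[of "gradient f x" v] mult_right_mono[OF assms(2)[of x] norm_ge_zero[of v]]
        by simp
    qed
  qed auto
  then show ?thesis by simp
qed

text \<open>Difference quotients integrate to 0 by translation invariance and converge to the
  partial derivative. The dominating ball has radius \<open>\<rho> + 1\<close> because the shifts
  have length at most 1.\<close>

lemma integral_gradient_zero:
  fixes f :: "'a::euclidean_space \<Rightarrow> real"
  assumes f: "smooth f" and K: "compact K" "\<And>x. x \<notin> K \<Longrightarrow> f x = 0" and b: "b \<in> Basis"
  shows "(LINT x|lborel. gradient f x \<bullet> b) = 0"
proof -
  have gK: "gradient f x = 0" if "x \<notin> K" for x
    by (rule gradient_eq_0_open[of "- K"]) (use that K compact_imp_closed in auto)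
  obtain B where B: "B > 0" "\<And>x. norm (gradient f x) \<le> B"
    using compact_support_bounded[OF continuous_gradient[OF f] K(1) gK] by blast
  obtain \<rho> where \<rho>: "\<rho> > 0" "\<And>x. x \<in> K \<Longrightarrow> norm x \<le> \<rho>"
    using K(1) by (meson bounded_pos compact_imp_bounded)
  note [measurable] = smooth_borel[OF f] gradient_borel[OF f]
  have fi: "integrable lborel f" by (rule compact_support_integrable[OF smooth_continuous[OF f] K])
  let ?d = "\<lambda>n x. real (Suc n) * (f (x + (1 / real (Suc n)) *\<^sub>R b) - f x)"
  have "(\<lambda>n. LINT x|lborel. ?d n x) \<longlonglongrightarrow> (LINT x|lborel. gradient f x \<bullet> b)"
  proof (rule integral_dominated_convergence[where w = "\<lambda>x. B * indicator (cball 0 (\<rho> + 1)) x"])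
    show "integrable lborel (\<lambda>x. B * indicator (cball (0 :: 'a) (\<rho> + 1)) x)"
      by (intro integrable_mult_right integrable_real_indicator) (use emeasure_lborel_cball_finite[of "0 :: 'a" "\<rho> + 1"] in simp_all)
    show "AE x in lborel. (\<lambda>n. ?d n x) \<longlonglongrightarrow> gradient f x \<bullet> b"
    proof (intro AE_I2)
      fix x
      have "((\<lambda>t. f (x + t *\<^sub>R b)) has_field_derivative (gradient f x \<bullet> b)) (at 0)"
        using smooth_line_derivative[OF f, of x b 0] by simp
      then have "((\<lambda>h. (f (x + h *\<^sub>R b) - f x) / h) \<longlongrightarrow> gradient f x \<bullet> b) (at 0)"
        by (simp add: DERIV_def)
      moreover have "filterlim (\<lambda>n. 1 / real (Suc n)) (at 0) sequentially"
        unfolding filterlim_at using LIMSEQ_Suc[OF lim_1_over_n] by (auto intro: eventually_sequentiallyI[of 0])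
      ultimately have "(\<lambda>n. (f (x + (1 / real (Suc n)) *\<^sub>R b) - f x) / (1 / real (Suc n))) \<longlonglongrightarrow> gradient f x \<bullet> b"
        by (rule filterlim_compose)
      then show "(\<lambda>n. ?d n x) \<longlonglongrightarrow> gradient f x \<bullet> b" by (simp add: field_simps)
    qed
    fix n
    show "AE x in lborel. norm (?d n x) \<le> B * indicator (cball 0 (\<rho> + 1)) x"
    proof (intro AE_I2)
      fix x :: 'a
      have nb: "norm ((1 / real (Suc n)) *\<^sub>R b) \<le> 1" using b by simp
      show "norm (?d n x) \<le> B * indicator (cball 0 (\<rho> + 1)) x"
      proof (cases "norm x \<le> \<rho> + 1")
        case True
        have "\<bar>f (x + (1 / real (Suc n)) *\<^sub>R b) - f x\<bar> \<le> B * norm ((1 / real (Suc n)) *\<^sub>R b)"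
          using smooth_mean_value[OF f B(2), of "x + (1 / real (Suc n)) *\<^sub>R b" x] by simp
        also have "\<dots> = B / real (Suc n)" using b by simp
        finally have "real (Suc n) * \<bar>f (x + (1 / real (Suc n)) *\<^sub>R b) - f x\<bar> \<le> B"
          by (simp only: pos_le_divide_eq[of "real (Suc n)", OF of_nat_0_less_iff[THEN iffD2, OF zero_less_Suc]] mult.commute)
        then show ?thesis using True by (simp add: abs_mult)
      next
        case False
        have "norm x \<le> norm (x + (1 / real (Suc n)) *\<^sub>R b) + 1"
          using nb norm_triangle_ineq4[of "x + (1 / real (Suc n)) *\<^sub>R b" "(1 / real (Suc n)) *\<^sub>R b"]
          unfolding add_diff_cancel_right' by linarith
        then have "x \<notin> K" "x + (1 / real (Suc n)) *\<^sub>R b \<notin> K" using False \<rho> by force+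
        then show ?thesis using K(2) False B(1) by simp
      qed
    qed
  qed measurable
  moreover have "(LINT x|lborel. ?d n x) = 0" for n
  proof -
    have "integrable lborel (\<lambda>x. f (x + (1 / real (Suc n)) *\<^sub>R b))"
      using fi integrable_distr_eq[of "(+) ((1 / real (Suc n)) *\<^sub>R b)" lborel borel f]
      by (simp add: lborel_distr_plus add.commute)
    then show ?thesis using fi by (simp add: lborel_integral_translate)
  qed
  ultimately show ?thesis by (simp add: LIMSEQ_const_iff)
qed

text \<open>Lindelof reduces \<open>U\<close> to countably many balls whose closures lie in
  \<open>U\<close>. In the product over \<open>i < n\<close> of \<open>(1 - \<eta> i x) ^ n\<close>
  the finite range keeps the support compact, and the exponent \<open>n\<close> forces the product
  to 0 as soon as one bump is positive.\<close>

lemma indicator_open_limit_of_test_functions: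
  fixes U :: "'a::euclidean_space set"
  assumes "open U"
  obtains \<theta> where "\<And>n::nat. test_function U (\<theta> n)" "\<And>n x. 0 \<le> \<theta> n x \<and> \<theta> n x \<le> 1"
    "\<And>x. (\<lambda>n. \<theta> n x) \<longlonglongrightarrow> indicator U x"
proof (cases "U = {}")
  case True
  show thesis by (rule that[of "\<lambda>_ _. 0"]) (use True test_function_0 in auto)
next
  case False
  define F where "F = {ball a r |a r. r > 0 \<and> cball a r \<subseteq> U}"
  have "U = \<Union>F"
  proof
    show "U \<subseteq> \<Union>F"
    proof
      fix x assume "x \<in> U"
      then obtain r where "r > 0" "cball x r \<subseteq> U" using assms open_contains_cball by blast
      then show "x \<in> \<Union>F" unfolding F_def by (intro UnionI[of "ball x r"]) auto
    qed
  qed (use ball_subset_cball in \<open>auto simp: F_def subset_iff\<close>)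
  obtain F' where F': "F' \<subseteq> F" "countable F'" "\<Union>F' = \<Union>F"
    by (rule Lindelof[of F]) (auto simp: F_def)
  have "F' \<noteq> {}" using F'(3) \<open>U = \<Union>F\<close> False by auto
  then obtain G :: "nat \<Rightarrow> 'a set" where G: "range G = F'"
    using F'(2) range_from_nat_into by metis
  then have "\<forall>i. \<exists>a r. G i = ball a r \<and> r > 0 \<and> cball a r \<subseteq> U" using F'(1) unfolding F_def by blast
  then obtain a r where ar: "\<And>i. G i = ball (a i) (r i)" "\<And>i. r i > 0" "\<And>i. cball (a i) (r i) \<subseteq> U" by metis
  have U: "U = (\<Union>i. ball (a i) (r i))" using \<open>U = \<Union>F\<close> F'(3) G ar(1) by auto
  define \<eta> where "\<eta> i = ball_bump (a i) (r i)" for i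
  have \<eta>: "0 \<le> \<eta> i x" "\<eta> i x < 1" "smooth (\<eta> i)" "0 < \<eta> i x \<longleftrightarrow> x \<in> ball (a i) (r i)" for i x
    by (auto simp: \<eta>_def ball_bump_nonneg ball_bump_less_1 ar ball_bump_pos_iff intro: smooth_intros)
  define \<theta> where "\<theta> n x = 1 - (\<Prod>i<n. (1 - \<eta> i x) ^ n)" for n x
  have \<eta>0: "\<eta> i x = 0" if "x \<notin> ball (a i) (r i)" for i x
    using \<eta>(1,4)[of i x] that by linarith
  have p: "0 \<le> (\<Prod>i<n. (1 - \<eta> i x) ^ n)" "(\<Prod>i<n. (1 - \<eta> i x) ^ n) \<le> 1" for n and x :: 'a
    using \<eta>(1,2) by (auto intro!: prod_nonneg prod_le_1 power_le_one simp: less_imp_le)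
  show thesis
  proof (rule that)
    fix n
    show "test_function U (\<theta> n)"
    proof (rule test_functionI)
      show "smooth (\<theta> n)" unfolding \<theta>_def using \<eta>(3) by (auto intro!: smooth_intros)
      show "compact (\<Union>i<n. cball (a i) (r i))" by auto
      show "(\<Union>i<n. cball (a i) (r i)) \<subseteq> U" using ar(3) by auto
      fix x assume "x \<notin> (\<Union>i<n. cball (a i) (r i))"
      then have "\<eta> i x = 0" if "i < n" for i using that by (intro \<eta>0) (force simp del: mem_ball mem_cball dest: subsetD[OF ball_subset_cball])
      then show "\<theta> n x = 0" by (simp add: \<theta>_def)
    qed
    show "0 \<le> \<theta> n x \<and> \<theta> n x \<le> 1" for x using p[of x n] by (simp add: \<theta>_def)
  next
    fix x
    show "(\<lambda>n. \<theta> n x) \<longlonglongrightarrow> indicator U x"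
    proof (cases "x \<in> U")
      case False
      then have "\<eta> i x = 0" for i using U by (intro \<eta>0) auto
      then show ?thesis using False by (simp add: \<theta>_def)
    next
      case True
      then obtain j where j: "0 < \<eta> j x" using U \<eta>(4) by blast
      have "(\<lambda>n. \<Prod>i<n. (1 - \<eta> i x) ^ n) \<longlonglongrightarrow> 0"
      proof (rule tendsto_sandwich[OF _ _ tendsto_const])
        show "(\<lambda>n. (1 - \<eta> j x) ^ n) \<longlonglongrightarrow> 0"
          using j \<eta>(2)[of j x] by (intro LIMSEQ_realpow_zero) auto
        show "eventually (\<lambda>n. (\<Prod>i<n. (1 - \<eta> i x) ^ n) \<le> (1 - \<eta> j x) ^ n) sequentially"
        proof (intro eventually_sequentiallyI[of "Suc j"])
          fix n assume "Suc j \<le> n"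
          then have "(\<Prod>i<n. (1 - \<eta> i x) ^ n) = (1 - \<eta> j x) ^ n * (\<Prod>i\<in>{..<n} - {j}. (1 - \<eta> i x) ^ n)"
            by (intro prod.remove) auto
          also have "\<dots> \<le> (1 - \<eta> j x) ^ n * 1"
            using \<eta>(1,2) by (intro mult_left_mono prod_le_1) (auto intro!: power_le_one simp: less_imp_le)
          finally show "(\<Prod>i<n. (1 - \<eta> i x) ^ n) \<le> (1 - \<eta> j x) ^ n" by simp
        qed
      qed (use p in auto)
      then have "(\<lambda>n. 1 - (\<Prod>i<n. (1 - \<eta> i x) ^ n)) \<longlonglongrightarrow> 1 - 0" by (intro tendsto_intros)
      then show ?thesis using True by (simp add: \<theta>_def)
    qed
  qed
qed

text \<open>Test functions give vanishing integrals over open subsets of \<open>\<Omega>\<close>,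
  hence by complement over closed ones. A closed subset of the positivity set is then null, and
  inner regularity passes this on to the whole set.\<close>

lemma AE_nonpos_of_test_functions:
  fixes g :: "'a::euclidean_space \<Rightarrow> real"
  assumes \<Omega>: "open \<Omega>" and g: "integrable (lebesgue_on \<Omega>) g"
    and 0: "\<And>\<phi>. test_function \<Omega> \<phi> \<Longrightarrow> (LINT x|lebesgue_on \<Omega>. \<phi> x * g x) = 0"
  shows "AE x in lebesgue_on \<Omega>. g x \<le> 0"
proof -
  let ?M = "lebesgue_on \<Omega>"
  note [measurable] = borel_measurable_integrable[OF g]
  have \<Omega>s: "\<Omega> \<in> sets lebesgue" using \<Omega> by auto
  have op: "(LINT x|?M. indicator U x * g x) = 0" if U: "open U" "U \<subseteq> \<Omega>" for U
  proof -
    obtain \<theta> where \<theta>: "\<And>n::nat. test_function U (\<theta> n)" "\<And>n x. 0 \<le> \<theta> n x \<and> \<theta> n x \<le> 1"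
      "\<And>x. (\<lambda>n. \<theta> n x) \<longlonglongrightarrow> indicator U x"
      using indicator_open_limit_of_test_functions[OF U(1)] by blast
    have \<theta>\<Omega>: "test_function \<Omega> (\<theta> n)" for n using \<theta>(1)[of n] U(2) by (auto simp: test_function_def)
    have [measurable]: "\<theta> n \<in> borel_measurable ?M" for n
      using smooth_borel[OF test_function_smooth[OF \<theta>(1)[of n]]]
      by (intro measurable_restrict_space1 measurable_completion) auto
    have [measurable]: "indicator U \<in> borel_measurable ?M"
      using U(1) by (intro measurable_restrict_space1 measurable_completion) auto
    have "(\<lambda>n. LINT x|?M. \<theta> n x * g x) \<longlonglongrightarrow> (LINT x|?M. indicator U x * g x)"
    proof (rule integral_dominated_convergence[where w = "\<lambda>x. \<bar>g x\<bar>"])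
      show "AE x in ?M. (\<lambda>n. \<theta> n x * g x) \<longlonglongrightarrow> indicator U x * g x"
        by (intro AE_I2 tendsto_intros \<theta>(3))
      show "AE x in ?M. norm (\<theta> n x * g x) \<le> \<bar>g x\<bar>" for n
        using \<theta>(2) by (intro AE_I2) (auto simp: abs_mult intro!: mult_left_le_one_le)
    qed (use g in \<open>auto intro: integrable_abs\<close>)
    then show ?thesis using 0[OF \<theta>\<Omega>] by (simp add: LIMSEQ_const_iff)
  qed
  have cl: "emeasure lebesgue T = 0" if T: "closed T" "T \<subseteq> {x \<in> \<Omega>. g x > 0}" for T
  proof -
    have Ts: "T \<in> sets lebesgue" using T(1) by auto
    have [measurable]: "indicator T \<in> borel_measurable ?M"
      using T(1) by (intro measurable_restrict_space1 measurable_completion) auto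
    have i: "integrable ?M (\<lambda>x. indicator A x * g x)" if "A \<in> sets borel" for A
    proof -
      have [measurable]: "indicator A \<in> borel_measurable ?M"
        using that by (intro measurable_restrict_space1 measurable_completion) auto
      then show ?thesis using g
        by (intro Bochner_Integration.integrable_bound[OF g]) (measurable, auto simp: indicator_def)
    qed
    have "(LINT x|?M. indicator T x * g x) = (LINT x|?M. indicator \<Omega> x * g x - indicator (\<Omega> - T) x * g x)"
      by (rule Bochner_Integration.integral_cong) (use T in \<open>auto simp: indicator_def\<close>)
    also have "\<dots> = 0 - 0"
      using \<Omega> T(1) op[OF \<Omega>] op[of "\<Omega> - T"]
      by (subst Bochner_Integration.integral_diff) (auto intro!: i simp: open_Diff)
    finally have "(LINT x|?M. indicator T x * g x) = 0" by simp
    moreover have "AE x in ?M. 0 \<le> indicator T x * g x"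
      using T(2) by (intro AE_I2) (auto simp: indicator_def less_imp_le)
    ultimately have "AE x in ?M. indicator T x * g x = 0"
      using integral_nonneg_eq_0_iff_AE[OF i[of T]] T(1) by auto
    then have "AE x in ?M. x \<notin> T" using T(2) by (auto elim!: eventually_mono simp: indicator_def)
    then have "AE x in lebesgue. x \<in> \<Omega> \<longrightarrow> x \<notin> T" using \<Omega>s by (simp add: AE_restrict_space_iff)
    then have "AE x in lebesgue. x \<notin> T" using T(2) by (auto elim!: eventually_mono)
    then show ?thesis using Ts by (subst (asm) AE_iff_measurable[of T]) auto
  qed
  let ?P = "{x \<in> \<Omega>. g x > 0}"
  have "{x \<in> space ?M. g x > 0} \<in> sets ?M" by measurable
  then have P: "?P \<in> sets lebesgue" using \<Omega>s by (auto simp: sets_restrict_space_iff)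
  have "emeasure lebesgue ?P \<le> ennreal e" if "e > 0" for e
  proof -
    obtain T where T: "closed T" "T \<subseteq> ?P" "?P - T \<in> lmeasurable" "emeasure lebesgue (?P - T) < ennreal e"
      using sets_lebesgue_inner_closed[OF P \<open>e > 0\<close>] by blast
    have "?P = T \<union> (?P - T)" using T(2) by auto
    then have "emeasure lebesgue ?P \<le> emeasure lebesgue T + emeasure lebesgue (?P - T)"
      using emeasure_subadditive[of T lebesgue "?P - T"] T(1,3) by auto
    then show ?thesis using cl[OF T(1,2)] T(4) by simp
  qed
  then have "emeasure lebesgue ?P = 0"
    using ennreal_le_epsilon[of 0 "emeasure lebesgue ?P"] by auto
  then have "?P \<in> null_sets lebesgue" using P by auto
  then have "AE x in lebesgue. x \<notin> ?P" by (rule AE_not_in)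
  then show ?thesis using \<Omega>s by (auto simp: AE_restrict_space_iff not_less elim!: eventually_mono)
qed

lemma AE_zero_of_test_functions:
  fixes g :: "'a::euclidean_space \<Rightarrow> real"
  assumes \<Omega>: "open \<Omega>" and g: "integrable (lebesgue_on \<Omega>) g"
    and 0: "\<And>\<phi>. test_function \<Omega> \<phi> \<Longrightarrow> (LINT x|lebesgue_on \<Omega>. \<phi> x * g x) = 0"
  shows "AE x in lebesgue_on \<Omega>. g x = 0"
  using AE_nonpos_of_test_functions[OF assms]
    AE_nonpos_of_test_functions[OF \<Omega>, of "\<lambda>x. - g x"] g 0 by auto

section \<open>The Dirichlet form\<close>

text \<open>Pointwise structure on representatives, so that the abstract forms apply to functions
  directly, without passing to classes.\<close>

instantiation "fun" :: (type, real_vector) real_vector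
begin

definition scaleR_fun :: "real \<Rightarrow> ('a \<Rightarrow> 'b) \<Rightarrow> 'a \<Rightarrow> 'b" where
  "scaleR_fun c f = (\<lambda>x. c *\<^sub>R f x)"

instance
  by standard (auto simp: scaleR_fun_def plus_fun_def scaleR_add_right scaleR_add_left)

end

lemma square_integrable_on_iff: "square_integrable_on \<Omega> f \<longleftrightarrow> f \<in> L2 (lebesgue_on \<Omega>)"
  by (simp add: square_integrable_on_def L2_def)

lemma L2_integrable_scaleR:
  fixes f :: "'a \<Rightarrow> real" and g :: "'a \<Rightarrow> 'b::euclidean_space"
  assumes "f \<in> L2 M" "g \<in> L2 M"
  shows "integrable M (\<lambda>x. f x *\<^sub>R g x)"
proof (rule Bochner_Integration.integrable_bound)
  show "integrable M (\<lambda>x. (norm (f x))\<^sup>2 + (norm (g x))\<^sup>2)" using assms by (auto simp: L2_def)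
  show "(\<lambda>x. f x *\<^sub>R g x) \<in> borel_measurable M" using assms by (auto simp: L2_def)
  have "norm (f x *\<^sub>R g x) \<le> (norm (f x))\<^sup>2 + (norm (g x))\<^sup>2" for x
    using sum_squares_bound[of "norm (f x)" "norm (g x)"]
      mult_nonneg_nonneg[OF norm_ge_zero[of "f x"] norm_ge_zero[of "g x"]]
    unfolding norm_scaleR real_norm_def by linarith
  then show "AE x in M. norm (f x *\<^sub>R g x) \<le> norm ((norm (f x))\<^sup>2 + (norm (g x))\<^sup>2)" by auto
qed

lemma L2_inner: "g \<in> L2 M \<Longrightarrow> (\<lambda>x. g x \<bullet> b) \<in> L2 M"
proof -
  assume g: "g \<in> L2 M"
  have "integrable M (\<lambda>x. (g x \<bullet> b)\<^sup>2)"
  proof (rule Bochner_Integration.integrable_bound)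
    show "integrable M (\<lambda>x. (norm (g x))\<^sup>2 * (norm b)\<^sup>2)" using g by (auto simp: L2_def)
    have "(g x \<bullet> b)\<^sup>2 \<le> (norm (g x))\<^sup>2 * (norm b)\<^sup>2" for x
      using Cauchy_Schwarz_ineq[of "g x" b] by (simp add: power2_norm_eq_inner)
    then show "AE x in M. norm ((g x \<bullet> b)\<^sup>2) \<le> norm ((norm (g x))\<^sup>2 * (norm b)\<^sup>2)" by auto
  qed (use g in \<open>auto simp: L2_def\<close>)
  then show ?thesis using g by (auto simp: L2_def)
qed

lemma dist2_add:
  assumes "f \<in> L2 M" "g \<in> L2 M" "f' \<in> L2 M" "g' \<in> L2 M"
  shows "dist2 M (\<lambda>x. f x + g x) (\<lambda>x. f' x + g' x) \<le> 2 * dist2 M f f' + 2 * dist2 M g g'"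
proof -
  have "dist2 M (\<lambda>x. f x + g x) (\<lambda>x. f' x + g' x) \<le> 2 * dist2 M (\<lambda>x. f x + g x) (\<lambda>x. f' x + g x)
      + 2 * dist2 M (\<lambda>x. f' x + g x) (\<lambda>x. f' x + g' x)"
    using assms by (intro dist2_triangle L2_add)
  then show ?thesis by (simp add: dist2_def)
qed

lemma dist2_scaleR: "dist2 M (\<lambda>x. c *\<^sub>R f x) (\<lambda>x. c *\<^sub>R g x) = c\<^sup>2 * dist2 M f g"
  by (simp add: dist2_def scaleR_diff_right[symmetric] power_mult_distrib)

section \<open>Closure of the gradient on test functions\<close>

locale bounded_open =
  fixes \<Omega> :: "'a::euclidean_space set"
  assumes open_\<Omega>: "open \<Omega>" and bounded_\<Omega>: "bounded \<Omega>"
begin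

abbreviation M where "M \<equiv> lebesgue_on \<Omega>"

lemma \<Omega>_sets: "\<Omega> \<in> sets lebesgue" using open_\<Omega> by auto

lemma borel_measurable_M: "f \<in> borel_measurable borel \<Longrightarrow> f \<in> borel_measurable M"
  by (intro measurable_restrict_space1 measurable_completion) auto

lemma finite_M: "finite_measure M"
proof
  have "emeasure M (space M) = emeasure lborel \<Omega>"
    using open_\<Omega> by (simp add: emeasure_restrict_space)
  then show "emeasure M (space M) \<noteq> \<infinity>"
    using emeasure_bounded_finite[OF bounded_\<Omega>] by simp
qed

lemma one_L2: "(\<lambda>x. 1 :: real) \<in> L2 M"
  using finite_measure.integrable_const[OF finite_M] by (simp add: L2_def)

lemma L2_integrable: "f \<in> L2 M \<Longrightarrow> integrable M f" for f :: "'a \<Rightarrow> real"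
  using L2_integrable_inner[OF _ one_L2] by simp

lemma compact_support_L2:
  fixes f :: "'a \<Rightarrow> 'b::euclidean_space"
  assumes "continuous_on UNIV f" "compact K" "K \<subseteq> \<Omega>" "\<And>x. x \<notin> K \<Longrightarrow> f x = 0"
  shows "f \<in> L2 M"
proof -
  have m: "f \<in> borel_measurable borel" using assms(1) by (rule borel_measurable_continuous_onI)
  have "integrable lborel (\<lambda>x. (norm (f x))\<^sup>2)"
    by (rule compact_support_integrable[of _ K]) (use assms in \<open>auto intro!: continuous_intros\<close>)
  then have "integrable M (\<lambda>x. (norm (f x))\<^sup>2)"
    using assms(3,4) m by (subst lebesgue_on_integral_eq(2)[OF _ \<Omega>_sets]) auto
  then show ?thesis using borel_measurable_M[OF m] by (simp add: L2_def)
qed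

lemma test_L2: "test_function \<Omega> \<phi> \<Longrightarrow> \<phi> \<in> L2 M"
  by (erule test_functionE) (blast intro: compact_support_L2 smooth_continuous)

lemma test_gradient_L2: "test_function \<Omega> \<phi> \<Longrightarrow> gradient \<phi> \<in> L2 M"
  by (erule test_functionE) (blast intro: compact_support_L2 continuous_gradient)

lemma integration_by_parts:
  assumes \<phi>: "test_function \<Omega> \<phi>" and \<psi>: "test_function \<Omega> \<psi>" and b: "b \<in> Basis"
  shows "(LINT x|M. \<phi> x * (gradient \<psi> x \<bullet> b)) = - (LINT x|M. \<psi> x * (gradient \<phi> x \<bullet> b))"
proof -
  have sm: "smooth \<phi>" "smooth \<psi>" using \<phi> \<psi> test_function_smooth by auto
  have t: "test_function \<Omega> (\<lambda>x. \<phi> x * \<psi> x)" using \<phi> sm by (intro test_function_smooth_mult)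
  obtain K where K: "compact K" "K \<subseteq> \<Omega>" "\<And>x. x \<notin> K \<Longrightarrow> \<phi> x * \<psi> x = 0"
      "\<And>x. x \<notin> K \<Longrightarrow> gradient (\<lambda>x. \<phi> x * \<psi> x) x = 0" "smooth (\<lambda>x. \<phi> x * \<psi> x)"
    using test_functionE[OF t] by metis
  have "continuous_on UNIV (\<lambda>x. gradient (\<lambda>x. \<phi> x * \<psi> x) x \<bullet> b)"
    using continuous_gradient[OF K(5)] by (intro continuous_intros)
  then have "(LINT x|M. gradient (\<lambda>x. \<phi> x * \<psi> x) x \<bullet> b) = (LINT x|lborel. gradient (\<lambda>x. \<phi> x * \<psi> x) x \<bullet> b)"
    using K(2,4) by (intro lebesgue_on_integral_eq \<Omega>_sets borel_measurable_continuous_onI)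
      (auto simp: subset_iff intro: arg_cong[where f = "\<lambda>v. v \<bullet> b" and y = 0, simplified])
  also have "\<dots> = 0" using K b by (intro integral_gradient_zero) auto
  finally have "(LINT x|M. \<phi> x * (gradient \<psi> x \<bullet> b) + \<psi> x * (gradient \<phi> x \<bullet> b)) = 0"
    by (simp add: gradient_mult sm inner_add_left)
  then show ?thesis
    using L2_integrable_inner[OF test_L2[OF \<phi>] L2_inner[OF test_gradient_L2[OF \<psi>], of b]]
      L2_integrable_inner[OF test_L2[OF \<psi>] L2_inner[OF test_gradient_L2[OF \<phi>], of b]]
    by (subst (asm) Bochner_Integration.integral_add) auto
qed

text \<open>Square integrability lets a component pass through the vector-valued integral. The
  scalar identities are the form in which the fundamental lemma applies.\<close>

lemma is_weak_gradient_iff: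
  assumes u: "u \<in> L2 M" and g: "g \<in> L2 M"
  shows "is_weak_gradient \<Omega> u g \<longleftrightarrow> (\<forall>\<phi>. test_function \<Omega> \<phi> \<longrightarrow> (\<forall>b\<in>Basis.
    (LINT x|M. u x * (gradient \<phi> x \<bullet> b)) = - (LINT x|M. \<phi> x * (g x \<bullet> b))))"
proof -
  have "(LINT x|M. u x *\<^sub>R gradient \<phi> x) = - (LINT x|M. \<phi> x *\<^sub>R g x) \<longleftrightarrow> (\<forall>b\<in>Basis.
      (LINT x|M. u x * (gradient \<phi> x \<bullet> b)) = - (LINT x|M. \<phi> x * (g x \<bullet> b)))"
    if \<phi>: "test_function \<Omega> \<phi>" for \<phi>
  proof -
    have "(LINT x|M. u x *\<^sub>R gradient \<phi> x) \<bullet> b = (LINT x|M. u x * (gradient \<phi> x \<bullet> b))"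
      "(LINT x|M. \<phi> x *\<^sub>R g x) \<bullet> b = (LINT x|M. \<phi> x * (g x \<bullet> b))" for b
      using integral_inner_left[of b M "\<lambda>x. u x *\<^sub>R gradient \<phi> x"] integral_inner_left[of b M "\<lambda>x. \<phi> x *\<^sub>R g x"]
        L2_integrable_scaleR[OF u test_gradient_L2[OF \<phi>]] L2_integrable_scaleR[OF test_L2[OF \<phi>] g] by auto
    then show ?thesis by (subst euclidean_eq_iff) (simp add: inner_minus_left)
  qed
  then show ?thesis by (auto simp: is_weak_gradient_def)
qed

lemma weak_gradient_unique:
  assumes "u \<in> L2 M" "g \<in> L2 M" "h \<in> L2 M" "is_weak_gradient \<Omega> u g" "is_weak_gradient \<Omega> u h"
  shows "AE x in M. g x = h x"
proof -
  have "AE x in M. (g x - h x) \<bullet> b = 0" if b: "b \<in> Basis" for b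
  proof (rule AE_zero_of_test_functions[OF open_\<Omega>])
    show "integrable M (\<lambda>x. (g x - h x) \<bullet> b)" using assms by (intro L2_integrable L2_inner L2_diff)
    fix \<phi> assume \<phi>: "test_function \<Omega> \<phi>"
    have "(LINT x|M. \<phi> x * (g x \<bullet> b)) = (LINT x|M. \<phi> x * (h x \<bullet> b))"
      using assms \<phi> b by (simp add: is_weak_gradient_iff)
    then show "(LINT x|M. \<phi> x * ((g x - h x) \<bullet> b)) = 0"
      using L2_integrable_inner[OF test_L2[OF \<phi>] L2_inner[OF assms(2), of b]]
        L2_integrable_inner[OF test_L2[OF \<phi>] L2_inner[OF assms(3), of b]]
      by (simp add: inner_diff_left right_diff_distrib)
  qed
  then have "AE x in M. \<forall>b\<in>Basis. (g x - h x) \<bullet> b = 0" by (intro AE_finite_allI) auto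
  then show ?thesis by eventually_elim (auto intro: euclidean_eqI simp: inner_diff_left)
qed

text \<open>The closed graph of the gradient on test functions. Carrying \<open>g\<close> along
  avoids the arbitrary choice inside \<open>weak_gradient\<close>, so sums and limits of gradients
  can be formed directly.\<close>

definition h10_pair :: "('a \<Rightarrow> real) \<Rightarrow> ('a \<Rightarrow> 'a) \<Rightarrow> bool" where
  "h10_pair u g \<longleftrightarrow> u \<in> L2 M \<and> g \<in> L2 M \<and> (\<exists>\<phi>. (\<forall>k::nat. test_function \<Omega> (\<phi> k)) \<and>
     (\<lambda>k. dist2 M (\<phi> k) u) \<longlonglongrightarrow> 0 \<and> (\<lambda>k. dist2 M (gradient (\<phi> k)) g) \<longlonglongrightarrow> 0)"

lemma h10_pair_test: "test_function \<Omega> \<phi> \<Longrightarrow> h10_pair \<phi> (gradient \<phi>)"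
  unfolding h10_pair_def
  by (intro conjI exI[of _ "\<lambda>_. \<phi>"]) (auto simp: dist2_def test_L2 test_gradient_L2)

text \<open>Closability: integration by parts against a fixed test function is continuous in mean
  square and survives the limit.\<close>

lemma h10_pair_weak:
  assumes "h10_pair u g"
  shows "is_weak_gradient \<Omega> u g"
proof -
  obtain \<phi> where \<phi>: "\<And>k::nat. test_function \<Omega> (\<phi> k)" "(\<lambda>k. dist2 M (\<phi> k) u) \<longlonglongrightarrow> 0"
      "(\<lambda>k. dist2 M (gradient (\<phi> k)) g) \<longlonglongrightarrow> 0" and ug: "u \<in> L2 M" "g \<in> L2 M"
    using assms unfolding h10_pair_def by blast
  show ?thesis unfolding is_weak_gradient_iff[OF ug]
  proof (intro allI impI ballI)
    fix \<psi> b assume \<psi>: "test_function \<Omega> \<psi>" and b: "b \<in> (Basis :: 'a set)"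
    have "(\<lambda>k. LINT x|M. \<phi> k x \<bullet> (gradient \<psi> x \<bullet> b)) \<longlonglongrightarrow> (LINT x|M. u x \<bullet> (gradient \<psi> x \<bullet> b))"
      using \<phi> ug L2_inner[OF test_gradient_L2[OF \<psi>]] test_L2 by (intro L2_tendsto_inner) auto
    moreover have "(\<lambda>k. - (LINT x|M. gradient (\<phi> k) x \<bullet> (\<psi> x *\<^sub>R b))) \<longlonglongrightarrow> - (LINT x|M. g x \<bullet> (\<psi> x *\<^sub>R b))"
    proof (intro tendsto_intros L2_tendsto_inner)
      obtain K where K: "smooth \<psi>" "compact K" "K \<subseteq> \<Omega>" "\<And>x. x \<notin> K \<Longrightarrow> \<psi> x = 0"
        using test_functionE[OF \<psi>] by metis
      then show "(\<lambda>x. \<psi> x *\<^sub>R b) \<in> L2 M"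
        by (intro compact_support_L2[of _ K]) (auto intro!: continuous_intros smooth_continuous)
    qed (use \<phi> ug test_gradient_L2 in auto)
    moreover have "(LINT x|M. \<phi> k x \<bullet> (gradient \<psi> x \<bullet> b)) = - (LINT x|M. gradient (\<phi> k) x \<bullet> (\<psi> x *\<^sub>R b))" for k
      using integration_by_parts[OF \<phi>(1)[of k] \<psi> b] by simp
    ultimately show "(LINT x|M. u x * (gradient \<psi> x \<bullet> b)) = - (LINT x|M. \<psi> x * (g x \<bullet> b))"
      by (auto dest: LIMSEQ_unique)
  qed
qed

lemma h10_pair_cong_AE:
  assumes "h10_pair u g" "AE x in M. g x = h x" "h \<in> L2 M"
  shows "h10_pair u h"
proof -
  have "dist2 M f g = dist2 M f h" if "f \<in> L2 M" for f
    unfolding dist2_def using assms that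
    by (intro integral_cong_AE) (auto simp: h10_pair_def L2_def)
  then show ?thesis using assms test_gradient_L2 unfolding h10_pair_def by auto
qed

text \<open>By uniqueness of weak gradients the chosen one agrees with \<open>g\<close> almost
  everywhere, hence is a limit of the same approximating gradients.\<close>

lemma h10_pair_H10:
  assumes p: "h10_pair u g"
  shows "u \<in> H10 \<Omega>" "h10_pair u (weak_gradient \<Omega> u)" "AE x in M. weak_gradient \<Omega> u x = g x"
proof -
  have ug: "u \<in> L2 M" "g \<in> L2 M" using p by (auto simp: h10_pair_def)
  then have ex: "\<exists>g. square_integrable_on \<Omega> g \<and> is_weak_gradient \<Omega> u g"
    using h10_pair_weak[OF p] square_integrable_on_iff by blast
  then have w: "weak_gradient \<Omega> u \<in> L2 M" "is_weak_gradient \<Omega> u (weak_gradient \<Omega> u)"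
    using someI_ex[OF ex, folded weak_gradient_def] by (auto simp: square_integrable_on_iff)
  show ae: "AE x in M. weak_gradient \<Omega> u x = g x"
    using weak_gradient_unique ug w h10_pair_weak[OF p] by blast
  show p': "h10_pair u (weak_gradient \<Omega> u)"
    by (rule h10_pair_cong_AE[OF p _ w(1)]) (use ae in \<open>auto elim: eventually_mono\<close>)
  then obtain \<phi> where \<phi>: "\<And>k::nat. test_function \<Omega> (\<phi> k)" "(\<lambda>k. dist2 M (\<phi> k) u) \<longlonglongrightarrow> 0"
      "(\<lambda>k. dist2 M (gradient (\<phi> k)) (weak_gradient \<Omega> u)) \<longlonglongrightarrow> 0"
    unfolding h10_pair_def by blast
  then show "u \<in> H10 \<Omega>"
    using ex ug tendsto_add[OF \<phi>(2,3)]
    unfolding H10_def H1_def square_integrable_on_iff dist2_def by auto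
qed

lemma H10_pair:
  assumes "u \<in> H10 \<Omega>"
  shows "h10_pair u (weak_gradient \<Omega> u)"
proof -
  have ex: "\<exists>g. square_integrable_on \<Omega> g \<and> is_weak_gradient \<Omega> u g" and u: "u \<in> L2 M"
    using assms by (auto simp: H10_def H1_def square_integrable_on_iff)
  then have w: "weak_gradient \<Omega> u \<in> L2 M"
    using someI_ex[OF ex, folded weak_gradient_def] by (auto simp: square_integrable_on_iff)
  obtain \<phi> where \<phi>: "\<And>k::nat. test_function \<Omega> (\<phi> k)"
    "(\<lambda>k. dist2 M (\<phi> k) u + dist2 M (gradient (\<phi> k)) (weak_gradient \<Omega> u)) \<longlonglongrightarrow> 0"
    using assms unfolding H10_def dist2_def by auto
  have "(\<lambda>k. dist2 M (\<phi> k) u) \<longlonglongrightarrow> 0" "(\<lambda>k. dist2 M (gradient (\<phi> k)) (weak_gradient \<Omega> u)) \<longlonglongrightarrow> 0"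
    by (rule tendsto_sandwich[OF _ _ tendsto_const \<phi>(2)]; simp add: dist2_nonneg)+
  then show ?thesis using u w \<phi>(1) unfolding h10_pair_def by blast
qed

lemma h10_pair_add:
  assumes "h10_pair u g" "h10_pair v h"
  shows "h10_pair (\<lambda>x. u x + v x) (\<lambda>x. g x + h x)"
proof -
  have L: "u \<in> L2 M" "g \<in> L2 M" "v \<in> L2 M" "h \<in> L2 M" using assms by (auto simp: h10_pair_def)
  obtain \<phi> where \<phi>: "\<And>k::nat. test_function \<Omega> (\<phi> k)" "(\<lambda>k. dist2 M (\<phi> k) u) \<longlonglongrightarrow> 0"
      "(\<lambda>k. dist2 M (gradient (\<phi> k)) g) \<longlonglongrightarrow> 0"
    using assms(1) unfolding h10_pair_def by blast
  obtain \<psi> where \<psi>: "\<And>k::nat. test_function \<Omega> (\<psi> k)" "(\<lambda>k. dist2 M (\<psi> k) v) \<longlonglongrightarrow> 0"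
      "(\<lambda>k. dist2 M (gradient (\<psi> k)) h) \<longlonglongrightarrow> 0"
    using assms(2) unfolding h10_pair_def by blast
  have gr: "gradient (\<lambda>x. \<phi> k x + \<psi> k x) = (\<lambda>x. gradient (\<phi> k) x + gradient (\<psi> k) x)" for k
    using test_function_smooth \<phi>(1) \<psi>(1) by (intro ext gradient_add) auto
  have "(\<lambda>k. 2 * dist2 M (\<phi> k) u + 2 * dist2 M (\<psi> k) v) \<longlonglongrightarrow> 2 * 0 + 2 * 0"
    by (intro tendsto_intros \<phi> \<psi>)
  then have l1: "(\<lambda>k. 2 * dist2 M (\<phi> k) u + 2 * dist2 M (\<psi> k) v) \<longlonglongrightarrow> 0" by simp
  have "(\<lambda>k. 2 * dist2 M (gradient (\<phi> k)) g + 2 * dist2 M (gradient (\<psi> k)) h) \<longlonglongrightarrow> 2 * 0 + 2 * 0"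
    by (intro tendsto_intros \<phi> \<psi>)
  then have l2: "(\<lambda>k. 2 * dist2 M (gradient (\<phi> k)) g + 2 * dist2 M (gradient (\<psi> k)) h) \<longlonglongrightarrow> 0" by simp
  have "(\<lambda>k. dist2 M (\<lambda>x. \<phi> k x + \<psi> k x) (\<lambda>x. u x + v x)) \<longlonglongrightarrow> 0"
    by (rule tendsto_sandwich[OF _ _ tendsto_const l1])
      (use \<phi>(1) \<psi>(1) L test_L2 in \<open>auto intro!: always_eventually dist2_add simp: dist2_nonneg\<close>)
  moreover have "(\<lambda>k. dist2 M (gradient (\<lambda>x. \<phi> k x + \<psi> k x)) (\<lambda>x. g x + h x)) \<longlonglongrightarrow> 0"
    unfolding gr by (rule tendsto_sandwich[OF _ _ tendsto_const l2])
      (use \<phi>(1) \<psi>(1) L test_gradient_L2 in \<open>auto intro!: always_eventually dist2_add simp: dist2_nonneg\<close>)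
  ultimately show ?thesis
    unfolding h10_pair_def using L2_add[OF L(1,3)] L2_add[OF L(2,4)] test_function_add[OF \<phi>(1) \<psi>(1)]
    by (intro conjI exI[of _ "\<lambda>k x. \<phi> k x + \<psi> k x"]) auto
qed

lemma h10_pair_scaleR:
  assumes "h10_pair u g"
  shows "h10_pair (\<lambda>x. c *\<^sub>R u x) (\<lambda>x. c *\<^sub>R g x)"
proof -
  have L: "u \<in> L2 M" "g \<in> L2 M" using assms by (auto simp: h10_pair_def)
  obtain \<phi> where \<phi>: "\<And>k::nat. test_function \<Omega> (\<phi> k)" "(\<lambda>k. dist2 M (\<phi> k) u) \<longlonglongrightarrow> 0"
      "(\<lambda>k. dist2 M (gradient (\<phi> k)) g) \<longlonglongrightarrow> 0"
    using assms(1) unfolding h10_pair_def by blast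
  have gr: "gradient (\<lambda>x. c *\<^sub>R \<phi> k x) = (\<lambda>x. c *\<^sub>R gradient (\<phi> k) x)" for k
    using gradient_cmult[OF test_function_smooth[OF \<phi>(1)[of k]], of c] by (intro ext) simp
  have "(\<lambda>k. dist2 M (\<lambda>x. c *\<^sub>R \<phi> k x) (\<lambda>x. c *\<^sub>R u x)) \<longlonglongrightarrow> c\<^sup>2 * 0"
    unfolding dist2_scaleR by (intro tendsto_intros \<phi>)
  moreover have "(\<lambda>k. dist2 M (gradient (\<lambda>x. c *\<^sub>R \<phi> k x)) (\<lambda>x. c *\<^sub>R g x)) \<longlonglongrightarrow> c\<^sup>2 * 0"
    unfolding gr dist2_scaleR by (intro tendsto_intros \<phi>)
  moreover have "test_function \<Omega> (\<lambda>x. c *\<^sub>R \<phi> k x)" for k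
    using test_function_cmult[OF \<phi>(1)] by simp
  ultimately show ?thesis
    unfolding h10_pair_def using L2_scaleR[OF L(1), of c] L2_scaleR[OF L(2), of c]
    by (intro conjI exI[of _ "\<lambda>k x. c *\<^sub>R \<phi> k x"]) auto
qed

lemma h10_pair_complete:
  assumes p: "\<And>n::nat. h10_pair (u n) (g n)"
    and "\<And>e. e > 0 \<Longrightarrow> \<exists>N. \<forall>m\<ge>N. \<forall>n\<ge>N. dist2 M (u m) (u n) + dist2 M (g m) (g n) < e"
  obtains v h where "h10_pair v h" "(\<lambda>n. dist2 M (u n) v) \<longlonglongrightarrow> 0" "(\<lambda>n. dist2 M (g n) h) \<longlonglongrightarrow> 0"
proof -
  have L: "u n \<in> L2 M" "g n \<in> L2 M" for n using p by (auto simp: h10_pair_def)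
  have c1: "\<exists>N. \<forall>m\<ge>N. \<forall>n\<ge>N. dist2 M (u m) (u n) < e" if "e > 0" for e
    using assms(2)[OF that] dist2_nonneg by (meson add_increasing2 order_refl le_less_trans)
  have c2: "\<exists>N. \<forall>m\<ge>N. \<forall>n\<ge>N. dist2 M (g m) (g n) < e" if "e > 0" for e
    using assms(2)[OF that] dist2_nonneg by (meson add_increasing order_refl le_less_trans)
  obtain v where v: "v \<in> L2 M" "(\<lambda>n. dist2 M (u n) v) \<longlonglongrightarrow> 0" using L2_complete[OF L(1) c1] by blast
  obtain h where h: "h \<in> L2 M" "(\<lambda>n. dist2 M (g n) h) \<longlonglongrightarrow> 0" using L2_complete[OF L(2) c2] by blast
  \<comment> \<open>Diagonal choice: one test function within \<open>1 / real (Suc n)\<close> of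
    each pair replaces the double sequence.\<close>
  have "\<exists>\<phi>. test_function \<Omega> \<phi> \<and> dist2 M \<phi> (u n) < 1 / real (Suc n) \<and> dist2 M (gradient \<phi>) (g n) < 1 / real (Suc n)" for n
  proof -
    obtain \<phi> where \<phi>: "\<And>k::nat. test_function \<Omega> (\<phi> k)" "(\<lambda>k. dist2 M (\<phi> k) (u n)) \<longlonglongrightarrow> 0"
        "(\<lambda>k. dist2 M (gradient (\<phi> k)) (g n)) \<longlonglongrightarrow> 0"
      using p[of n] unfolding h10_pair_def by blast
    have "eventually (\<lambda>k. dist2 M (\<phi> k) (u n) < 1 / real (Suc n) \<and> dist2 M (gradient (\<phi> k)) (g n) < 1 / real (Suc n)) sequentially"
      using \<phi>(2,3) by (intro eventually_conj order_tendstoD) auto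
    then show ?thesis using \<phi>(1) by (auto simp: eventually_sequentially)
  qed
  then obtain \<phi> where \<phi>: "\<And>n. test_function \<Omega> (\<phi> n)" "\<And>n. dist2 M (\<phi> n) (u n) < 1 / real (Suc n)"
    "\<And>n. dist2 M (gradient (\<phi> n)) (g n) < 1 / real (Suc n)" by metis
  have lim: "(\<lambda>n. 2 * (1 / real (Suc n)) + 2 * a n) \<longlonglongrightarrow> 0" if "a \<longlonglongrightarrow> 0" for a
  proof -
    have "(\<lambda>n. 2 * (1 / real (Suc n)) + 2 * a n) \<longlonglongrightarrow> 2 * 0 + 2 * 0"
      by (intro tendsto_intros that LIMSEQ_Suc lim_1_over_n)
    then show ?thesis by simp
  qed
  have "(\<lambda>n. dist2 M (\<phi> n) v) \<longlonglongrightarrow> 0"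
  proof (rule tendsto_sandwich[OF _ _ tendsto_const lim[OF v(2)]])
    have "dist2 M (\<phi> n) v \<le> 2 * (1 / real (Suc n)) + 2 * dist2 M (u n) v" for n
      using dist2_triangle[OF test_L2[OF \<phi>(1)[of n]] L(1)[of n] v(1)] \<phi>(2)[of n] by linarith
    then show "eventually (\<lambda>n. dist2 M (\<phi> n) v \<le> 2 * (1 / real (Suc n)) + 2 * dist2 M (u n) v) sequentially"
      by (intro always_eventually allI)
  qed (simp add: dist2_nonneg)
  moreover have "(\<lambda>n. dist2 M (gradient (\<phi> n)) h) \<longlonglongrightarrow> 0"
  proof (rule tendsto_sandwich[OF _ _ tendsto_const lim[OF h(2)]])
    have "dist2 M (gradient (\<phi> n)) h \<le> 2 * (1 / real (Suc n)) + 2 * dist2 M (g n) h" for n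
      using dist2_triangle[OF test_gradient_L2[OF \<phi>(1)[of n]] L(2)[of n] h(1)] \<phi>(3)[of n] by linarith
    then show "eventually (\<lambda>n. dist2 M (gradient (\<phi> n)) h \<le> 2 * (1 / real (Suc n)) + 2 * dist2 M (g n) h) sequentially"
      by (intro always_eventually allI)
  qed (simp add: dist2_nonneg)
  ultimately have "h10_pair v h" unfolding h10_pair_def using v h \<phi>(1) by blast
  then show thesis using that v h by blast
qed

section \<open>The mass form and the energy form\<close>

definition ip :: "('a \<Rightarrow> real) \<Rightarrow> ('a \<Rightarrow> real) \<Rightarrow> real" where
  "ip u v = (LINT x|M. u x * v x)"

definition en :: "('a \<Rightarrow> real) \<Rightarrow> ('a \<Rightarrow> real) \<Rightarrow> real" where
  "en u v = (LINT x|M. weak_gradient \<Omega> u x \<bullet> weak_gradient \<Omega> v x)"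

text \<open>Frees computations from the choice in \<open>weak_gradient\<close>: any gradients
  obtained as limits give the same energy.\<close>

lemma en_eq:
  assumes "h10_pair u g" "h10_pair v h"
  shows "en u v = (LINT x|M. g x \<bullet> h x)"
proof -
  note a = h10_pair_H10(2,3)[OF assms(1)] h10_pair_H10(2,3)[OF assms(2)]
  have [measurable]: "g \<in> borel_measurable M" "h \<in> borel_measurable M"
    "weak_gradient \<Omega> u \<in> borel_measurable M" "weak_gradient \<Omega> v \<in> borel_measurable M"
    using assms a by (auto simp: h10_pair_def L2_def)
  show ?thesis unfolding en_def
    by (rule integral_cong_AE) (measurable, use a(2,4) in eventually_elim, simp)
qed

lemma ip_self: "ip u u = (LINT x|M. (norm (u x))\<^sup>2)"
  by (simp add: ip_def power2_eq_square)

lemma ip_diff_self: "ip (u - v) (u - v) = dist2 M u v"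
  by (simp add: ip_self dist2_def)

lemma H10_L2: "u \<in> H10 \<Omega> \<Longrightarrow> u \<in> L2 M"
  using H10_pair unfolding h10_pair_def by blast

lemma H10_sum_pair: "\<lbrakk>u \<in> H10 \<Omega>; v \<in> H10 \<Omega>\<rbrakk> \<Longrightarrow>
    h10_pair (u + v) (\<lambda>x. weak_gradient \<Omega> u x + weak_gradient \<Omega> v x)"
  unfolding plus_fun_def by (intro h10_pair_add H10_pair)

lemma H10_scale_pair: "u \<in> H10 \<Omega> \<Longrightarrow> h10_pair (c *\<^sub>R u) (\<lambda>x. c *\<^sub>R weak_gradient \<Omega> u x)"
  unfolding scaleR_fun_def by (intro h10_pair_scaleR H10_pair)

lemma en_diff_self:
  assumes "h10_pair u g" "h10_pair v h"
  shows "en (u - v) (u - v) = dist2 M g h"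
proof -
  have "h10_pair (\<lambda>x. u x + (- 1) *\<^sub>R v x) (\<lambda>x. g x + (- 1) *\<^sub>R h x)"
    by (intro h10_pair_add h10_pair_scaleR assms)
  then have "h10_pair (u - v) (\<lambda>x. g x - h x)" by (simp add: fun_diff_def)
  then show ?thesis by (simp add: en_eq dist2_def power2_norm_eq_inner)
qed

lemma psd_ip: "psd_form (L2 M) ip"
proof
  show "subspace (L2 M :: ('a \<Rightarrow> real) set)"
    unfolding subspace_def zero_fun_def plus_fun_def scaleR_fun_def
    by (intro conjI ballI allI L2_zero L2_add L2_scaleR)
  show "ip (u + v) w = ip u w + ip v w" if "u \<in> L2 M" "v \<in> L2 M" "w \<in> L2 M" for u v w
    using L2_integrable_inner[OF that(1,3)] L2_integrable_inner[OF that(2,3)]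
    by (simp add: ip_def distrib_right)
  show "ip (c *\<^sub>R u) w = c * ip u w" for c u w by (simp add: ip_def scaleR_fun_def mult.assoc)
  show "ip u w = ip w u" for u w by (simp add: ip_def mult.commute)
  show "0 \<le> ip u u" for u by (simp add: ip_def)
qed

lemma psd_en: "psd_form (H10 \<Omega>) en"
proof
  have "h10_pair 0 (\<lambda>x. 0)" unfolding zero_fun_def
    using h10_pair_scaleR[OF h10_pair_test[OF test_function_0], of 0] by simp
  then show "subspace (H10 \<Omega>)"
    unfolding subspace_def using H10_sum_pair H10_scale_pair h10_pair_H10(1) by blast
  have L: "weak_gradient \<Omega> u \<in> L2 M" if "u \<in> H10 \<Omega>" for u
    using H10_pair[OF that] by (simp add: h10_pair_def)
  show "en (u + v) w = en u w + en v w" if "u \<in> H10 \<Omega>" "v \<in> H10 \<Omega>" "w \<in> H10 \<Omega>" for u v w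
    unfolding en_eq[OF H10_sum_pair[OF that(1,2)] H10_pair[OF that(3)]]
    using L2_integrable_inner[OF L[OF that(1)] L[OF that(3)]] L2_integrable_inner[OF L[OF that(2)] L[OF that(3)]]
    by (simp add: inner_add_left en_def)
  show "en (c *\<^sub>R u) w = c * en u w" if "u \<in> H10 \<Omega>" "w \<in> H10 \<Omega>" for c u w
    unfolding en_eq[OF H10_scale_pair[OF that(1)] H10_pair[OF that(2)]] by (simp add: en_def)
  show "en u w = en w u" for u w by (simp add: en_def inner_commute)
  show "0 \<le> en u u" for u by (simp add: en_def)
qed

lemma H10_complete:
  assumes w: "\<And>n::nat. w n \<in> H10 \<Omega>"
    and c: "\<And>e. e > 0 \<Longrightarrow> \<exists>N. \<forall>m\<ge>N. \<forall>n\<ge>N. ip (w m - w n) (w m - w n) + en (w m - w n) (w m - w n) < e"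
  shows "\<exists>u\<in>H10 \<Omega>. (\<lambda>n. ip (w n - u) (w n - u) + en (w n - u) (w n - u)) \<longlonglongrightarrow> 0"
proof -
  have p: "h10_pair (w n) (weak_gradient \<Omega> (w n))" for n by (rule H10_pair[OF w])
  obtain v h where v: "h10_pair v h" "(\<lambda>n. dist2 M (w n) v) \<longlonglongrightarrow> 0"
      "(\<lambda>n. dist2 M (weak_gradient \<Omega> (w n)) h) \<longlonglongrightarrow> 0"
    by (rule h10_pair_complete[OF p]) (use c in \<open>simp_all add: ip_diff_self en_diff_self[OF p p]\<close>)
  have "(\<lambda>n. dist2 M (w n) v + dist2 M (weak_gradient \<Omega> (w n)) h) \<longlonglongrightarrow> 0 + 0"
    using v by (intro tendsto_intros)
  then show ?thesis using h10_pair_H10(1)[OF v(1)]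
    by (intro bexI[of _ v]) (simp_all add: ip_diff_self en_diff_self[OF p v(1)])
qed

lemma test_H10: "test_function \<Omega> \<phi> \<Longrightarrow> \<phi> \<in> H10 \<Omega>"
  using h10_pair_H10(1) h10_pair_test by blast

lemma en_test: "test_function \<Omega> \<phi> \<Longrightarrow> en \<phi> \<phi> = (LINT x|M. (norm (gradient \<phi> x))\<^sup>2)"
  by (simp add: en_eq[OF h10_pair_test h10_pair_test] power2_norm_eq_inner)

end

section \<open>Approximation by averages over cubes\<close>

lemma nn_integral_lborel_translate:
  fixes f :: "'a::euclidean_space \<Rightarrow> ennreal"
  assumes [measurable]: "f \<in> borel_measurable borel"
  shows "(\<integral>\<^sup>+x. f (c + x) \<partial>lborel) = (\<integral>\<^sup>+x. f x \<partial>lborel)"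
proof -
  have "(\<integral>\<^sup>+x. f x \<partial>lborel) = (\<integral>\<^sup>+x. f x \<partial>distr lborel borel ((+) c))" by (simp add: lborel_distr_plus)
  then show ?thesis by (simp add: nn_integral_distr)
qed

text \<open>The increment \<open>c\<close> is the mean of \<open>g\<close> over the unit interval,
  and the variance about the mean is nonnegative.\<close>

lemma square_increment_le:
  fixes g :: "real \<Rightarrow> real"
  assumes F: "\<And>t. (F has_field_derivative g t) (at t)" and g: "continuous_on UNIV g"
  shows "ennreal ((F 1 - F 0)\<^sup>2) \<le> (\<integral>\<^sup>+t. ennreal ((g t)\<^sup>2) * indicator {0..1} t \<partial>lborel)"
proof -
  have gc: "isCont g t" for t using g by (simp add: continuous_on_eq_continuous_at)
  define c where "c = F 1 - F 0"
  have 1: "(LINT t|lborel. g t * indicator {0..1} t) = c"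
    unfolding c_def by (rule integral_FTC_Icc_real) (use F gc in auto)
  have i1: "integrable lborel (\<lambda>t. g t * indicator {0..1} t)"
    by (rule borel_integrable_atLeastAtMost) (use gc in auto)
  have i2: "integrable lborel (\<lambda>t. (g t)\<^sup>2 * indicator {0..1} t)"
    by (rule borel_integrable_atLeastAtMost) (use gc in \<open>auto intro!: continuous_intros\<close>)
  have i3: "integrable lborel (\<lambda>t. c\<^sup>2 * indicator {0..1::real} t)"
    by (rule borel_integrable_atLeastAtMost) auto
  have "0 \<le> (LINT t|lborel. (g t - c)\<^sup>2 * indicator {0..1} t)" by simp
  also have "\<dots> = (LINT t|lborel. (g t)\<^sup>2 * indicator {0..1} t - 2 * c * (g t * indicator {0..1} t) + c\<^sup>2 * indicator {0..1} t)"
    by (rule Bochner_Integration.integral_cong) (auto simp: power2_diff algebra_simps)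
  also have "\<dots> = (LINT t|lborel. (g t)\<^sup>2 * indicator {0..1} t) - 2 * c * c + c\<^sup>2"
    using i1 i2 i3 1 by simp
  finally have "c\<^sup>2 \<le> (LINT t|lborel. (g t)\<^sup>2 * indicator {0..1} t)" by (simp add: power2_eq_square)
  then have "ennreal (c\<^sup>2) \<le> ennreal (LINT t|lborel. (g t)\<^sup>2 * indicator {0..1} t)" by (rule ennreal_leI)
  also have "\<dots> = (\<integral>\<^sup>+t. ennreal ((g t)\<^sup>2 * indicator {0..1} t) \<partial>lborel)"
    using i2 by (intro nn_integral_eq_integral[symmetric]) auto
  also have "\<dots> = (\<integral>\<^sup>+t. ennreal ((g t)\<^sup>2) * indicator {0..1} t \<partial>lborel)"
    by (intro nn_integral_cong) (auto simp: indicator_def)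
  finally show ?thesis unfolding c_def .
qed

text \<open>Integrate the squared increment along the segment from \<open>x\<close> to
  \<open>x + z\<close>; by Fubini and translation invariance every intermediate point contributes
  the same gradient integral. Nonnegative integrals spare all integrability conditions.\<close>

lemma translation_estimate:
  fixes u :: "'a::euclidean_space \<Rightarrow> real"
  assumes u: "smooth u"
  shows "(\<integral>\<^sup>+x. ennreal ((u (x + z) - u x)\<^sup>2) \<partial>lborel)
    \<le> ennreal ((norm z)\<^sup>2) * (\<integral>\<^sup>+x. ennreal ((norm (gradient u x))\<^sup>2) \<partial>lborel)"
proof -
  note [measurable] = smooth_borel[OF u] gradient_borel[OF u]
  have "ennreal ((u (x + z) - u x)\<^sup>2)
      \<le> (\<integral>\<^sup>+t. ennreal ((norm z)\<^sup>2) * ennreal ((norm (gradient u (x + t *\<^sub>R z)))\<^sup>2) * indicator {0..1} t \<partial>lborel)" for x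
  proof -
    have "ennreal ((u (x + 1 *\<^sub>R z) - u (x + 0 *\<^sub>R z))\<^sup>2)
        \<le> (\<integral>\<^sup>+t. ennreal ((gradient u (x + t *\<^sub>R z) \<bullet> z)\<^sup>2) * indicator {0..1} t \<partial>lborel)"
    proof (rule square_increment_le)
      show "((\<lambda>t. u (x + t *\<^sub>R z)) has_field_derivative gradient u (x + t *\<^sub>R z) \<bullet> z) (at t)" for t
        by (rule smooth_line_derivative[OF u])
    next
      show "continuous_on UNIV (\<lambda>t. gradient u (x + t *\<^sub>R z) \<bullet> z)"
        by (intro continuous_intros continuous_on_compose2[OF continuous_gradient[OF u]]) auto
    qed
    also have "\<dots> \<le> (\<integral>\<^sup>+t. ennreal ((norm z)\<^sup>2) * ennreal ((norm (gradient u (x + t *\<^sub>R z)))\<^sup>2) * indicator {0..1} t \<partial>lborel)"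
    proof (intro nn_integral_mono mult_right_mono)
      fix t
      have "(gradient u (x + t *\<^sub>R z) \<bullet> z)\<^sup>2 \<le> (norm z)\<^sup>2 * (norm (gradient u (x + t *\<^sub>R z)))\<^sup>2"
        using Cauchy_Schwarz_ineq[of "gradient u (x + t *\<^sub>R z)" z] by (simp add: power2_norm_eq_inner mult.commute)
      then show "ennreal ((gradient u (x + t *\<^sub>R z) \<bullet> z)\<^sup>2) \<le> ennreal ((norm z)\<^sup>2) * ennreal ((norm (gradient u (x + t *\<^sub>R z)))\<^sup>2)"
        by (simp add: ennreal_mult[symmetric] ennreal_leI)
    qed simp
    finally show ?thesis by simp
  qed
  then have "(\<integral>\<^sup>+x. ennreal ((u (x + z) - u x)\<^sup>2) \<partial>lborel)
      \<le> (\<integral>\<^sup>+x. \<integral>\<^sup>+t. ennreal ((norm z)\<^sup>2) * ennreal ((norm (gradient u (x + t *\<^sub>R z)))\<^sup>2) * indicator {0..1} t \<partial>lborel \<partial>lborel)"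
    by (intro nn_integral_mono)
  also have "\<dots> = (\<integral>\<^sup>+t. \<integral>\<^sup>+x. ennreal ((norm z)\<^sup>2) * ennreal ((norm (gradient u (x + t *\<^sub>R z)))\<^sup>2) * indicator {0..1} t \<partial>lborel \<partial>lborel)"
    by (rule lborel_pair.Fubini') measurable
  also have "\<dots> = (\<integral>\<^sup>+t. (ennreal ((norm z)\<^sup>2) * (\<integral>\<^sup>+x. ennreal ((norm (gradient u x))\<^sup>2) \<partial>lborel)) * indicator {0..1::real} t \<partial>lborel)"
  proof (rule nn_integral_cong)
    fix t :: real
    have "(\<integral>\<^sup>+x. ennreal ((norm (gradient u (x + t *\<^sub>R z)))\<^sup>2) \<partial>lborel) = (\<integral>\<^sup>+x. ennreal ((norm (gradient u x))\<^sup>2) \<partial>lborel)"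
      using nn_integral_lborel_translate[of "\<lambda>x. ennreal ((norm (gradient u x))\<^sup>2)" "t *\<^sub>R z"]
      by (simp add: add.commute)
    then show "(\<integral>\<^sup>+x. ennreal ((norm z)\<^sup>2) * ennreal ((norm (gradient u (x + t *\<^sub>R z)))\<^sup>2) * indicator {0..1} t \<partial>lborel)
        = (ennreal ((norm z)\<^sup>2) * (\<integral>\<^sup>+x. ennreal ((norm (gradient u x))\<^sup>2) \<partial>lborel)) * indicator {0..1} t"
      by (simp add: nn_integral_cmult nn_integral_multc)
  qed
  also have "\<dots> = ennreal ((norm z)\<^sup>2) * (\<integral>\<^sup>+x. ennreal ((norm (gradient u x))\<^sup>2) \<partial>lborel)"
    by (subst nn_integral_cmult_indicator) auto
  finally show ?thesis .
qed

text \<open>Cells are half-open, hence disjoint, and the shift by \<open>\<rho>\<close> lets natural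
  numbers index a grid that starts at \<open>- \<rho>\<close> in each coordinate.\<close>

definition grid_cube :: "real \<Rightarrow> real \<Rightarrow> ('a::euclidean_space \<Rightarrow> nat) \<Rightarrow> 'a set" where
  "grid_cube \<rho> s k = {x. \<forall>b\<in>Basis. s * real (k b) \<le> x \<bullet> b + \<rho> \<and> x \<bullet> b + \<rho> < s * (real (k b) + 1)}"

lemma grid_cube_borel [measurable]: "(grid_cube \<rho> s k :: 'a::euclidean_space set) \<in> sets borel"
proof -
  have "{x \<in> space borel. \<forall>b\<in>Basis. s * real (k b) \<le> x \<bullet> b + \<rho> \<and> x \<bullet> b + \<rho> < s * (real (k b) + 1)}
      \<in> sets (borel :: 'a measure)"
    by (intro sets.sets_Collect_finite_All sets.sets_Collect_conj finite_Basis) measurable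
  then show ?thesis by (simp add: grid_cube_def)
qed

text \<open>A half-open cell lies between an open and a closed box of equal volume.\<close>

lemma emeasure_grid_cube:
  fixes k :: "'a::euclidean_space \<Rightarrow> nat"
  assumes "s > 0"
  shows "emeasure lborel (grid_cube \<rho> s k :: 'a set) = ennreal (s ^ DIM('a))"
proof (rule antisym)
  define l u :: 'a where "l = (\<Sum>b\<in>Basis. (s * real (k b) - \<rho>) *\<^sub>R b)"
    and "u = (\<Sum>b\<in>Basis. (s * (real (k b) + 1) - \<rho>) *\<^sub>R b)"
  have lu: "l \<bullet> b = s * real (k b) - \<rho>" "u \<bullet> b = s * (real (k b) + 1) - \<rho>" if "b \<in> Basis" for b
    using that by (simp_all add: l_def u_def)
  have le: "l \<bullet> b \<le> u \<bullet> b" if "b \<in> Basis" for b using lu[OF that] assms by (simp add: algebra_simps)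
  have p: "(\<Prod>b\<in>Basis. (u - l) \<bullet> b) = s ^ DIM('a)"
    by (simp add: inner_diff_left lu algebra_simps)
  have "box l u \<subseteq> grid_cube \<rho> s k" "grid_cube \<rho> s k \<subseteq> cbox l u"
    using lu by (force simp: grid_cube_def mem_box)+
  from emeasure_mono[OF this(1), of lborel] emeasure_mono[OF this(2), of lborel]
  show "emeasure lborel (grid_cube \<rho> s k :: 'a set) \<le> ennreal (s ^ DIM('a))"
    "ennreal (s ^ DIM('a)) \<le> emeasure lborel (grid_cube \<rho> s k :: 'a set)"
    using emeasure_lborel_box[OF le] emeasure_lborel_cbox[OF le] by (simp_all add: p)
qed

lemma grid_cube_index:
  assumes "s > 0" "x \<in> grid_cube \<rho> s k" "b \<in> Basis"
  shows "k b = nat \<lfloor>(x \<bullet> b + \<rho>) / s\<rfloor>"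
proof -
  have "\<lfloor>(x \<bullet> b + \<rho>) / s\<rfloor> = int (k b)"
    using assms by (intro floor_unique) (auto simp: grid_cube_def field_simps)
  then show ?thesis by simp
qed

text \<open>A point determines \<open>k\<close> on \<open>Basis\<close> by rounding down;
  extensionality fixes its values elsewhere.\<close>

lemma grid_cube_disjoint:
  assumes "s > 0" "x \<in> grid_cube \<rho> s k" "x \<in> grid_cube \<rho> s k'" "k \<in> extensional Basis" "k' \<in> extensional Basis"
  shows "k = k'"
  using assms grid_cube_index[OF assms(1,2)] grid_cube_index[OF assms(1,3)]
  by (intro extensionalityI[of _ Basis]) auto

lemma grid_cube_cover:
  fixes x :: "'a::euclidean_space"
  assumes \<rho>: "\<rho> > 0" "\<And>b. b \<in> Basis \<Longrightarrow> \<bar>x \<bullet> b\<bar> < \<rho>" and N: "N > 0"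
  shows "\<exists>k\<in>Basis \<rightarrow>\<^sub>E {..<N}. x \<in> grid_cube \<rho> (2 * \<rho> / real N) k"
proof -
  let ?s = "2 * \<rho> / real N"
  have s: "?s > 0" using \<rho> N by simp
  define k where "k = (\<lambda>b\<in>Basis. nat \<lfloor>(x \<bullet> b + \<rho>) / ?s\<rfloor>)"
  have *: "0 \<le> (x \<bullet> b + \<rho>) / ?s" "(x \<bullet> b + \<rho>) / ?s < real N" if "b \<in> Basis" for b
  proof -
    have "0 \<le> x \<bullet> b + \<rho>" "x \<bullet> b + \<rho> < 2 * \<rho>" using \<rho>(2)[OF that] by linarith+
    then show "0 \<le> (x \<bullet> b + \<rho>) / ?s" using s by (intro divide_nonneg_pos)
    have "2 * \<rho> = real N * ?s" using N by simp
    then show "(x \<bullet> b + \<rho>) / ?s < real N"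
      using \<open>x \<bullet> b + \<rho> < 2 * \<rho>\<close> s by (simp only: pos_divide_less_eq[OF s])
  qed
  have "k b < N" if "b \<in> Basis" for b
    using *[OF that] that by (simp add: k_def floor_less_iff nat_less_iff)
  moreover have "?s * real (k b) \<le> x \<bullet> b + \<rho>" "x \<bullet> b + \<rho> < ?s * (real (k b) + 1)" if "b \<in> Basis" for b
  proof -
    have k: "real (k b) = of_int \<lfloor>(x \<bullet> b + \<rho>) / ?s\<rfloor>" using *(1)[OF that] that by (simp add: k_def)
    have "real (k b) \<le> (x \<bullet> b + \<rho>) / ?s" "(x \<bullet> b + \<rho>) / ?s < real (k b) + 1" unfolding k by linarith+
    then have "real (k b) * ?s \<le> x \<bullet> b + \<rho>" "x \<bullet> b + \<rho> < (real (k b) + 1) * ?s"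
      by (simp_all only: pos_le_divide_eq[OF s] pos_divide_less_eq[OF s])
    then show "?s * real (k b) \<le> x \<bullet> b + \<rho>" "x \<bullet> b + \<rho> < ?s * (real (k b) + 1)"
      by (simp_all only: mult.commute[of ?s])
  qed
  ultimately show ?thesis by (intro bexI[of _ k]) (auto simp: grid_cube_def k_def)
qed

text \<open>This turns the gap between mean square and squared mean into a double integral of
  differences, the form in which translations can act. Nonnegativity is recorded because
  \<open>ennreal\<close> would hide a negative value.\<close>

lemma double_integral_variance:
  fixes u :: "'a::euclidean_space \<Rightarrow> real"
  assumes Q [measurable]: "Q \<in> sets borel" and v: "emeasure lborel Q = ennreal v" "v \<ge> 0"
    and u: "integrable lborel (\<lambda>x. indicator Q x * u x)" "integrable lborel (\<lambda>x. indicator Q x * (u x)\<^sup>2)"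
    and [measurable]: "u \<in> borel_measurable borel"
  shows "ennreal (2 * v * (LINT x|lborel. indicator Q x * (u x)\<^sup>2) - 2 * (LINT x|lborel. indicator Q x * u x)\<^sup>2)
    = (\<integral>\<^sup>+x. \<integral>\<^sup>+y. indicator Q x * indicator Q y * ennreal ((u y - u x)\<^sup>2) \<partial>lborel \<partial>lborel)" (is ?eq)
    and "0 \<le> 2 * v * (LINT x|lborel. indicator Q x * (u x)\<^sup>2) - 2 * (LINT x|lborel. indicator Q x * u x)\<^sup>2"
proof -
  let ?a = "LINT x|lborel. indicator Q x * u x" and ?b = "LINT x|lborel. indicator Q x * (u x)\<^sup>2"
  have iQ: "integrable lborel (indicator Q :: 'a \<Rightarrow> real)" using v by (intro integrable_real_indicator) auto
  have vQ: "(LINT x|lborel. indicator Q x) = v" using v by (simp add: measure_def)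
  have inner: "(LINT y|lborel. indicator Q y * (u y - u x)\<^sup>2) = ?b - 2 * u x * ?a + v * (u x)\<^sup>2"
    "integrable lborel (\<lambda>y. indicator Q y * (u y - u x)\<^sup>2)" for x
  proof -
    have e: "indicator Q y * (u y - u x)\<^sup>2
        = indicator Q y * (u y)\<^sup>2 - 2 * u x * (indicator Q y * u y) + (u x)\<^sup>2 * indicator Q y" for y
      by (simp add: power2_diff algebra_simps)
    show "(LINT y|lborel. indicator Q y * (u y - u x)\<^sup>2) = ?b - 2 * u x * ?a + v * (u x)\<^sup>2"
      unfolding e using u iQ vQ by simp
    show "integrable lborel (\<lambda>y. indicator Q y * (u y - u x)\<^sup>2)"
      unfolding e using u iQ by simp
  qed
  have e: "indicator Q x * (?b - 2 * u x * ?a + v * (u x)\<^sup>2)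
      = ?b * indicator Q x - 2 * ?a * (indicator Q x * u x) + v * (indicator Q x * (u x)\<^sup>2)" for x
    by (simp add: algebra_simps)
  have outer: "(LINT x|lborel. indicator Q x * (?b - 2 * u x * ?a + v * (u x)\<^sup>2)) = 2 * v * ?b - 2 * ?a\<^sup>2"
    unfolding e using u iQ vQ by (simp add: power2_eq_square)
  have oi: "integrable lborel (\<lambda>x. indicator Q x * (?b - 2 * u x * ?a + v * (u x)\<^sup>2))"
    unfolding e using u iQ by simp
  have nn: "0 \<le> ?b - 2 * u x * ?a + v * (u x)\<^sup>2" for x
    unfolding inner(1)[symmetric] by simp
  have "(\<integral>\<^sup>+y. indicator Q x * indicator Q y * ennreal ((u y - u x)\<^sup>2) \<partial>lborel)
      = ennreal (indicator Q x * (?b - 2 * u x * ?a + v * (u x)\<^sup>2))" for x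
  proof -
    have "(\<integral>\<^sup>+y. indicator Q x * indicator Q y * ennreal ((u y - u x)\<^sup>2) \<partial>lborel)
        = indicator Q x * (\<integral>\<^sup>+y. ennreal (indicator Q y * (u y - u x)\<^sup>2) \<partial>lborel)"
      by (subst nn_integral_cmult[symmetric]) (auto intro!: nn_integral_cong simp: indicator_def)
    also have "\<dots> = indicator Q x * ennreal (?b - 2 * u x * ?a + v * (u x)\<^sup>2)"
      using inner by (subst nn_integral_eq_integral) auto
    finally show ?thesis by (simp add: indicator_def)
  qed
  then have "(\<integral>\<^sup>+x. \<integral>\<^sup>+y. indicator Q x * indicator Q y * ennreal ((u y - u x)\<^sup>2) \<partial>lborel \<partial>lborel)
      = (\<integral>\<^sup>+x. ennreal (indicator Q x * (?b - 2 * u x * ?a + v * (u x)\<^sup>2)) \<partial>lborel)" by simp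
  also have "\<dots> = ennreal (2 * v * ?b - 2 * ?a\<^sup>2)"
    using oi nn by (subst nn_integral_eq_integral) (auto simp: outer)
  finally show ?eq by simp
  show "0 \<le> 2 * v * ?b - 2 * ?a\<^sup>2"
    unfolding outer[symmetric] using nn by (intro integral_nonneg_AE AE_I2) auto
qed

definition centered_cube :: "real \<Rightarrow> 'a::euclidean_space set" where
  "centered_cube L = {x. \<forall>b\<in>Basis. \<bar>x \<bullet> b\<bar> \<le> L / 2}"

lemma centered_cube_eq: "centered_cube L = cbox ((- L / 2) *\<^sub>R One) ((L / 2) *\<^sub>R One)"
  by (force simp: centered_cube_def mem_box abs_le_iff)

lemma centered_cube_borel [measurable]: "centered_cube L \<in> sets borel"
  by (simp add: centered_cube_eq)

lemma emeasure_centered_cube_finite: "emeasure lborel (centered_cube L) < \<infinity>"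
  unfolding centered_cube_eq by (rule emeasure_lborel_cbox_finite)

lemma emeasure_centered_cube:
  assumes "L \<ge> 0"
  shows "emeasure lborel (centered_cube L :: 'a::euclidean_space set) = ennreal (L ^ DIM('a))"
proof -
  have "emeasure lborel (centered_cube L :: 'a set)
      = ennreal (\<Prod>b\<in>Basis. ((L / 2) *\<^sub>R One - (- L / 2) *\<^sub>R One :: 'a) \<bullet> b)"
    unfolding centered_cube_eq using assms by (intro emeasure_lborel_cbox) auto
  also have "(\<Prod>b\<in>Basis. ((L / 2) *\<^sub>R One - (- L / 2) *\<^sub>R One :: 'a) \<bullet> b) = (\<Prod>b\<in>(Basis :: 'a set). L)"
    by (intro prod.cong) (simp_all add: inner_diff_left inner_add_left)
  finally show ?thesis by simp
qed

lemma norm_square_le_cube: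
  fixes z :: "'a::euclidean_space" and s :: real
  assumes "\<And>b. b \<in> Basis \<Longrightarrow> \<bar>z \<bullet> b\<bar> \<le> s"
  shows "(norm z)\<^sup>2 \<le> DIM('a) * s\<^sup>2"
proof -
  have "(norm z)\<^sup>2 = (\<Sum>b\<in>Basis. (z \<bullet> b)\<^sup>2)"
    unfolding power2_norm_eq_inner euclidean_inner[of z z] by (simp add: power2_eq_square)
  also have "\<dots> \<le> (\<Sum>b\<in>(Basis :: 'a set). s\<^sup>2)"
    using assms by (intro sum_mono) (metis abs_ge_zero power2_abs power_mono)
  finally show ?thesis by simp
qed

text \<open>The cells are disjoint, so two points of the same cell differ by a vector of a cube of side
  \<open>2s\<close>; integrating the translation estimate over that cube replaces Poincare's inequality in each cell.\<close>

lemma grid_poincare: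
  fixes u :: "'a::euclidean_space \<Rightarrow> real" and s :: real
  assumes u: "smooth u" and K: "compact K" "\<And>x. x \<notin> K \<Longrightarrow> u x = 0"
    and \<rho>: "\<rho> > 0" "\<And>x b. x \<in> K \<Longrightarrow> b \<in> Basis \<Longrightarrow> \<bar>x \<bullet> b\<bar> < \<rho>" and N: "N > 0"
  defines "s \<equiv> 2 * \<rho> / real N" and "I \<equiv> (Basis \<rightarrow>\<^sub>E {..<N}) :: ('a \<Rightarrow> nat) set"
  shows "(LINT x|lborel. (u x)\<^sup>2) \<le> (\<Sum>k\<in>I. (LINT x|lborel. indicator (grid_cube \<rho> s k) x * u x)\<^sup>2 / s ^ DIM('a))
    + 2 ^ DIM('a) * DIM('a) * s\<^sup>2 / 2 * (LINT x|lborel. (norm (gradient u x))\<^sup>2)"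
proof -
  have s: "s > 0" using \<rho> N by (simp add: s_def)
  have I: "finite I" "I \<subseteq> extensional Basis" unfolding I_def using finite_PiE[of "Basis :: 'a set" "\<lambda>_. {..<N}"] by (auto simp: PiE_def)
  let ?Q = "grid_cube \<rho> s" and ?v = "s ^ DIM('a)"
  note [measurable] = smooth_borel[OF u] gradient_borel[OF u]
  have gK: "gradient u x = 0" if "x \<notin> K" for x
    by (rule gradient_eq_0_open[of "- K"]) (use that K compact_imp_closed in auto)
  have iu: "integrable lborel u" by (rule compact_support_integrable[OF smooth_continuous[OF u] K])
  have iu2: "integrable lborel (\<lambda>x. (u x)\<^sup>2)"
    by (rule compact_support_integrable[OF _ K(1)]) (use K smooth_continuous[OF u] in \<open>auto intro!: continuous_intros\<close>)
  have ig: "integrable lborel (\<lambda>x. (norm (gradient u x))\<^sup>2)"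
    by (rule compact_support_integrable[OF _ K(1)]) (use gK continuous_gradient[OF u] in \<open>auto intro!: continuous_intros\<close>)
  have iQ: "integrable lborel (\<lambda>x. indicator (?Q k) x * f x)" if "integrable lborel f" for f :: "'a \<Rightarrow> real" and k
    using that integrable_mult_indicator[of "?Q k" lborel f] by simp
  let ?a = "\<lambda>k. LINT x|lborel. indicator (?Q k) x * u x" and ?b = "\<lambda>k. LINT x|lborel. indicator (?Q k) x * (u x)\<^sup>2"
  let ?G = "LINT x|lborel. (norm (gradient u x))\<^sup>2"
  have var: "ennreal (2 * ?v * ?b k - 2 * (?a k)\<^sup>2)
      = (\<integral>\<^sup>+x. \<integral>\<^sup>+y. indicator (?Q k) x * indicator (?Q k) y * ennreal ((u y - u x)\<^sup>2) \<partial>lborel \<partial>lborel)"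
    "0 \<le> 2 * ?v * ?b k - 2 * (?a k)\<^sup>2" for k
    using double_integral_variance[OF grid_cube_borel emeasure_grid_cube[OF s] _ iQ[OF iu] iQ[OF iu2], of k] s
    by auto
  define Z where "Z = (centered_cube (2 * s) :: 'a set)"
  have Z_iff: "z \<in> Z \<longleftrightarrow> (\<forall>b\<in>Basis. \<bar>z \<bullet> b\<bar> \<le> s)" for z by (simp add: Z_def centered_cube_def)
  have [measurable]: "Z \<in> sets borel" by (simp add: Z_def)
  have "(\<Sum>k\<in>I. ennreal (2 * ?v * ?b k - 2 * (?a k)\<^sup>2))
      = (\<integral>\<^sup>+x. \<integral>\<^sup>+y. (\<Sum>k\<in>I. indicator (?Q k) x * indicator (?Q k) y * ennreal ((u y - u x)\<^sup>2)) \<partial>lborel \<partial>lborel)"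
    unfolding var by (simp add: nn_integral_sum)
  also have "\<dots> \<le> (\<integral>\<^sup>+x. \<integral>\<^sup>+y. indicator Z (y - x) * ennreal ((u y - u x)\<^sup>2) \<partial>lborel \<partial>lborel)"
  proof (intro nn_integral_mono)
    fix x y :: 'a
    \<comment> \<open>A common cell of \<open>x\<close> and \<open>y\<close> is unique, so the sum
      is at most 1, and the side \<open>s\<close> of that cell bounds every coordinate of
      \<open>y - x\<close>.\<close>
    have "(\<Sum>k\<in>I. indicator (?Q k) x * indicator (?Q k) y :: ennreal) \<le> indicator Z (y - x)"
    proof (cases "\<exists>k\<in>I. x \<in> ?Q k \<and> y \<in> ?Q k")
      case True
      then obtain k where k: "k \<in> I" "x \<in> ?Q k" "y \<in> ?Q k" by blast
      have "\<bar>(y - x) \<bullet> b\<bar> \<le> s" if "b \<in> Basis" for b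
      proof -
        have "s * real (k b) \<le> x \<bullet> b + \<rho>" "x \<bullet> b + \<rho> < s * real (k b) + s"
          "s * real (k b) \<le> y \<bullet> b + \<rho>" "y \<bullet> b + \<rho> < s * real (k b) + s"
          using k(2,3) that by (auto simp: grid_cube_def distrib_left)
        then show ?thesis by (simp add: inner_diff_left abs_le_iff)
      qed
      then have "y - x \<in> Z" by (simp add: Z_iff)
      moreover have "indicator (?Q j) x * indicator (?Q j) y = (if j = k then 1 else 0 :: ennreal)" if "j \<in> I" for j
        using grid_cube_disjoint[OF s k(2), of j] that k I(2) by (auto simp: indicator_def)
      ultimately show ?thesis using k(1) I(1) by simp
    next
      case False
      then show ?thesis by (subst sum.neutral) (auto simp: indicator_def)
    qed
    then show "(\<Sum>k\<in>I. indicator (?Q k) x * indicator (?Q k) y * ennreal ((u y - u x)\<^sup>2))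
        \<le> indicator Z (y - x) * ennreal ((u y - u x)\<^sup>2)"
      unfolding sum_distrib_right[symmetric] by (rule mult_right_mono) simp
  qed
  also have "\<dots> = (\<integral>\<^sup>+x. \<integral>\<^sup>+z. indicator Z z * ennreal ((u (x + z) - u x)\<^sup>2) \<partial>lborel \<partial>lborel)"
  proof (rule nn_integral_cong)
    fix x :: 'a
    show "(\<integral>\<^sup>+y. indicator Z (y - x) * ennreal ((u y - u x)\<^sup>2) \<partial>lborel)
        = (\<integral>\<^sup>+z. indicator Z z * ennreal ((u (x + z) - u x)\<^sup>2) \<partial>lborel)"
      using nn_integral_lborel_translate[of "\<lambda>y. indicator Z (y - x) * ennreal ((u y - u x)\<^sup>2)" x] by simp
  qed
  also have "\<dots> = (\<integral>\<^sup>+z. \<integral>\<^sup>+x. indicator Z z * ennreal ((u (x + z) - u x)\<^sup>2) \<partial>lborel \<partial>lborel)"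
    by (rule lborel_pair.Fubini') measurable
  also have "\<dots> \<le> (\<integral>\<^sup>+z. (ennreal (DIM('a) * s\<^sup>2) * ennreal ?G) * indicator Z z \<partial>lborel)"
  proof (intro nn_integral_mono)
    fix z :: 'a
    have "(\<integral>\<^sup>+x. indicator Z z * ennreal ((u (x + z) - u x)\<^sup>2) \<partial>lborel)
        = indicator Z z * (\<integral>\<^sup>+x. ennreal ((u (x + z) - u x)\<^sup>2) \<partial>lborel)"
      by (intro nn_integral_cmult) measurable
    also have "\<dots> \<le> indicator Z z * (ennreal ((norm z)\<^sup>2) * ennreal ?G)"
      using translation_estimate[OF u, of z] ig by (intro mult_left_mono) (auto simp: nn_integral_eq_integral)
    also have "\<dots> \<le> indicator Z z * (ennreal (DIM('a) * s\<^sup>2) * ennreal ?G)"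
      using norm_square_le_cube[of z s]
      by (cases "z \<in> Z") (auto simp: Z_iff intro!: mult_right_mono ennreal_leI)
    finally show "(\<integral>\<^sup>+x. indicator Z z * ennreal ((u (x + z) - u x)\<^sup>2) \<partial>lborel)
        \<le> (ennreal (DIM('a) * s\<^sup>2) * ennreal ?G) * indicator Z z" by (simp add: mult.commute)
  qed
  \<comment> \<open>The volume \<open>(2 * s) ^ DIM('a)\<close> of \<open>Z\<close>, divided by the
    factor \<open>2 * ?v\<close> of the variance, produces the constant
    \<open>2 ^ DIM('a) / 2\<close>.\<close>
  also have "\<dots> = (ennreal (DIM('a) * s\<^sup>2) * ennreal ?G) * ennreal ((2 * s) ^ DIM('a))"
    using emeasure_centered_cube[of "2 * s", where 'a = 'a] s by (subst nn_integral_cmult_indicator) (auto simp: Z_def)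
  also have "\<dots> = ennreal (DIM('a) * s\<^sup>2 * ?G * (2 * s) ^ DIM('a))"
    using s by (simp add: ennreal_mult)
  finally have "ennreal (\<Sum>k\<in>I. 2 * ?v * ?b k - 2 * (?a k)\<^sup>2) \<le> ennreal (DIM('a) * s\<^sup>2 * ?G * (2 * s) ^ DIM('a))"
    using var(2) by (subst (asm) sum_ennreal) auto
  then have 1: "(\<Sum>k\<in>I. 2 * ?v * ?b k - 2 * (?a k)\<^sup>2) \<le> DIM('a) * s\<^sup>2 * ?G * (2 * s) ^ DIM('a)"
    using s by (subst (asm) ennreal_le_iff) auto
  have "(LINT x|lborel. (u x)\<^sup>2) \<le> (LINT x|lborel. (\<Sum>k\<in>I. indicator (?Q k) x * (u x)\<^sup>2))"
  proof (rule integral_mono[OF iu2])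
    show "integrable lborel (\<lambda>x. \<Sum>k\<in>I. indicator (?Q k) x * (u x)\<^sup>2)" by (intro Bochner_Integration.integrable_sum iQ iu2)
    fix x :: 'a
    show "(u x)\<^sup>2 \<le> (\<Sum>k\<in>I. indicator (?Q k) x * (u x)\<^sup>2)"
    proof (cases "x \<in> K")
      case True
      then obtain k where k: "k \<in> I" "x \<in> ?Q k"
        using grid_cube_cover[OF \<rho>(1) \<rho>(2) N, of x] unfolding I_def s_def by blast
      have "indicator (?Q k) x * (u x)\<^sup>2 \<le> (\<Sum>k\<in>I. indicator (?Q k) x * (u x)\<^sup>2)"
        using k(1) I(1) by (intro member_le_sum) auto
      then show ?thesis using k(2) by simp
    qed (use K in simp)
  qed
  also have "\<dots> = (\<Sum>k\<in>I. ?b k)" by (intro Bochner_Integration.integral_sum iQ iu2)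
  finally have "2 * ?v * (LINT x|lborel. (u x)\<^sup>2) \<le> 2 * ?v * (\<Sum>k\<in>I. ?b k)" using s by (intro mult_left_mono) auto
  also have "\<dots> = (\<Sum>k\<in>I. 2 * ?v * ?b k - 2 * (?a k)\<^sup>2) + 2 * (\<Sum>k\<in>I. (?a k)\<^sup>2)"
    by (simp add: sum_subtractf sum_distrib_left)
  also have "\<dots> \<le> DIM('a) * s\<^sup>2 * ?G * (2 * s) ^ DIM('a) + 2 * (\<Sum>k\<in>I. (?a k)\<^sup>2)" using 1 by simp
  finally have "2 * ?v * (LINT x|lborel. (u x)\<^sup>2)
      \<le> 2 * ?v * ((\<Sum>k\<in>I. (?a k)\<^sup>2 / ?v) + 2 ^ DIM('a) * DIM('a) * s\<^sup>2 / 2 * ?G)"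
    using s by (simp add: sum_divide_distrib[symmetric] distrib_left power_mult_distrib ac_simps)
  then show ?thesis using s by (subst (asm) mult_le_cancel_left_pos) auto
qed

context bounded_open
begin

lemma grid_approximation:
  obtains C where "C > 0" "\<And>N. N > 0 \<Longrightarrow> \<exists>g :: nat \<Rightarrow> 'a \<Rightarrow> real. (\<forall>i<N ^ DIM('a). g i \<in> L2 M \<and> ip (g i) (g i) \<le> 1) \<and>
        (\<forall>u\<in>H10 \<Omega>. ip u u \<le> (\<Sum>i<N ^ DIM('a). (ip u (g i))\<^sup>2) + C / (real N)\<^sup>2 * en u u)"
proof -
  obtain \<rho> where \<rho>0: "\<rho> > 0" "\<And>x. x \<in> \<Omega> \<Longrightarrow> norm x < \<rho>"
    using bounded_\<Omega> by (metis bounded_pos_less)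
  then have \<rho>: "\<bar>x \<bullet> b\<bar> < \<rho>" if "x \<in> \<Omega>" "b \<in> Basis" for x b
    using that Basis_le_norm[of b x] by force
  \<comment> \<open>The constant of \<open>grid_poincare\<close> for
    \<open>s = 2 * \<rho> / real N\<close>, with the power of \<open>N\<close> taken out.\<close>
  define C where "C = 2 ^ DIM('a) * DIM('a) * (2 * \<rho>)\<^sup>2 / 2"
  show thesis
  proof (rule that[of C])
    show "C > 0" using \<rho>0 by (simp add: C_def)
    fix N :: nat assume N: "N > 0"
    define s where "s = 2 * \<rho> / real N"
    have s: "s > 0" using \<rho>0 N by (simp add: s_def)
    define I where "I = ((Basis \<rightarrow>\<^sub>E {..<N}) :: ('a \<Rightarrow> nat) set)"
    have "finite I" "card I = N ^ DIM('a)" unfolding I_def by (auto intro: finite_PiE simp: card_PiE)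
    then obtain h where h: "bij_betw h {..<N ^ DIM('a)} I"
      using ex_bij_betw_nat_finite by (metis atLeast0LessThan)
    \<comment> \<open>Normalised to unit square over the whole cell; a cell may stick out of
      \<open>\<Omega>\<close>, so on \<open>\<Omega>\<close> the square is only at most 1.\<close>
    define f where "f k x = indicator (grid_cube \<rho> s k) x / sqrt (s ^ DIM('a))" for k and x :: 'a
    have f2: "(f k x)\<^sup>2 = indicator (grid_cube \<rho> s k) x / s ^ DIM('a)" for k x
      using s by (simp add: f_def power_divide indicator_def)
    have f_L2: "f k \<in> L2 M" for k
    proof -
      have m: "f k \<in> borel_measurable M" unfolding f_def by (intro borel_measurable_M) measurable
      have m2: "(\<lambda>x. (f k x)\<^sup>2) \<in> borel_measurable M" using m by measurable
      have "integrable M (\<lambda>x. (f k x)\<^sup>2)"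
        using m2 s by (intro finite_measure.integrable_const_bound[OF finite_M, where B = "1 / s ^ DIM('a)"] AE_I2)
          (simp_all add: f2 indicator_def)
      then show ?thesis using m by (simp add: L2_def)
    qed
    have f1: "ip (f k) (f k) \<le> 1" for k
    proof -
      have "ip (f k) (f k) = (LINT x|lebesgue. indicator (grid_cube \<rho> s k \<inter> \<Omega>) x / s ^ DIM('a))"
        unfolding ip_self using \<Omega>_sets
        by (subst integral_restrict_space) (auto simp: f2 indicator_inter_arith intro!: Bochner_Integration.integral_cong)
      also have "\<dots> = measure lebesgue (grid_cube \<rho> s k \<inter> \<Omega>) / s ^ DIM('a)" by simp
      also have "\<dots> \<le> measure lebesgue (grid_cube \<rho> s k :: 'a set) / s ^ DIM('a)"
        using s emeasure_grid_cube[OF s, of \<rho> k] \<Omega>_sets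
        by (intro divide_right_mono measure_mono_fmeasurable) (auto intro!: fmeasurableI)
      also have "\<dots> = 1" using s emeasure_grid_cube[OF s, of \<rho> k] by (simp add: measure_def)
      finally show ?thesis .
    qed
    have sC: "2 ^ DIM('a) * DIM('a) * s\<^sup>2 / 2 = C / (real N)\<^sup>2" using N by (simp add: s_def C_def power_divide)
    have test: "ip u u \<le> (\<Sum>k\<in>I. (ip u (f k))\<^sup>2) + C / (real N)\<^sup>2 * (LINT x|M. (norm (gradient u x))\<^sup>2)"
      if u: "test_function \<Omega> u" for u
    proof -
      obtain K where K: "smooth u" "compact K" "K \<subseteq> \<Omega>" "\<And>x. x \<notin> K \<Longrightarrow> u x = 0"
        "\<And>x. x \<notin> K \<Longrightarrow> gradient u x = 0" using test_functionE[OF u] by metis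
      note [measurable] = smooth_borel[OF K(1)] gradient_borel[OF K(1)]
      have z: "u x = 0" "gradient u x = 0" if "x \<notin> \<Omega>" for x using K that by auto
      have 1: "ip u u = (LINT x|lborel. (u x)\<^sup>2)"
        unfolding ip_self using z by (subst lebesgue_on_integral_eq[OF _ \<Omega>_sets]) auto
      have 2: "(LINT x|M. (norm (gradient u x))\<^sup>2) = (LINT x|lborel. (norm (gradient u x))\<^sup>2)"
        using z by (subst lebesgue_on_integral_eq[OF _ \<Omega>_sets]) auto
      have 3: "(ip u (f k))\<^sup>2 = (LINT x|lborel. indicator (grid_cube \<rho> s k) x * u x)\<^sup>2 / s ^ DIM('a)" for k
      proof -
        have "ip u (f k) = (LINT x|lborel. u x * f k x)"
          unfolding ip_def f_def using z by (intro lebesgue_on_integral_eq \<Omega>_sets) auto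
        also have "\<dots> = (LINT x|lborel. indicator (grid_cube \<rho> s k) x * u x) / sqrt (s ^ DIM('a))"
          by (simp add: f_def mult.commute)
        finally show ?thesis using s by (simp add: power_divide)
      qed
      show ?thesis
        using grid_poincare[OF K(1,2,4) \<rho>0(1) \<rho> N] K(3)
        unfolding 1 2 3 sC[symmetric] I_def s_def by blast
    qed
    \<comment> \<open>Both sides are continuous along the approximating test functions, so the
      estimate extends to their closure.\<close>
    have all: "ip u u \<le> (\<Sum>k\<in>I. (ip u (f k))\<^sup>2) + C / (real N)\<^sup>2 * en u u" if u: "u \<in> H10 \<Omega>" for u
    proof -
      let ?g = "weak_gradient \<Omega> u"
      obtain \<phi> where \<phi>: "\<And>k::nat. test_function \<Omega> (\<phi> k)" "(\<lambda>k. dist2 M (\<phi> k) u) \<longlonglongrightarrow> 0"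
          "(\<lambda>k. dist2 M (gradient (\<phi> k)) ?g) \<longlonglongrightarrow> 0" and L: "u \<in> L2 M" "?g \<in> L2 M"
        using H10_pair[OF u] unfolding h10_pair_def by blast
      have "(\<lambda>j. ip (\<phi> j) (\<phi> j)) \<longlonglongrightarrow> ip u u"
        unfolding ip_self using L2_tendsto_norm[OF test_L2[OF \<phi>(1)] L(1) \<phi>(2)] .
      moreover have "(\<lambda>j. (\<Sum>k\<in>I. (ip (\<phi> j) (f k))\<^sup>2) + C / (real N)\<^sup>2 * (LINT x|M. (norm (gradient (\<phi> j) x))\<^sup>2))
          \<longlonglongrightarrow> (\<Sum>k\<in>I. (ip u (f k))\<^sup>2) + C / (real N)\<^sup>2 * (LINT x|M. (norm (?g x))\<^sup>2)"
        using L2_tendsto_norm[OF test_gradient_L2[OF \<phi>(1)] L(2) \<phi>(3)]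
          L2_tendsto_inner[OF test_L2[OF \<phi>(1)] L(1) f_L2 \<phi>(2)]
        by (intro tendsto_intros) (auto simp: ip_def)
      ultimately have "ip u u \<le> (\<Sum>k\<in>I. (ip u (f k))\<^sup>2) + C / (real N)\<^sup>2 * (LINT x|M. (norm (?g x))\<^sup>2)"
        using test[OF \<phi>(1)] by (intro LIMSEQ_le) auto
      then show ?thesis by (simp add: en_def power2_norm_eq_inner)
    qed
    have "(\<Sum>i<N ^ DIM('a). (ip u (f (h i)))\<^sup>2) = (\<Sum>k\<in>I. (ip u (f k))\<^sup>2)" for u
      by (rule sum.reindex_bij_betw[OF h])
    then show "\<exists>g :: nat \<Rightarrow> 'a \<Rightarrow> real. (\<forall>i<N ^ DIM('a). g i \<in> L2 M \<and> ip (g i) (g i) \<le> 1) \<and>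
        (\<forall>u\<in>H10 \<Omega>. ip u u \<le> (\<Sum>i<N ^ DIM('a). (ip u (g i))\<^sup>2) + C / (real N)\<^sup>2 * en u u)"
      using all f_L2 f1 by (intro exI[of _ "\<lambda>i. f (h i)"]) simp
  qed
qed

end

section \<open>Bessel's inequality for plane waves and Gaussian sums\<close>

lemma lborel_integral_prod:
  fixes h :: "'a::euclidean_space \<Rightarrow> real \<Rightarrow> complex"
  assumes "\<And>b. b \<in> Basis \<Longrightarrow> integrable lborel (h b)"
  shows "(LINT x|(lborel :: 'a measure). (\<Prod>b\<in>Basis. h b (x \<bullet> b))) = (\<Prod>b\<in>Basis. LINT y|lborel. h b y)"
proof -
  interpret product_sigma_finite "\<lambda>b :: 'a. lborel :: real measure"
    by standard
  have [measurable]: "h b \<in> borel_measurable borel" if "b \<in> Basis" for b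
    using borel_measurable_integrable[OF assms[OF that]] by simp
  have "(LINT x|(lborel :: 'a measure). (\<Prod>b\<in>Basis. h b (x \<bullet> b)))
      = (LINT f|(\<Pi>\<^sub>M b\<in>(Basis :: 'a set). lborel). (\<Prod>b\<in>Basis. h b ((\<Sum>c\<in>Basis. f c *\<^sub>R c) \<bullet> b)))"
  proof (subst lborel_eq, rule integral_distr)
    have "(\<lambda>f. f b) \<in> borel_measurable (\<Pi>\<^sub>M b\<in>(Basis :: 'a set). lborel :: real measure)" if "b \<in> Basis" for b :: 'a
      using measurable_component_singleton[OF that, of "\<lambda>_. lborel :: real measure"] by simp
    then show "(\<lambda>f. \<Sum>b\<in>Basis. f b *\<^sub>R b) \<in> (\<Pi>\<^sub>M b\<in>(Basis :: 'a set). lborel) \<rightarrow>\<^sub>M borel"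
      by (intro borel_measurable_sum borel_measurable_scaleR) auto
    show "(\<lambda>x :: 'a. \<Prod>b\<in>Basis. h b (x \<bullet> b)) \<in> borel_measurable borel"
      by (intro borel_measurable_prod) measurable
  qed
  also have "\<dots> = (LINT f|(\<Pi>\<^sub>M b\<in>(Basis :: 'a set). lborel). (\<Prod>b\<in>Basis. h b (f b)))"
    by (intro Bochner_Integration.integral_cong prod.cong refl arg_cong[where f = "h _"]) simp
  also have "\<dots> = (\<Prod>b\<in>Basis. LINT y|lborel. h b y)"
    using assms by (intro product_integral_prod) auto
  finally show ?thesis .
qed

lemma integrable_indicator_cis: "integrable lborel (\<lambda>y. indicator {a..b} y *\<^sub>R cis (w * y))"
  by (rule borel_integrable_compact) (auto intro!: continuous_intros)

lemma integral_cis_period: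
  assumes "L > 0"
  shows "(LINT y|lborel. indicator {- L / 2..L / 2} y *\<^sub>R cis (2 * pi * real_of_int m / L * y)) = (if m = 0 then of_real L else 0)"
proof (cases "m = 0")
  case True
  have "(LINT y|lborel. indicator {- L / 2..L / 2} y *\<^sub>R (1 :: complex)) = of_real L"
    using assms by (simp add: scaleR_conv_of_real)
  then show ?thesis using True by simp
next
  case False
  define w where "w = 2 * pi * real_of_int m / L"
  have w: "w \<noteq> 0" using False assms by (simp add: w_def)
  have "(LINT y|lborel. indicator {- L / 2..L / 2} y *\<^sub>R cis (w * y))
      = cis (w * (L / 2)) / (\<i> * of_real w) - cis (w * (- L / 2)) / (\<i> * of_real w)"
  proof (rule integral_FTC_atLeastAtMost)
    fix x :: real
    show "((\<lambda>x. cis (w * x) / (\<i> * of_real w)) has_vector_derivative cis (w * x)) (at x within {- L / 2..L / 2})"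
      unfolding cis_conv_exp using w
      by (auto intro!: derivative_eq_intros has_vector_derivative_real_field simp: field_simps)
  qed (use assms in \<open>auto intro!: continuous_intros\<close>)
  also have "\<dots> = 0"
  proof -
    have e: "w * (L / 2) = pi * of_int m" "w * (- L / 2) = - (pi * of_int m)"
      using assms by (simp_all add: w_def)
    have "cis (pi * of_int m) = cis (- (pi * of_int m))"
      by (simp add: complex_eq_iff sin_times_pi_eq_0 mult.commute[of pi])
    then show ?thesis unfolding e by simp
  qed
  finally show ?thesis using False by (simp add: w_def)
qed

definition wave :: "real \<Rightarrow> ('a::euclidean_space \<Rightarrow> int) \<Rightarrow> 'a" where
  "wave L k = (\<Sum>b\<in>Basis. (2 * pi * real_of_int (k b) / L) *\<^sub>R b)"

lemma wave_inner: "b \<in> Basis \<Longrightarrow> wave L k \<bullet> b = 2 * pi * real_of_int (k b) / L"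
  by (simp add: wave_def)

text \<open>The integrand factors over the coordinates, and a coordinate with
  \<open>k b \<noteq> l b\<close> integrates a wave over whole periods.\<close>

lemma wave_orthogonal:
  fixes k l :: "'a::euclidean_space \<Rightarrow> int"
  assumes L: "L > 0" and kl: "k \<in> extensional Basis" "l \<in> extensional Basis"
  shows "(LINT x|lborel. indicator (centered_cube L) x *\<^sub>R cis (x \<bullet> wave L k - x \<bullet> wave L l))
    = (if k = l then of_real (L ^ DIM('a)) else 0)"
proof -
  let ?h = "\<lambda>b y. indicator {- L / 2..L / 2} y *\<^sub>R cis (2 * pi * real_of_int (k b - l b) / L * y)"
  have "indicator (centered_cube L) x *\<^sub>R cis (x \<bullet> wave L k - x \<bullet> wave L l) = (\<Prod>b\<in>Basis. ?h b (x \<bullet> b))" for x :: 'a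
  proof (cases "x \<in> centered_cube L")
    case True
    have "x \<bullet> wave L k - x \<bullet> wave L l = (\<Sum>b\<in>Basis. 2 * pi * real_of_int (k b - l b) / L * (x \<bullet> b))"
      unfolding inner_diff_right[symmetric]
      by (subst euclidean_inner) (auto simp: inner_diff_left wave_inner algebra_simps diff_divide_distrib intro!: sum.cong)
    then have "cis (x \<bullet> wave L k - x \<bullet> wave L l) = (\<Prod>b\<in>Basis. cis (2 * pi * real_of_int (k b - l b) / L * (x \<bullet> b)))"
      by (simp add: cis_conv_exp exp_sum sum_distrib_left)
    moreover have "- L / 2 \<le> x \<bullet> b" "x \<bullet> b \<le> L / 2" if "b \<in> Basis" for b
      using True that abs_le_iff[of "x \<bullet> b" "L / 2"] by (auto simp: centered_cube_def)
    ultimately show ?thesis using True by (auto intro!: prod.cong)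
  next
    case False
    then obtain b where "b \<in> Basis" "\<not> \<bar>x \<bullet> b\<bar> \<le> L / 2" unfolding centered_cube_def by blast
    moreover from this have "\<not> (- L / 2 \<le> x \<bullet> b \<and> x \<bullet> b \<le> L / 2)" by linarith
    ultimately have "b \<in> Basis" "\<not> (- L / 2 \<le> x \<bullet> b \<and> x \<bullet> b \<le> L / 2)" by blast+
    then show ?thesis using False by (subst prod_zero) (auto intro!: bexI[of _ b])
  qed
  then have "(LINT x|lborel. indicator (centered_cube L) x *\<^sub>R cis (x \<bullet> wave L k - x \<bullet> wave L l))
      = (LINT x|lborel. (\<Prod>b\<in>(Basis :: 'a set). ?h b (x \<bullet> b)))" by (simp only:)
  also have "\<dots> = (\<Prod>b\<in>(Basis :: 'a set). LINT y|lborel. ?h b y)"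
    by (rule lborel_integral_prod) (rule integrable_indicator_cis)
  also have "\<dots> = (\<Prod>b\<in>(Basis :: 'a set). if k b = l b then of_real L else 0)"
    by (intro prod.cong refl) (subst integral_cis_period[OF L], simp)
  also have "\<dots> = (if k = l then of_real (L ^ DIM('a)) else 0)"
  proof (cases "k = l")
    case False
    then obtain b where "b \<in> Basis" "k b \<noteq> l b" using kl extensionalityI[of k Basis l] by blast
    then show ?thesis using False by (subst prod_zero) (auto intro!: bexI[of _ b])
  qed simp
  finally show ?thesis .
qed

text \<open>Let \<open>h\<close> be the trigonometric polynomial built from the coefficients
  \<open>c k\<close>. Pairing \<open>f\<close> with \<open>h\<close> gives \<open>A\<close>,
  orthogonality of the waves gives \<open>L ^ DIM('a) * A\<close> for the square of
  \<open>h\<close>, and Cauchy--Schwarz then bounds \<open>A\<close>. Cosine and sine are the real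
  and imaginary parts of one coefficient.\<close>

lemma fourier_bessel:
  fixes f :: "'a::euclidean_space \<Rightarrow> real"
  assumes L: "L > 0" and I: "finite I" "I \<subseteq> extensional Basis"
    and f: "f \<in> L2 lebesgue" "\<And>x. x \<notin> centered_cube L \<Longrightarrow> f x = 0"
  shows "(\<Sum>k\<in>I. (LINT x|lebesgue. f x * cos (x \<bullet> wave L k))\<^sup>2 + (LINT x|lebesgue. f x * sin (x \<bullet> wave L k))\<^sup>2)
    \<le> L ^ DIM('a) * (LINT x|lebesgue. (f x)\<^sup>2)"
proof -
  let ?B = "centered_cube L :: 'a set"
  define e where "e k x = indicator ?B x *\<^sub>R cis (x \<bullet> wave L k)" for k and x :: 'a
  have e_m [measurable]: "e k \<in> borel_measurable borel" for k unfolding e_def cis_conv_exp by measurable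
  have [measurable]: "(\<lambda>x. cnj (e k x)) \<in> borel_measurable borel" for k
  proof -
    have "(\<lambda>x. cnj (e k x)) = (\<lambda>x. indicator ?B x *\<^sub>R exp (\<i> * of_real (- (x \<bullet> wave L k))))"
      by (rule ext) (simp only: e_def complex_cnj_scaleR cis_cnj, simp only: cis_conv_exp)
    then show ?thesis by simp
  qed
  have bounded_L2: "g \<in> L2 lebesgue" if "g \<in> borel_measurable borel" "\<And>x. norm (g x) \<le> c * indicator ?B x"
    for g :: "'a \<Rightarrow> complex" and c
  proof -
    have [measurable]: "g \<in> borel_measurable borel" by fact
    have "integrable lborel (\<lambda>x. (norm (g x))\<^sup>2)"
    proof (rule Bochner_Integration.integrable_bound)
      show "integrable lborel (\<lambda>x. c\<^sup>2 * indicator ?B x)"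
        using emeasure_centered_cube_finite by (intro integrable_mult_right integrable_real_indicator) auto
      have "(norm (g x))\<^sup>2 \<le> c\<^sup>2 * indicator ?B x" for x
        using power_mono[OF that(2)[of x] norm_ge_zero, of 2] by (auto simp: indicator_def split: if_splits)
      then show "AE x in lborel. norm ((norm (g x))\<^sup>2) \<le> norm (c\<^sup>2 * indicator ?B x)" by (auto simp: abs_mult)
    qed measurable
    then show ?thesis unfolding L2_def by (auto intro: measurable_completion simp: integrable_completion)
  qed
  have e_L2: "e k \<in> L2 lebesgue" for k
    by (rule bounded_L2[where c = 1]) (auto simp: e_def indicator_def)
  have fe: "integrable lebesgue (\<lambda>x. of_real (f x) * e k x)" for k
    using L2_integrable_scaleR[OF f(1) e_L2[of k]] by (simp add: scaleR_conv_of_real)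
  define c where "c k = (LINT x|lebesgue. of_real (f x) * e k x)" for k
  have Re_c: "Re (c k) = (LINT x|lebesgue. f x * cos (x \<bullet> wave L k))" for k
    unfolding c_def integral_Re[OF fe, symmetric] using f(2)
    by (intro Bochner_Integration.integral_cong) (auto simp: e_def indicator_def)
  have Im_c: "Im (c k) = (LINT x|lebesgue. f x * sin (x \<bullet> wave L k))" for k
    unfolding c_def integral_Im[OF fe, symmetric] using f(2)
    by (intro Bochner_Integration.integral_cong) (auto simp: e_def indicator_def)
  define A where "A = (\<Sum>k\<in>I. (norm (c k))\<^sup>2)"
  have A: "A = (\<Sum>k\<in>I. (LINT x|lebesgue. f x * cos (x \<bullet> wave L k))\<^sup>2 + (LINT x|lebesgue. f x * sin (x \<bullet> wave L k))\<^sup>2)"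
    unfolding A_def cmod_power2 Re_c Im_c ..
  define h where "h x = (\<Sum>k\<in>I. c k * cnj (e k x))" for x
  have h_m [measurable]: "h \<in> borel_measurable borel" unfolding h_def by measurable
  have h_L2: "h \<in> L2 lebesgue"
  proof (rule bounded_L2[where c = "\<Sum>k\<in>I. norm (c k)"])
    fix x
    have "norm (h x) \<le> (\<Sum>k\<in>I. norm (c k) * norm (e k x))"
      unfolding h_def by (rule order_trans[OF norm_sum]) (simp add: norm_mult)
    also have "\<dots> = (\<Sum>k\<in>I. norm (c k)) * indicator ?B x"
      unfolding sum_distrib_right by (intro sum.cong) (auto simp: e_def indicator_def)
    finally show "norm (h x) \<le> (\<Sum>k\<in>I. norm (c k)) * indicator ?B x" .
  qed measurable
  have f_L2: "(\<lambda>x. complex_of_real (f x)) \<in> L2 lebesgue"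
    using f(1) by (auto simp: L2_def)
  have fh: "(LINT x|lebesgue. complex_of_real (f x) \<bullet> h x) = A"
  proof -
    \<comment> \<open>The inner product of complex values is the real part of the conjugate of one
      times the other, so no imaginary part survives.\<close>
    have "complex_of_real (f x) \<bullet> h x = (\<Sum>k\<in>I. Re (cnj (c k) * (of_real (f x) * e k x)))" for x
      unfolding h_def inner_sum_right by (intro sum.cong) (auto simp: inner_complex_def algebra_simps)
    then have "(LINT x|lebesgue. complex_of_real (f x) \<bullet> h x) = (LINT x|lebesgue. (\<Sum>k\<in>I. Re (cnj (c k) * (of_real (f x) * e k x))))"
      by (simp only:)
    also have "\<dots> = (\<Sum>k\<in>I. LINT x|lebesgue. Re (cnj (c k) * (of_real (f x) * e k x)))"
      by (intro Bochner_Integration.integral_sum integrable_Re integrable_mult_right fe)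
    also have "\<dots> = (\<Sum>k\<in>I. Re (cnj (c k) * c k))"
      using fe by (intro sum.cong refl) (subst integral_Re, auto simp: c_def)
    also have "\<dots> = A" unfolding A_def cmod_power2 by (intro sum.cong) (auto simp: power2_eq_square)
    finally show ?thesis .
  qed
  have hh: "(LINT x|lebesgue. (norm (h x))\<^sup>2) = L ^ DIM('a) * A"
  proof -
    have ee: "e l x * cnj (e k x) = indicator ?B x *\<^sub>R cis (x \<bullet> wave L l - x \<bullet> wave L k)" for k l x
      by (auto simp: e_def indicator_def cis_cnj cis_mult)
    have iee: "integrable lborel (\<lambda>x. e l x * cnj (e k x))" for k l
    proof (rule Bochner_Integration.integrable_bound)
      show "integrable lborel (indicator ?B :: 'a \<Rightarrow> real)"
        using emeasure_centered_cube_finite by (intro integrable_real_indicator) auto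
      show "(\<lambda>x. e l x * cnj (e k x)) \<in> borel_measurable lborel" by measurable
    qed (auto simp: e_def indicator_def norm_mult)
    have "complex_of_real (LINT x|lebesgue. (norm (h x))\<^sup>2) = (LINT x|lborel. complex_of_real ((norm (h x))\<^sup>2))"
    proof -
      have "(\<lambda>x. (norm (h x))\<^sup>2) \<in> borel_measurable lborel" by measurable
      then show ?thesis by (simp only: integral_completion integral_complex_of_real)
    qed
    also have "\<dots> = (LINT x|lborel. (\<Sum>k\<in>I. \<Sum>l\<in>I. c k * cnj (c l) * (e l x * cnj (e k x))))"
      by (intro Bochner_Integration.integral_cong refl)
        (simp only: complex_norm_square h_def cnj_sum complex_cnj_mult complex_cnj_cnj sum_product mult_ac)
    also have "\<dots> = (\<Sum>k\<in>I. \<Sum>l\<in>I. c k * cnj (c l) * (LINT x|lborel. e l x * cnj (e k x)))"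
      using iee by simp
    also have "\<dots> = (\<Sum>k\<in>I. \<Sum>l\<in>I. if l = k then c k * cnj (c l) * of_real (L ^ DIM('a)) else 0)"
      unfolding ee using I(2) by (intro sum.cong refl) (subst wave_orthogonal[OF L], auto)
    also have "\<dots> = (\<Sum>k\<in>I. of_real (L ^ DIM('a)) * complex_of_real ((norm (c k))\<^sup>2))"
      using I(1) by (intro sum.cong refl) (simp add: complex_norm_square mult.commute del: of_real_power)
    also have "\<dots> = complex_of_real (L ^ DIM('a) * A)" by (simp add: A_def sum_distrib_left)
    finally show ?thesis by (simp only: of_real_eq_iff)
  qed
  have A0: "0 \<le> A" unfolding A_def by (intro sum_nonneg) auto
  have "A\<^sup>2 \<le> (LINT x|lebesgue. (f x)\<^sup>2) * (L ^ DIM('a) * A)"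
    using L2_cauchy_schwarz[OF f_L2 h_L2] unfolding fh hh by simp
  then have "A * A \<le> (L ^ DIM('a) * (LINT x|lebesgue. (f x)\<^sup>2)) * A" by (simp add: power2_eq_square mult_ac)
  then show ?thesis unfolding A[symmetric]
    using A0 L by (cases "A = 0") (auto simp: mult_le_cancel_right)
qed

section \<open>Gaussian sums over the lattice\<close>

lemma gaussian_wave_sum:
  fixes L :: real
  shows "(\<Sum>k\<in>(Basis :: 'a::euclidean_space set) \<rightarrow>\<^sub>E {- int N..int N}. exp (- (norm (wave L k))\<^sup>2 * t))
    = (\<Sum>m = - int N..int N. exp (- (2 * pi * real_of_int m / L)\<^sup>2 * t)) ^ DIM('a)"
proof -
  have "exp (- (norm (wave L k))\<^sup>2 * t) = (\<Prod>b\<in>Basis. exp (- (2 * pi * real_of_int (k b) / L)\<^sup>2 * t))" for k :: "'a \<Rightarrow> int"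
  proof -
    have "(norm (wave L k))\<^sup>2 = (\<Sum>b\<in>Basis. (2 * pi * real_of_int (k b) / L)\<^sup>2)"
      unfolding power2_norm_eq_inner euclidean_inner[of "wave L k" "wave L k"]
      by (intro sum.cong) (auto simp: wave_inner power2_eq_square)
    then show ?thesis by (simp add: exp_sum[symmetric] sum_negf sum_distrib_right)
  qed
  then show ?thesis
    using prod_sum_PiE[of "Basis :: 'a set" "\<lambda>_. {- int N..int N}" "\<lambda>b m. exp (- (2 * pi * real_of_int m / L)\<^sup>2 * t)"]
    by simp
qed

text \<open>A left-endpoint Riemann sum of a decreasing function. The index runs up to
  \<open>N\<close> inclusive so that the endpoint \<open>real N * \<delta>\<close> lies in a cell as
  well.\<close>

lemma gaussian_sum_lower:
  assumes \<delta>: "\<delta> > 0"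
  shows "(LINT x|lborel. indicator {.. real N * \<delta>} x *\<^sub>R (indicator {0..} x *\<^sub>R exp (- x\<^sup>2)))
    \<le> \<delta> * (\<Sum>m\<le>N. exp (- (real m * \<delta>)\<^sup>2))"
proof -
  let ?J = "\<lambda>m. {real m * \<delta>..<real (Suc m) * \<delta>}"
  have J: "integrable lborel (\<lambda>x. indicator (?J m) x * c)" "(LINT x|lborel. indicator (?J m) x * c) = \<delta> * c" for m and c :: real
    using \<delta> by (auto simp: algebra_simps)
  have "(LINT x|lborel. indicator {.. real N * \<delta>} x *\<^sub>R (indicator {0..} x *\<^sub>R exp (- x\<^sup>2)))
    \<le> (LINT x|lborel. (\<Sum>m\<le>N. indicator (?J m) x * exp (- (real m * \<delta>)\<^sup>2)))"
  proof (rule integral_mono)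
    show "integrable lborel (\<lambda>x. indicator {.. real N * \<delta>} x *\<^sub>R (indicator {0..} x *\<^sub>R exp (- x\<^sup>2)))"
      by (rule integrable_mult_indicator, simp, rule integrable.intros[OF gaussian_moment_0])
    show "integrable lborel (\<lambda>x. (\<Sum>m\<le>N. indicator (?J m) x * exp (- (real m * \<delta>)\<^sup>2)))"
      using J by (intro Bochner_Integration.integrable_sum) auto
    fix x :: real
    show "indicator {.. real N * \<delta>} x *\<^sub>R (indicator {0..} x *\<^sub>R exp (- x\<^sup>2))
        \<le> (\<Sum>m\<le>N. indicator (?J m) x * exp (- (real m * \<delta>)\<^sup>2))"
    proof (cases "0 \<le> x \<and> x \<le> real N * \<delta>")
      case True
      define m where "m = nat \<lfloor>x / \<delta>\<rfloor>"
      have m: "real m = of_int \<lfloor>x / \<delta>\<rfloor>" using True \<delta> by (simp add: m_def)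
      have "real m \<le> x / \<delta>" "x / \<delta> < real (Suc m)" using m by (auto, linarith)
      then have mx: "real m * \<delta> \<le> x" "x < real (Suc m) * \<delta>" using \<delta> by (simp_all only: pos_le_divide_eq pos_divide_less_eq)
      have "real m * \<delta> \<le> real N * \<delta>" using mx True by linarith
      then have mN: "m \<in> {..N}" using \<delta> by simp
      have "exp (- x\<^sup>2) \<le> exp (- (real m * \<delta>)\<^sup>2)" using mx \<delta> by (auto intro!: power_mono)
      also have "\<dots> = indicator (?J m) x * exp (- (real m * \<delta>)\<^sup>2)" using mx by simp
      also have "\<dots> \<le> (\<Sum>m\<le>N. indicator (?J m) x * exp (- (real m * \<delta>)\<^sup>2))"
        using mN by (intro member_le_sum) auto
      finally show ?thesis using True by simp
    qed (auto simp: indicator_def intro!: sum_nonneg)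
  qed
  also have "\<dots> = (\<Sum>m\<le>N. \<delta> * exp (- (real m * \<delta>)\<^sup>2))"
    by (subst Bochner_Integration.integral_sum, rule J(1)) (simp only: J(2))
  finally show ?thesis by (simp add: sum_distrib_left)
qed

text \<open>A lower bound with the right limit suffices. With side \<open>Suc n\<close> and cutoff
  \<open>(Suc n)\<^sup>2\<close> the mesh tends to 0 while cutoff times mesh tends to infinity, so
  the Riemann sums capture the whole Gaussian integral.\<close>

lemma gaussian_theta_limit:
  assumes t: "t > 0"
  shows "\<exists>B. B \<longlonglongrightarrow> 1 / sqrt (4 * pi * t) \<and> (\<forall>n. B n \<le>
    (\<Sum>m = - int ((Suc n)\<^sup>2)..int ((Suc n)\<^sup>2). exp (- (2 * pi * real_of_int m / real (Suc n))\<^sup>2 * t)) / real (Suc n))"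
proof -
  let ?F = "\<lambda>y. LINT x|lborel. indicator {..y} x *\<^sub>R (indicator {0..} x *\<^sub>R exp (- x\<^sup>2 :: real))"
  define c where "c = 2 * pi * sqrt t"
  have c: "c > 0" using t by (simp add: c_def)
  \<comment> \<open>\<open>c / real (Suc n)\<close> is the mesh; it is subtracted once because two
    half sums count the index 0 twice.\<close>
  define B where "B n = (2 * ?F (real ((Suc n)\<^sup>2) * (c / real (Suc n))) - c / real (Suc n)) / c" for n
  have "(?F \<longlongrightarrow> sqrt pi / 2) at_top"
    using tendsto_integral_at_top[OF _ integrable.intros[OF gaussian_moment_0]]
    unfolding has_bochner_integral_integral_eq[OF gaussian_moment_0] by simp
  moreover have "filterlim (\<lambda>n. real ((Suc n)\<^sup>2) * (c / real (Suc n))) at_top sequentially"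
    using c by real_asymp
  ultimately have "(\<lambda>n. ?F (real ((Suc n)\<^sup>2) * (c / real (Suc n)))) \<longlonglongrightarrow> sqrt pi / 2"
    by (rule filterlim_compose)
  moreover have "(\<lambda>n. c / real (Suc n)) \<longlonglongrightarrow> 0" by real_asymp
  ultimately have "B \<longlonglongrightarrow> (2 * (sqrt pi / 2) - 0) / c"
    unfolding B_def using c by (intro tendsto_intros) auto
  moreover have "(2 * (sqrt pi / 2) - 0) / c = 1 / sqrt (4 * pi * t)"
    using t by (simp add: c_def real_sqrt_mult field_simps)
  moreover have "B n \<le> (\<Sum>m = - int ((Suc n)\<^sup>2)..int ((Suc n)\<^sup>2). exp (- (2 * pi * real_of_int m / real (Suc n))\<^sup>2 * t)) / real (Suc n)" for n
  proof -
    define \<delta> where "\<delta> = c / real (Suc n)"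
    define N where "N = (Suc n)\<^sup>2"
    have \<delta>: "\<delta> > 0" using c by (simp add: \<delta>_def)
    have e: "exp (- (2 * pi * real_of_int m / real (Suc n))\<^sup>2 * t) = exp (- (real_of_int m * \<delta>)\<^sup>2)" for m
      using t by (simp add: \<delta>_def c_def power_mult_distrib power_divide mult_ac)
    have "{- int N..int N} = {- int N..-1} \<union> {0..int N}" by auto
    then have "(\<Sum>m = - int N..int N. exp (- (real_of_int m * \<delta>)\<^sup>2))
        = (\<Sum>m = - int N..-1. exp (- (real_of_int m * \<delta>)\<^sup>2)) + (\<Sum>m = 0..int N. exp (- (real_of_int m * \<delta>)\<^sup>2))"
      by (simp add: sum.union_disjoint)
    also have "(\<Sum>m = - int N..-1. exp (- (real_of_int m * \<delta>)\<^sup>2)) = (\<Sum>m = 1..N. exp (- (real m * \<delta>)\<^sup>2))"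
      by (rule sum.reindex_bij_witness[of _ "\<lambda>m. - int m" "\<lambda>m. nat (- m)"]) auto
    also have "(\<Sum>m = 0..int N. exp (- (real_of_int m * \<delta>)\<^sup>2)) = (\<Sum>m\<le>N. exp (- (real m * \<delta>)\<^sup>2))"
      by (rule sum.reindex_bij_witness[of _ int nat]) auto
    also have "(\<Sum>m = 1..N. exp (- (real m * \<delta>)\<^sup>2)) = (\<Sum>m\<le>N. exp (- (real m * \<delta>)\<^sup>2)) - 1"
    proof -
      have "{..N} = insert 0 {1..N}" by auto
      then show ?thesis by simp
    qed
    finally have s: "(\<Sum>m = - int N..int N. exp (- (real_of_int m * \<delta>)\<^sup>2)) = 2 * (\<Sum>m\<le>N. exp (- (real m * \<delta>)\<^sup>2)) - 1" by simp
    have "2 * ?F (real N * \<delta>) - \<delta> \<le> \<delta> * (\<Sum>m = - int N..int N. exp (- (real_of_int m * \<delta>)\<^sup>2))"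
      using gaussian_sum_lower[OF \<delta>, of N] unfolding s by (simp add: algebra_simps)
    then have "(2 * ?F (real N * \<delta>) - \<delta>) / c \<le> \<delta> * (\<Sum>m = - int N..int N. exp (- (real_of_int m * \<delta>)\<^sup>2)) / c"
      using c by (intro divide_right_mono) auto
    also have "\<dots> = (\<Sum>m = - int N..int N. exp (- (real_of_int m * \<delta>)\<^sup>2)) / real (Suc n)"
      using c by (simp add: \<delta>_def)
    finally show ?thesis unfolding e B_def N_def[symmetric] \<delta>_def[symmetric] .
  qed
  ultimately show ?thesis by metis
qed

section \<open>Mollified cutoff functions\<close>

text \<open>Convolution over a fixed compact box, so that differentiation under the integral sign
  applies with \<open>f\<close> merely continuous.\<close>

definition conv_box :: "'a::euclidean_space \<Rightarrow> 'a \<Rightarrow> ('a \<Rightarrow> real) \<Rightarrow> ('a \<Rightarrow> real) \<Rightarrow> 'a \<Rightarrow> real" where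
  "conv_box a b f \<rho> x = integral (cbox a b) (\<lambda>y. f y * \<rho> (x - y))"

lemma conv_box_has_derivative:
  fixes f \<rho> :: "'a::euclidean_space \<Rightarrow> real"
  assumes f: "continuous_on UNIV f" and \<rho>: "smooth \<rho>"
  shows "(conv_box a b f \<rho> has_derivative (\<lambda>v. integral (cbox a b) (\<lambda>y. f y * (gradient \<rho> (x - y) \<bullet> v)))) (at x)"
proof -
  let ?D = "\<lambda>x y. f y *\<^sub>R blinfun_inner_right (gradient \<rho> (x - y))"
  have fc: "continuous_on S (\<lambda>y. f (g y))" if "continuous_on S g" for S and g :: "'b::topological_space \<Rightarrow> 'a"
    using continuous_on_compose2[OF f that] by auto
  have \<rho>c: "continuous_on S (\<lambda>y. \<rho> (g y))" if "continuous_on S g" for S and g :: "'b::topological_space \<Rightarrow> 'a"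
    using continuous_on_compose2[OF smooth_continuous[OF \<rho>] that] by auto
  have gc: "continuous_on S (\<lambda>y. gradient \<rho> (g y))" if "continuous_on S g" for S and g :: "'b::topological_space \<Rightarrow> 'a"
    using continuous_on_compose2[OF continuous_gradient[OF \<rho>] that] by auto
  have Dc: "continuous_on (UNIV \<times> cbox a b) (\<lambda>(x, y). ?D x y)"
    unfolding split_beta
    by (intro continuous_intros fc bounded_linear.continuous_on[OF bounded_linear_blinfun_inner_right] gc)
  have "((\<lambda>x. integral (cbox a b) (\<lambda>y. f y * \<rho> (x - y))) has_derivative blinfun_apply (integral (cbox a b) (?D x)))
      (at x within UNIV)"
  proof (rule leibniz_rule[OF _ _ Dc])
    fix x y
    have "((\<lambda>x. \<rho> (x - y)) has_derivative (\<lambda>v. gradient \<rho> (x - y) \<bullet> v)) (at x)"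
      by (rule has_derivative_compose[of "\<lambda>x. x - y", OF _ smooth_has_derivative[OF \<rho>]])
        (auto intro!: derivative_eq_intros)
    then have "((\<lambda>x. f y * \<rho> (x - y)) has_derivative (\<lambda>v. f y * (gradient \<rho> (x - y) \<bullet> v))) (at x)"
      by (intro derivative_intros)
    then show "((\<lambda>x. f y * \<rho> (x - y)) has_derivative blinfun_apply (?D x y)) (at x within UNIV)"
      by (rule has_derivative_eq_rhs) (auto simp: blinfun.scaleR_left)
  next
    fix x
    show "(\<lambda>y. f y * \<rho> (x - y)) integrable_on cbox a b"
      by (intro integrable_continuous continuous_intros fc \<rho>c)
  qed auto
  moreover have "?D x integrable_on cbox a b"
    by (intro integrable_continuous continuous_intros fc
        bounded_linear.continuous_on[OF bounded_linear_blinfun_inner_right] gc)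
  then have "blinfun_apply (integral (cbox a b) (?D x))
      = (\<lambda>v. integral (cbox a b) (\<lambda>y. f y * (gradient \<rho> (x - y) \<bullet> v)))"
    by (intro ext) (simp add: blinfun_apply_integral blinfun.scaleR_left)
  ultimately show ?thesis unfolding conv_box_def[abs_def] by simp
qed

text \<open>A partial derivative is again a convolution of \<open>f\<close>, with a partial
  derivative of \<open>\<rho>\<close> as kernel; hence the induction for all kernels at
  once.\<close>

lemma smooth_conv_box:
  assumes f: "continuous_on UNIV f" and \<rho>: "smooth \<rho>"
  shows "smooth (conv_box a b f \<rho>)"
  unfolding smooth_def
proof
  fix k
  show "C_k k (conv_box a b f \<rho>)" using \<rho>
  proof (induction k arbitrary: \<rho>)
    case 0
    show ?case unfolding C_k.simps continuous_on_eq_continuous_at[OF open_UNIV]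
      using has_derivative_continuous[OF conv_box_has_derivative[OF f 0]] by blast
  next
    case (Suc k)
    show ?case
      by (rule C_k_SucI[OF conv_box_has_derivative[OF f Suc.prems]])
        (use Suc.IH[OF smooth_gradient_inner[OF Suc.prems]] in \<open>simp add: conv_box_def[abs_def]\<close>)
  qed
qed

text \<open>Evenness of \<open>\<rho>\<close> moves the variable from the kernel to
  \<open>f\<close>. The convolution becomes a weighted average of translates of \<open>f\<close>,
  from which it inherits bounds.\<close>

lemma conv_box_eq_lborel:
  fixes f \<rho> :: "'a::euclidean_space \<Rightarrow> real"
  assumes f: "continuous_on UNIV f" "\<And>y. y \<notin> cbox a b \<Longrightarrow> f y = 0" and \<rho>: "continuous_on UNIV \<rho>"
    "\<And>z. \<rho> (- z) = \<rho> z"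
  shows "conv_box a b f \<rho> x = (LINT z|lborel. f (x + z) * \<rho> z)"
proof -
  have c: "continuous_on UNIV (\<lambda>y. f y * \<rho> (x - y))"
    by (intro continuous_intros f(1) continuous_on_compose2[OF \<rho>(1)]) auto
  have e: "(\<lambda>y. indicator (cbox a b) y *\<^sub>R (f y * \<rho> (x - y))) = (\<lambda>y. f y * \<rho> (x - y))"
    by (rule ext) (use f(2) in \<open>auto simp: indicator_def\<close>)
  have i: "integrable lborel (\<lambda>y. f y * \<rho> (x - y))"
    using f(2) by (intro compact_support_integrable[OF c compact_cbox[of a b]]) auto
  have "conv_box a b f \<rho> x = (LINT y|lborel. f y * \<rho> (x - y))"
  proof -
    have "set_integrable lborel (cbox a b) (\<lambda>y. f y * \<rho> (x - y))" unfolding set_integrable_def e by (rule i)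
    from set_borel_integral_eq_integral(2)[OF this] show ?thesis
      unfolding set_lebesgue_integral_def e conv_box_def by (rule sym)
  qed
  also have "\<dots> = (LINT z|lborel. f (z + x) * \<rho> (x - (z + x)))"
    by (rule lborel_integral_translate[symmetric]) (rule borel_measurable_continuous_onI[OF c])
  also have "\<dots> = (LINT z|lborel. f (x + z) * \<rho> z)"
    using \<rho>(2) by (simp add: add.commute)
  finally show ?thesis .
qed

text \<open>The difference quotient in the direction of the gradient itself tends to the squared
  length of the gradient.\<close>

lemma smooth_lipschitz_gradient_le:
  assumes m: "smooth m" and lip: "\<And>x y. \<bar>m x - m y\<bar> \<le> c * norm (x - y)"
  shows "norm (gradient m x) \<le> c"
proof -
  let ?g = "gradient m x"
  have "((\<lambda>t. m (x + t *\<^sub>R ?g)) has_field_derivative (?g \<bullet> ?g)) (at 0)"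
    using smooth_line_derivative[OF m, of x ?g 0] by simp
  then have "((\<lambda>h. (m (x + h *\<^sub>R ?g) - m x) / h) \<longlongrightarrow> ?g \<bullet> ?g) (at 0)" by (simp add: DERIV_def)
  moreover have "eventually (\<lambda>h. (m (x + h *\<^sub>R ?g) - m x) / h \<le> c * norm ?g) (at 0)"
    unfolding eventually_at_filter
  proof (intro always_eventually allI impI)
    fix h :: real assume h: "h \<noteq> 0"
    have "\<bar>m (x + h *\<^sub>R ?g) - m x\<bar> \<le> c * norm ?g * \<bar>h\<bar>"
      using lip[of "x + h *\<^sub>R ?g" x] by (simp add: mult_ac)
    then have "\<bar>(m (x + h *\<^sub>R ?g) - m x) / h\<bar> \<le> c * norm ?g" using h by (simp add: divide_le_eq)
    then show "(m (x + h *\<^sub>R ?g) - m x) / h \<le> c * norm ?g" by linarith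
  qed
  ultimately have "?g \<bullet> ?g \<le> c * norm ?g" by (rule tendsto_upperbound) simp
  then have "norm ?g * norm ?g \<le> c * norm ?g" by (simp add: power2_norm_eq_inner[symmetric] power2_eq_square)
  moreover have "0 \<le> c" using lip[of "x + (SOME b. b \<in> Basis)" x] some_in_eq[of "Basis :: 'a set"]
    by (auto simp: intro: order_trans[OF abs_ge_zero])
  ultimately show ?thesis by (cases "?g = 0") (auto simp: mult_le_cancel_right)
qed

text \<open>An average of translates keeps the range and the Lipschitz constant, so smoothing costs
  nothing in the gradient bound. The last property will give both the support and the plateau of the
  cutoff.\<close>

lemma mollify:
  fixes f :: "'a::euclidean_space \<Rightarrow> real"
  assumes \<delta>: "\<delta> > 0" and lip: "\<And>x y. \<bar>f x - f y\<bar> \<le> c * norm (x - y)" and f01: "\<And>x. 0 \<le> f x \<and> f x \<le> 1"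
    and bd: "bounded {x. f x \<noteq> 0}"
  obtains m where "smooth m" "\<And>x. 0 \<le> m x \<and> m x \<le> 1" "\<And>x. norm (gradient m x) \<le> c"
    "\<And>x v. (\<And>y. y \<in> ball x \<delta> \<Longrightarrow> f y = v) \<Longrightarrow> m x = v"
proof -
  define \<rho> where "\<rho> = ball_bump (0 :: 'a) \<delta>"
  have \<rho>: "smooth \<rho>" "\<And>z. 0 \<le> \<rho> z" "\<And>z. 0 < \<rho> z \<longleftrightarrow> z \<in> ball 0 \<delta>"
    using \<delta> by (auto simp: \<rho>_def ball_bump_nonneg ball_bump_pos_iff intro: smooth_intros)
  have \<rho>0: "\<rho> z = 0" if "z \<notin> cball 0 \<delta>" for z
    using \<rho>(2,3)[of z] that ball_subset_cball[of "0 :: 'a" \<delta>] by (metis antisym_conv2 subsetD)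
  have \<rho>c: "continuous_on UNIV \<rho>" by (rule smooth_continuous[OF \<rho>(1)])
  have \<rho>s: "\<rho> (- z) = \<rho> z" for z by (simp add: \<rho>_def ball_bump_def)
  note [measurable] = smooth_borel[OF \<rho>(1)]
  have \<rho>i: "integrable lborel \<rho>" by (rule compact_support_integrable[OF \<rho>c compact_cball \<rho>0])
  have fc: "continuous_on UNIV f"
  proof (rule lipschitz_on_continuous_on[of "max c 0"])
    show "(max c 0)-lipschitz_on UNIV f"
    proof (rule lipschitz_onI)
      fix x y
      have "dist (f x) (f y) \<le> c * dist x y" using lip[of x y] by (simp add: dist_norm)
      also have "\<dots> \<le> max c 0 * dist x y" by (intro mult_right_mono) auto
      finally show "dist (f x) (f y) \<le> max c 0 * dist x y" .
    qed simp
  qed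
  have [measurable]: "f \<in> borel_measurable borel" using fc by (rule borel_measurable_continuous_onI)
  obtain a b where ab: "{x. f x \<noteq> 0} \<subseteq> cbox a b" using bounded_subset_cbox_symmetric[OF bd] by blast
  define I where "I = (LINT z|lborel. \<rho> z)"
  have I: "I > 0"
  proof -
    have "I \<noteq> 0"
    proof
      assume "I = 0"
      then have "AE z in lborel. \<rho> z = 0"
        using integral_nonneg_eq_0_iff_AE[OF \<rho>i] \<rho>(2) by (simp add: I_def)
      then have "AE z in lborel. z \<notin> ball (0 :: 'a) \<delta>" by eventually_elim (use \<rho>(3) in force)
      then have "emeasure lborel (ball (0 :: 'a) \<delta>) = 0" by (subst (asm) AE_iff_measurable[of "ball 0 \<delta>"]) auto
      moreover have "emeasure lborel (ball (0 :: 'a) \<delta>) \<noteq> 0"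
        using \<delta> unit_ball_vol_pos[of "real DIM('a)", THEN order.strict_implies_not_eq] by (simp add: emeasure_ball)
      ultimately show False by simp
    qed
    moreover have "I \<ge> 0" unfolding I_def using \<rho>(2) by simp
    ultimately show ?thesis by simp
  qed
  define m where "m x = (1 / I) * conv_box a b f \<rho> x" for x
  have m: "m x = (1 / I) * (LINT z|lborel. f (x + z) * \<rho> z)" for x
    unfolding m_def using ab fc \<rho>c \<rho>s by (subst conv_box_eq_lborel) auto
  have fi: "integrable lborel (\<lambda>z. f (x + z) * \<rho> z)" for x
  proof (rule Bochner_Integration.integrable_bound[OF \<rho>i])
    have "f (x + z) * \<rho> z \<le> 1 * \<rho> z" for z using f01 \<rho>(2) by (intro mult_right_mono) auto
    then show "AE z in lborel. norm (f (x + z) * \<rho> z) \<le> norm (\<rho> z)" using f01 \<rho>(2) by (simp add: abs_mult)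
  qed measurable
  show thesis
  proof (rule that)
    show sm: "smooth m" unfolding m_def by (intro smooth_intros smooth_conv_box[OF fc \<rho>(1)])
    show "0 \<le> m x \<and> m x \<le> 1" for x
    proof -
      have "0 \<le> (LINT z|lborel. f (x + z) * \<rho> z)" using f01 \<rho>(2) by (intro integral_nonneg_AE AE_I2) auto
      moreover have "(LINT z|lborel. f (x + z) * \<rho> z) \<le> I" unfolding I_def
        using f01 \<rho>(2) by (intro integral_mono fi \<rho>i mult_left_le_one_le) auto
      ultimately show ?thesis using I by (simp add: m)
    qed
    have "\<bar>m x - m y\<bar> \<le> c * norm (x - y)" for x y
    proof -
      have "(LINT z|lborel. f (x + z) * \<rho> z) - (LINT z|lborel. f (y + z) * \<rho> z) = (LINT z|lborel. f (x + z) * \<rho> z - f (y + z) * \<rho> z)"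
        using fi by simp
      also have "\<bar>\<dots>\<bar> \<le> (LINT z|lborel. \<bar>f (x + z) * \<rho> z - f (y + z) * \<rho> z\<bar>)"
        by (rule integral_abs_bound)
      also have "\<dots> \<le> (LINT z|lborel. c * norm (x - y) * \<rho> z)"
      proof (rule integral_mono)
        fix z
        have "\<bar>f (x + z) - f (y + z)\<bar> * \<rho> z \<le> c * norm (x - y) * \<rho> z"
          using lip[of "x + z" "y + z"] \<rho>(2) by (intro mult_right_mono) auto
        then show "\<bar>f (x + z) * \<rho> z - f (y + z) * \<rho> z\<bar> \<le> c * norm (x - y) * \<rho> z"
          using \<rho>(2)[of z] by (simp add: left_diff_distrib[symmetric] abs_mult)
      qed (use fi \<rho>i in auto)
      also have "\<dots> = c * norm (x - y) * I" by (simp add: I_def)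
      finally have "\<bar>(LINT z|lborel. f (x + z) * \<rho> z) - (LINT z|lborel. f (y + z) * \<rho> z)\<bar> / I \<le> c * norm (x - y)"
        using I by (simp add: divide_le_eq)
      then show ?thesis using I by (simp add: m diff_divide_distrib[symmetric])
    qed
    then show "norm (gradient m x) \<le> c" for x by (rule smooth_lipschitz_gradient_le[OF sm])
    fix x v assume v: "\<And>y. y \<in> ball x \<delta> \<Longrightarrow> f y = v"
    have "f (x + z) * \<rho> z = v * \<rho> z" for z
    proof (cases "z \<in> ball 0 \<delta>")
      case True
      then show ?thesis using v[of "x + z"] by (simp add: dist_norm)
    next
      case False
      then have "\<rho> z = 0" using \<rho>(2,3)[of z] by linarith
      then show ?thesis by simp
    qed
    then have "m x = (1 / I) * (LINT z|lborel. v * \<rho> z)" unfolding m by (simp only:)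
    then show "m x = v" using I by (simp add: I_def)
  qed
qed

text \<open>A segment from \<open>x\<close> to a point outside \<open>\<Omega>\<close> crosses the
  boundary. The cutoff needs the distance to the complement, which vanishes outside
  \<open>\<Omega>\<close>; the collar is defined by the distance to the boundary.\<close>

lemma infdist_compl_eq_frontier:
  fixes \<Omega> :: "'a::euclidean_space set"
  assumes "open \<Omega>" "bounded \<Omega>" "x \<in> \<Omega>"
  shows "infdist x (- \<Omega>) = infdist x (frontier \<Omega>)"
proof (rule antisym)
  have ne: "- \<Omega> \<noteq> {}" using assms(2) not_bounded_UNIV by (metis Compl_empty_eq double_complement)
  have hit: "\<exists>z\<in>frontier \<Omega>. dist x z \<le> dist x y" if "y \<notin> \<Omega>" for y
  proof -
    have "closed_segment x y \<inter> frontier \<Omega> \<noteq> {}"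
      using assms(3) that by (intro connected_Int_frontier) auto
    then obtain z where z: "z \<in> closed_segment x y" "z \<in> frontier \<Omega>" by blast
    then show ?thesis using segment_bound1[of z x y] by (intro bexI[of _ z]) (auto simp: dist_norm norm_minus_commute)
  qed
  then have fne: "frontier \<Omega> \<noteq> {}" using ne by blast
  have "frontier \<Omega> \<subseteq> - \<Omega>" using assms(1) by (auto simp: frontier_def interior_open)
  then show "infdist x (- \<Omega>) \<le> infdist x (frontier \<Omega>)" using fne by (rule infdist_mono)
  show "infdist x (frontier \<Omega>) \<le> infdist x (- \<Omega>)"
    unfolding infdist_notempty[OF ne]
    by (rule cINF_greatest[OF ne]) (metis ComplD hit infdist_le2)
qed

section \<open>Boundary collars and cutoff functions\<close>

context bounded_open
begin

lemma collar_sets: "boundary_collar \<Omega> h \<in> sets lebesgue"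
proof -
  have "boundary_collar \<Omega> h = \<Omega> \<inter> {x. infdist x (frontier \<Omega>) \<le> h}" by (auto simp: boundary_collar_def)
  moreover have "closed {x. infdist x (frontier \<Omega>) \<le> h}"
    by (intro closed_Collect_le continuous_intros)
  ultimately show ?thesis using open_\<Omega> by auto
qed

lemma \<Omega>_lmeasurable: "\<Omega> \<in> lmeasurable"
  using bounded_\<Omega> \<Omega>_sets by (rule bounded_set_imp_lmeasurable)

lemma collar_lmeasurable: "boundary_collar \<Omega> h \<in> lmeasurable"
  by (rule fmeasurableI2[OF \<Omega>_lmeasurable _ collar_sets]) (auto simp: boundary_collar_def)

text \<open>The smoothed ramp of slope \<open>1 / h\<close> equals 1 wherever the distance to the
  complement exceeds \<open>h + \<eta>\<close>. Lost mass and gradient are thus confined to the same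
  collar.\<close>

lemma cutoff_exists:
  assumes h: "h > 0" and \<eta>: "\<eta> > 0"
  obtains \<phi> where "test_function \<Omega> \<phi>" "\<And>x. 0 \<le> \<phi> x \<and> \<phi> x \<le> 1"
    "measure lebesgue \<Omega> - measure lebesgue (boundary_collar \<Omega> (h + \<eta>)) \<le> (LINT x|M. (\<phi> x)\<^sup>2)"
    "(LINT x|M. (norm (gradient \<phi> x))\<^sup>2) \<le> measure lebesgue (boundary_collar \<Omega> (h + \<eta>)) / h\<^sup>2"
proof -
  \<comment> \<open>Starting the ramp at \<open>2 * \<delta>\<close> and mollifying at radius
    \<open>\<delta>\<close> leaves a margin \<open>\<delta>\<close> for compact support, and the
    value 1 is reached by \<open>h + 3 * \<delta>\<close>.\<close>
  define \<delta> where "\<delta> = \<eta> / 3"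
  have \<delta>: "\<delta> > 0" "\<eta> = 3 * \<delta>" using \<eta> by (auto simp: \<delta>_def)
  have ne: "- \<Omega> \<noteq> {}" using bounded_\<Omega> not_bounded_UNIV by (metis Compl_empty_eq double_complement)
  define D where "D x = infdist x (- \<Omega>)" for x
  have D_lip: "\<bar>D x - D y\<bar> \<le> norm (x - y)" for x y
    unfolding D_def using infdist_triangle_abs[of x "- \<Omega>" y] by (simp add: dist_norm)
  have D_out: "D x = 0" if "x \<notin> \<Omega>" for x using that by (simp add: D_def)
  define f where "f x = max 0 (min 1 ((D x - 2 * \<delta>) / h))" for x
  have f_lip: "\<bar>f x - f y\<bar> \<le> (1 / h) * norm (x - y)" for x y
  proof -
    have "\<bar>f x - f y\<bar> \<le> \<bar>(D x - 2 * \<delta>) / h - (D y - 2 * \<delta>) / h\<bar>" unfolding f_def by linarith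
    also have "\<dots> = \<bar>D x - D y\<bar> / h" using h by (simp add: diff_divide_distrib[symmetric])
    also have "\<dots> \<le> (1 / h) * norm (x - y)" using D_lip h by (simp add: divide_right_mono)
    finally show ?thesis .
  qed
  have f01: "0 \<le> f x \<and> f x \<le> 1" for x by (simp add: f_def)
  have f0: "f x = 0" if "D x \<le> 2 * \<delta>" for x
  proof -
    have "(D x - 2 * \<delta>) / h \<le> 0" using that h by (intro divide_nonpos_pos) auto
    then show ?thesis by (simp add: f_def)
  qed
  have f1: "f x = 1" if "h + 2 * \<delta> \<le> D x" for x using that h by (simp add: f_def le_divide_eq)
  have "{x. f x \<noteq> 0} \<subseteq> \<Omega>" using f0 D_out \<delta>(1) by force
  then have bd: "bounded {x. f x \<noteq> 0}" using bounded_\<Omega> bounded_subset by blast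
  obtain m where m: "smooth m" "\<And>x. 0 \<le> m x \<and> m x \<le> 1" "\<And>x. norm (gradient m x) \<le> 1 / h"
    "\<And>x v. (\<And>y. y \<in> ball x \<delta> \<Longrightarrow> f y = v) \<Longrightarrow> m x = v"
    using mollify[OF \<delta>(1) f_lip f01 bd] by blast
  have D_ball: "\<bar>D y - D x\<bar> < \<delta>" if "y \<in> ball x \<delta>" for x y
    using D_lip[of y x] that by (simp add: dist_norm norm_minus_commute)
  have m0: "m x = 0" if "D x < \<delta>" for x
    by (rule m(4), rule f0) (use that D_ball in fastforce)
  have m1: "m x = 1" if "h + \<eta> < D x" for x
    by (rule m(4), rule f1) (use that D_ball \<delta> in fastforce)
  have Dc: "continuous_on UNIV D" unfolding D_def by (intro continuous_intros)
  have test: "test_function \<Omega> m"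
  proof (rule test_functionI[OF m(1)])
    have sub: "{x. \<delta> \<le> D x} \<subseteq> \<Omega>" using D_out \<delta>(1) by force
    show "{x. \<delta> \<le> D x} \<subseteq> \<Omega>" by (rule sub)
    have "closed {x. \<delta> \<le> D x}" by (intro closed_Collect_le continuous_on_const Dc)
    then show "compact {x. \<delta> \<le> D x}"
      using bounded_subset[OF bounded_\<Omega> sub] by (simp add: compact_eq_bounded_closed)
    show "m x = 0" if "x \<notin> {x. \<delta> \<le> D x}" for x using that m0 by simp
  qed
  let ?\<omega> = "boundary_collar \<Omega> (h + \<eta>)"
  have \<omega>: "x \<in> ?\<omega> \<longleftrightarrow> D x \<le> h + \<eta>" if "x \<in> \<Omega>" for x
    using that infdist_compl_eq_frontier[OF open_\<Omega> bounded_\<Omega> that] by (simp add: boundary_collar_def D_def)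
  have g0: "gradient m x = 0" if "h + \<eta> < D x" for x
    by (rule gradient_eq_0_open[of "{x. h + \<eta> < D x}"]) (use that m1 in \<open>auto intro!: open_Collect_less Dc\<close>)
  have ind: "integrable M (indicator A :: 'a \<Rightarrow> real)" "(LINT x|M. indicator A x) = measure lebesgue A"
    if "A \<subseteq> \<Omega>" "A \<in> sets lebesgue" for A
  proof -
    have "A \<in> lmeasurable" using \<Omega>_lmeasurable that by (rule fmeasurableI2)
    then show "integrable M (indicator A :: 'a \<Rightarrow> real)" "(LINT x|M. indicator A x) = measure lebesgue A"
      using that \<Omega>_sets
      by (auto simp: measure_restrict_space emeasure_restrict_space sets_restrict_space_iff Int_absorb2
        fmeasurable_def intro!: integrable_real_indicator)
  qed
  have \<omega>s: "?\<omega> \<subseteq> \<Omega>" by (auto simp: boundary_collar_def)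
  show thesis
  proof (rule that[OF test m(2)])
    have "measure lebesgue \<Omega> - measure lebesgue ?\<omega> = measure lebesgue (\<Omega> - ?\<omega>)"
      using \<Omega>_lmeasurable collar_lmeasurable \<omega>s by (simp add: measurable_measure_Diff collar_sets)
    also have "\<dots> = (LINT x|M. indicator (\<Omega> - ?\<omega>) x)"
      using ind(2)[of "\<Omega> - ?\<omega>"] \<Omega>_sets collar_sets by auto
    also have "\<dots> \<le> (LINT x|M. (m x)\<^sup>2)"
    proof (rule integral_mono)
      show "integrable M (\<lambda>x. (m x)\<^sup>2)" using test_L2[OF test] by (simp add: L2_def)
      fix x assume "x \<in> space M"
      then show "indicator (\<Omega> - ?\<omega>) x \<le> (m x)\<^sup>2" using \<omega>[of x] m1[of x] by (auto simp: indicator_def)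
    qed (use ind(1)[of "\<Omega> - ?\<omega>"] \<Omega>_sets collar_sets in auto)
    finally show "measure lebesgue \<Omega> - measure lebesgue ?\<omega> \<le> (LINT x|M. (m x)\<^sup>2)" .
    have "(LINT x|M. (norm (gradient m x))\<^sup>2) \<le> (LINT x|M. indicator ?\<omega> x / h\<^sup>2)"
    proof (rule integral_mono)
      show "integrable M (\<lambda>x. (norm (gradient m x))\<^sup>2)" using test_gradient_L2[OF test] by (simp add: L2_def)
      show "integrable M (\<lambda>x. indicator ?\<omega> x / h\<^sup>2)" using ind(1)[OF \<omega>s collar_sets] by simp
      fix x assume x: "x \<in> space M"
      have "(norm (gradient m x))\<^sup>2 \<le> (1 / h)\<^sup>2" using m(3) by (intro power_mono) auto
      then show "(norm (gradient m x))\<^sup>2 \<le> indicator ?\<omega> x / h\<^sup>2"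
        using x \<omega>[of x] g0[of x] by (auto simp: indicator_def power_divide)
    qed
    also have "\<dots> = measure lebesgue ?\<omega> / h\<^sup>2" using ind(2)[OF \<omega>s collar_sets] by simp
    finally show "(LINT x|M. (norm (gradient m x))\<^sup>2) \<le> measure lebesgue ?\<omega> / h\<^sup>2" .
  qed
qed

text \<open>The collar is defined with \<open>\<le>\<close>, so it is the intersection of the
  slightly wider ones, and measure is continuous from above. This removes the margin
  \<open>\<eta>\<close> of \<open>cutoff_exists\<close>.\<close>

lemma collar_right_continuous:
  "(\<lambda>n. measure lebesgue (boundary_collar \<Omega> (h + 1 / real (Suc n)))) \<longlonglongrightarrow> measure lebesgue (boundary_collar \<Omega> h)"
proof -
  have "(\<Inter>n. boundary_collar \<Omega> (h + 1 / real (Suc n))) = boundary_collar \<Omega> h"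
  proof
    show "(\<Inter>n. boundary_collar \<Omega> (h + 1 / real (Suc n))) \<subseteq> boundary_collar \<Omega> h"
    proof
      fix x assume x: "x \<in> (\<Inter>n. boundary_collar \<Omega> (h + 1 / real (Suc n)))"
      have "(\<lambda>n. h + 1 / real (Suc n)) \<longlonglongrightarrow> h + 0" by (intro tendsto_intros LIMSEQ_Suc lim_1_over_n)
      then have "infdist x (frontier \<Omega>) \<le> h + 0"
        by (rule LIMSEQ_le_const) (use x in \<open>auto simp: boundary_collar_def\<close>)
      then show "x \<in> boundary_collar \<Omega> h" using x by (auto simp: boundary_collar_def)
    qed
    show "boundary_collar \<Omega> h \<subseteq> (\<Inter>n. boundary_collar \<Omega> (h + 1 / real (Suc n)))"
      by (auto simp: boundary_collar_def intro: order_trans)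
  qed
  moreover have "(\<lambda>n. measure lebesgue (boundary_collar \<Omega> (h + 1 / real (Suc n))))
      \<longlonglongrightarrow> measure lebesgue (\<Inter>n. boundary_collar \<Omega> (h + 1 / real (Suc n)))"
  proof (rule Lim_measure_decseq)
    show "range (\<lambda>n. boundary_collar \<Omega> (h + 1 / real (Suc n))) \<subseteq> sets lebesgue" using collar_sets by auto
    show "decseq (\<lambda>n. boundary_collar \<Omega> (h + 1 / real (Suc n)))"
    proof (rule decseq_SucI, rule subsetI)
      fix n x assume x: "x \<in> boundary_collar \<Omega> (h + 1 / real (Suc (Suc n)))"
      have "1 / real (Suc (Suc n)) \<le> 1 / real (Suc n)" by (simp add: field_simps)
      then show "x \<in> boundary_collar \<Omega> (h + 1 / real (Suc n))" using x unfolding boundary_collar_def by simp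
    qed
    show "emeasure lebesgue (boundary_collar \<Omega> (h + 1 / real (Suc i))) \<noteq> \<infinity>" for i
      unfolding infinity_ennreal_def by (rule fmeasurableD2[OF collar_lmeasurable])
  qed
  ultimately show ?thesis by simp
qed

end

section \<open>The heat trace\<close>

lemma fun_sum_apply: "(\<Sum>i\<in>I. f i) x = (\<Sum>i\<in>I. f i x)" for f :: "'i \<Rightarrow> 'a \<Rightarrow> 'b::comm_monoid_add"
  by (induction I rule: infinite_finite_induct) auto

text \<open>The cross terms of the two squares cancel, which separates the energy of the phase from
  that of the amplitude.\<close>

lemma norm_square_rotate:
  fixes p g :: "'a::real_inner"
  shows "(norm (a *\<^sub>R (- sin \<theta>) *\<^sub>R p + cos \<theta> *\<^sub>R g))\<^sup>2 + (norm (a *\<^sub>R cos \<theta> *\<^sub>R p + sin \<theta> *\<^sub>R g))\<^sup>2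
    = (norm p)\<^sup>2 * a\<^sup>2 + (norm g)\<^sup>2"
proof -
  have "(norm (a *\<^sub>R (- s) *\<^sub>R p + c *\<^sub>R g))\<^sup>2 + (norm (a *\<^sub>R c *\<^sub>R p + s *\<^sub>R g))\<^sup>2
      = (s\<^sup>2 + c\<^sup>2) * (a\<^sup>2 * (p \<bullet> p)) + (s\<^sup>2 + c\<^sup>2) * (g \<bullet> g)" for s c :: real
    unfolding power2_norm_eq_inner
    by (simp add: inner_add_left inner_add_right inner_commute power2_eq_square algebra_simps)
  from this[of "sin \<theta>" "cos \<theta>"] show ?thesis
    unfolding sin_cos_squared_add by (simp only: power2_norm_eq_inner mult_1 mult.commute)
qed

lemma gradient_mult_cos_sin:
  assumes "smooth \<phi>"
  shows "gradient (\<lambda>x. \<phi> x * cos (x \<bullet> p)) x = \<phi> x *\<^sub>R (- sin (x \<bullet> p)) *\<^sub>R p + cos (x \<bullet> p) *\<^sub>R gradient \<phi> x"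
    "gradient (\<lambda>x. \<phi> x * sin (x \<bullet> p)) x = \<phi> x *\<^sub>R cos (x \<bullet> p) *\<^sub>R p + sin (x \<bullet> p) *\<^sub>R gradient \<phi> x"
proof -
  have "gradient (\<lambda>x. cos (x \<bullet> p)) x = (- sin (x \<bullet> p)) *\<^sub>R p" "gradient (\<lambda>x. sin (x \<bullet> p)) x = cos (x \<bullet> p) *\<^sub>R p"
    by (rule gradient_unique; auto intro!: derivative_eq_intros simp: inner_commute)+
  then show "gradient (\<lambda>x. \<phi> x * cos (x \<bullet> p)) x = \<phi> x *\<^sub>R (- sin (x \<bullet> p)) *\<^sub>R p + cos (x \<bullet> p) *\<^sub>R gradient \<phi> x"
    "gradient (\<lambda>x. \<phi> x * sin (x \<bullet> p)) x = \<phi> x *\<^sub>R cos (x \<bullet> p) *\<^sub>R p + sin (x \<bullet> p) *\<^sub>R gradient \<phi> x"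
    by (simp_all add: gradient_mult[OF assms] smooth_cos_sin smooth_inner)
qed

context bounded_open
begin

lemma AE_zero_iff_ip: "u \<in> L2 M \<Longrightarrow> (AE x in M. u x = 0) \<longleftrightarrow> ip u u = 0"
  using dist2_zero_iff[OF _ L2_zero, of u M] by (simp add: dist2_def ip_self)

text \<open>The grid estimate supplies \<open>C\<close>; independence and spanning almost everywhere
  turn into statements about \<open>ip\<close> through \<open>AE_zero_iff_ip\<close> and
  \<open>dist2_zero_iff\<close>.\<close>

lemma eigenvalue_listing:
  assumes ev: "dirichlet_eigenvalues \<Omega> ev"
  obtains C where "compact_form_listing (L2 M) (H10 \<Omega>) ip en C DIM('a) ev"
proof -
  obtain C where C: "C > 0" "\<And>N. N > 0 \<Longrightarrow> \<exists>g :: nat \<Rightarrow> 'a \<Rightarrow> real. (\<forall>i<N ^ DIM('a). g i \<in> L2 M \<and> ip (g i) (g i) \<le> 1) \<and>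
        (\<forall>u\<in>H10 \<Omega>. ip u u \<le> (\<Sum>i<N ^ DIM('a). (ip u (g i))\<^sup>2) + C / (real N)\<^sup>2 * en u u)"
    using grid_approximation by blast
  interpret ip: psd_form "L2 M" ip by (rule psd_ip)
  interpret en: psd_form "H10 \<Omega>" en by (rule psd_en)
  have cf: "compact_form (L2 M) (H10 \<Omega>) ip en C DIM('a)"
    by unfold_locales (use H10_L2 H10_complete C in auto)
  then interpret compact_form "L2 M" "H10 \<Omega>" ip en C "DIM('a)" .
  have eig: "dirichlet_eigenspace \<Omega> \<mu> = eigenspace \<mu>" for \<mu>
  proof -
    have "square_integrable_on \<Omega> (\<lambda>x. \<mu> * u x)" if "u \<in> H10 \<Omega>" for u
      using L2_scaleR[OF H10_L2[OF that], of \<mu>] by (simp add: square_integrable_on_iff)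
    moreover have "(LINT x|M. \<mu> * u x * v x) = \<mu> * ip u v" for u v by (simp add: ip_def mult.assoc)
    ultimately show ?thesis
      unfolding dirichlet_eigenspace_def dirichlet_laplacian_def eigenspace_def en_def by auto
  qed
  have "compact_form_listing (L2 M) (H10 \<Omega>) ip en C DIM('a) ev"
  proof (rule compact_form_listing.intro[OF cf], unfold_locales)
    show "mono ev" "finite {j. ev j = \<mu>}" for \<mu> using ev by (auto simp: dirichlet_eigenvalues_def)
    fix \<mu>
    let ?n = "card {j. ev j = \<mu>}"
    have "has_dimension_ae M (eigenspace \<mu>) ?n"
      using ev unfolding dirichlet_eigenvalues_def eig by blast
    then obtain e :: "nat \<Rightarrow> 'a \<Rightarrow> real" where e: "\<And>i. i < ?n \<Longrightarrow> e i \<in> eigenspace \<mu>"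
      and ind: "\<And>c :: nat \<Rightarrow> real. (AE x in M. (\<Sum>i<?n. c i * e i x) = 0) \<Longrightarrow> \<forall>i<?n. c i = 0"
      and spn: "\<And>u. u \<in> eigenspace \<mu> \<Longrightarrow> \<exists>c :: nat \<Rightarrow> real. AE x in M. u x = (\<Sum>i<?n. c i * e i x)"
      unfolding has_dimension_ae_def by blast
    have ap: "(\<Sum>i<?n. c i *\<^sub>R e i) x = (\<Sum>i<?n. c i * e i x)" for c x
      by (simp add: fun_sum_apply scaleR_fun_def)
    have eH: "e i \<in> H10 \<Omega>" if "i < ?n" for i using e[OF that] by (simp add: eigenspace_def)
    have sL: "(\<Sum>i<?n. c i *\<^sub>R e i) \<in> L2 M" for c
      by (intro ip.closed(5) ip.closed(4) H10_L2 eH) auto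
    have "\<forall>i<?n. c i = 0" if "ip (\<Sum>i<?n. c i *\<^sub>R e i) (\<Sum>i<?n. c i *\<^sub>R e i) = 0" for c
      using that ind[of c] unfolding AE_zero_iff_ip[OF sL, symmetric] ap by blast
    moreover have "\<exists>c. ip (u - (\<Sum>i<?n. c i *\<^sub>R e i)) (u - (\<Sum>i<?n. c i *\<^sub>R e i)) = 0"
      if u: "u \<in> eigenspace \<mu>" for u
    proof -
      obtain c where c: "AE x in M. u x = (\<Sum>i<?n. c i * e i x)" using spn[OF u] by blast
      have "u \<in> L2 M" using u H10_L2 by (auto simp: eigenspace_def)
      then show ?thesis using c dist2_zero_iff[OF _ sL, of u c] unfolding ip_diff_self ap by blast
    qed
    ultimately show "\<exists>e :: nat \<Rightarrow> 'a \<Rightarrow> real. (\<forall>i<?n. e i \<in> eigenspace \<mu>) \<and>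
      (\<forall>c. (let s = \<Sum>i<?n. c i *\<^sub>R e i in ip s s = 0) \<longrightarrow> (\<forall>i<?n. c i = 0)) \<and>
      (\<forall>u\<in>eigenspace \<mu>. \<exists>c. let s = u - (\<Sum>i<?n. c i *\<^sub>R e i) in ip s s = 0)"
      unfolding Let_def using e by blast
  qed
  then show thesis using that by blast
qed

text \<open>Real and imaginary parts serve as two real vectors. Their individual masses and energies
  depend on the phase; only the sums are simple.\<close>

lemma coherent_norm:
  assumes \<phi>: "test_function \<Omega> \<phi>"
  defines "c \<equiv> \<lambda>p x. \<phi> x * cos (x \<bullet> p)" and "s \<equiv> \<lambda>p x. \<phi> x * sin (x \<bullet> p)"
  shows "test_function \<Omega> (c p)" "test_function \<Omega> (s p)"
    "ip (c p) (c p) + ip (s p) (s p) = (LINT x|M. (\<phi> x)\<^sup>2)"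
    "en (c p) (c p) + en (s p) (s p) = (LINT x|M. (norm (gradient \<phi> x))\<^sup>2) + (norm p)\<^sup>2 * (LINT x|M. (\<phi> x)\<^sup>2)"
proof -
  have sm: "smooth \<phi>" using \<phi> by (rule test_function_smooth)
  show t: "test_function \<Omega> (c p)" "test_function \<Omega> (s p)" unfolding c_def s_def
    by (intro test_function_smooth_mult[OF \<phi>] smooth_cos_sin smooth_inner)+
  have i: "integrable M (\<lambda>x. (c p x)\<^sup>2)" "integrable M (\<lambda>x. (s p x)\<^sup>2)"
    "integrable M (\<lambda>x. (norm (gradient (c p) x))\<^sup>2)" "integrable M (\<lambda>x. (norm (gradient (s p) x))\<^sup>2)"
    "integrable M (\<lambda>x. (norm (gradient \<phi> x))\<^sup>2)" "integrable M (\<lambda>x. (\<phi> x)\<^sup>2)"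
    using L2_integrable_norm[OF test_L2[OF t(1)]] L2_integrable_norm[OF test_L2[OF t(2)]]
      L2_integrable_norm[OF test_gradient_L2[OF t(1)]] L2_integrable_norm[OF test_gradient_L2[OF t(2)]]
      L2_integrable_norm[OF test_gradient_L2[OF \<phi>]] L2_integrable_norm[OF test_L2[OF \<phi>]] by simp_all
  have "ip (c p) (c p) + ip (s p) (s p) = (LINT x|M. (c p x)\<^sup>2 + (s p x)\<^sup>2)"
    using i(1,2) by (simp add: ip_self)
  also have "(\<lambda>x. (c p x)\<^sup>2 + (s p x)\<^sup>2) = (\<lambda>x. (\<phi> x)\<^sup>2)"
    by (simp add: c_def s_def power_mult_distrib distrib_left[symmetric])
  finally show "ip (c p) (c p) + ip (s p) (s p) = (LINT x|M. (\<phi> x)\<^sup>2)" .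
  have "en (c p) (c p) + en (s p) (s p) = (LINT x|M. (norm (gradient (c p) x))\<^sup>2 + (norm (gradient (s p) x))\<^sup>2)"
    using i(3,4) by (simp add: en_test[OF t(1)] en_test[OF t(2)])
  also have "(\<lambda>x. (norm (gradient (c p) x))\<^sup>2 + (norm (gradient (s p) x))\<^sup>2)
      = (\<lambda>x. (norm p)\<^sup>2 * (\<phi> x)\<^sup>2 + (norm (gradient \<phi> x))\<^sup>2)"
    unfolding c_def s_def gradient_mult_cos_sin[OF sm] norm_square_rotate ..
  also have "(LINT x|M. (norm p)\<^sup>2 * (\<phi> x)\<^sup>2 + (norm (gradient \<phi> x))\<^sup>2)
      = (LINT x|M. (norm (gradient \<phi> x))\<^sup>2) + (norm p)\<^sup>2 * (LINT x|M. (\<phi> x)\<^sup>2)"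
    using i(5,6) by simp
  finally show "en (c p) (c p) + en (s p) (s p) = (LINT x|M. (norm (gradient \<phi> x))\<^sup>2) + (norm p)\<^sup>2 * (LINT x|M. (\<phi> x)\<^sup>2)" .
qed

text \<open>The overlaps with \<open>u\<close> are Fourier coefficients of \<open>\<phi>\<close>
  times \<open>u\<close>, extended by zero to the cube; \<open>0 \<le> \<phi> x \<le> 1\<close> then
  removes \<open>\<phi>\<close> from the bound.\<close>

lemma coherent_bessel:
  assumes L: "L > 0" "\<Omega> \<subseteq> centered_cube L" and I: "finite I" "I \<subseteq> extensional Basis"
    and \<phi>: "test_function \<Omega> \<phi>" "\<And>x. 0 \<le> \<phi> x \<and> \<phi> x \<le> 1" and u: "u \<in> L2 M"
  shows "(\<Sum>k\<in>I. (ip (\<lambda>x. \<phi> x * cos (x \<bullet> wave L k)) u)\<^sup>2 + (ip (\<lambda>x. \<phi> x * sin (x \<bullet> wave L k)) u)\<^sup>2)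
    \<le> L ^ DIM('a) * ip u u"
proof -
  define f where "f x = indicator \<Omega> x *\<^sub>R (\<phi> x * u x)" for x
  have [measurable]: "u \<in> borel_measurable M" using u by (rule L2_measurable)
  have [measurable]: "\<phi> \<in> borel_measurable M" using test_L2[OF \<phi>(1)] by (rule L2_measurable)
  have int: "(LINT x|lebesgue. indicator \<Omega> x *\<^sub>R g x) = (LINT x|M. g x)"
    and int': "integrable lebesgue (\<lambda>x. indicator \<Omega> x *\<^sub>R g x) \<longleftrightarrow> integrable M g"
    and mea: "(\<lambda>x. indicator \<Omega> x *\<^sub>R g x) \<in> borel_measurable lebesgue \<longleftrightarrow> g \<in> borel_measurable M" for g :: "'a \<Rightarrow> real"
    using \<Omega>_sets by (simp_all add: integral_restrict_space integrable_restrict_space borel_measurable_restrict_space_iff)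
  have le: "(\<phi> x * u x)\<^sup>2 \<le> (u x)\<^sup>2" for x
    using \<phi>(2)[of x] mult_left_le_one_le[of "(u x)\<^sup>2" "(\<phi> x)\<^sup>2"] by (simp add: power_mult_distrib power_le_one)
  have i2: "integrable M (\<lambda>x. (\<phi> x * u x)\<^sup>2)"
  proof (rule Bochner_Integration.integrable_bound)
    show "integrable M (\<lambda>x. (u x)\<^sup>2)" using L2_integrable_norm[OF u] by simp
    show "AE x in M. norm ((\<phi> x * u x)\<^sup>2) \<le> norm ((u x)\<^sup>2)" using le by simp
  qed measurable
  have f2: "(f x)\<^sup>2 = indicator \<Omega> x *\<^sub>R (\<phi> x * u x)\<^sup>2" for x by (simp add: f_def indicator_def)
  have fL: "f \<in> L2 lebesgue"
  proof -
    have "f \<in> borel_measurable lebesgue" unfolding f_def[abs_def] mea by measurable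
    moreover have "integrable lebesgue (\<lambda>x. (f x)\<^sup>2)" unfolding f2 int' by (rule i2)
    ultimately show ?thesis by (simp add: L2_def)
  qed
  have fa: "(LINT x|lebesgue. f x * w x) = ip (\<lambda>x. \<phi> x * w x) u" for w
    unfolding f_def ip_def int[symmetric] by (intro Bochner_Integration.integral_cong) auto
  have "(\<Sum>k\<in>I. (ip (\<lambda>x. \<phi> x * cos (x \<bullet> wave L k)) u)\<^sup>2 + (ip (\<lambda>x. \<phi> x * sin (x \<bullet> wave L k)) u)\<^sup>2)
      \<le> L ^ DIM('a) * (LINT x|lebesgue. (f x)\<^sup>2)"
    unfolding fa[symmetric] using L(2) by (intro fourier_bessel[OF L(1) I fL]) (auto simp: f_def indicator_def)
  also have "(LINT x|lebesgue. (f x)\<^sup>2) = (LINT x|M. (\<phi> x * u x)\<^sup>2)" unfolding f2 int ..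
  also have "L ^ DIM('a) * \<dots> \<le> L ^ DIM('a) * ip u u"
    unfolding ip_self using i2 L2_integrable_norm[OF u] le L(1)
    by (intro mult_left_mono integral_mono) auto
  finally show ?thesis .
qed

text \<open>Lattice and eigenvectors are truncated at first, so that the two sums can be exchanged.
  Eigenvectors go to their limit with the lattice box fixed, because the truncation error grows with
  the momenta; the bound is left open in \<open>N\<close> for the later limit.\<close>

theorem heat_trace_lower_cube:
  assumes lst: "compact_form_listing (L2 M) (H10 \<Omega>) ip en C DIM('a) ev"
    and t: "t > 0" and L: "L > 0" "\<Omega> \<subseteq> centered_cube L"
    and \<phi>: "test_function \<Omega> \<phi>" "\<And>x. 0 \<le> \<phi> x \<and> \<phi> x \<le> 1"
  shows "(\<Sum>m = - int N..int N. exp (- (2 * pi * real_of_int m / L)\<^sup>2 * t)) ^ DIM('a)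
      * ((LINT x|M. (\<phi> x)\<^sup>2) - t * (LINT x|M. (norm (gradient \<phi> x))\<^sup>2))
    \<le> L ^ DIM('a) * (\<Sum>j. exp (- ev j * t))"
proof -
  interpret compact_form_listing "L2 M" "H10 \<Omega>" ip en C "DIM('a)" ev by (rule lst)
  let ?A = "LINT x|M. (\<phi> x)\<^sup>2" and ?G = "LINT x|M. (norm (gradient \<phi> x))\<^sup>2"
  define I where "I = ((Basis \<rightarrow>\<^sub>E {- int N..int N}) :: ('a \<Rightarrow> int) set)"
  have I: "finite I" "I \<subseteq> extensional Basis"
    unfolding I_def using finite_PiE[of "Basis :: 'a set" "\<lambda>_. {- int N..int N}"] by (auto simp: PiE_def)
  define q where "q k = (norm (wave L k))\<^sup>2" for k :: "'a \<Rightarrow> int"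
  define c where "c k x = \<phi> x * cos (x \<bullet> wave L k)" for k and x :: 'a
  define s where "s k x = \<phi> x * sin (x \<bullet> wave L k)" for k and x :: 'a
  have cn: "test_function \<Omega> (c k)" "test_function \<Omega> (s k)" "ip (c k) (c k) + ip (s k) (s k) = ?A"
    "en (c k) (c k) + en (s k) (s k) = ?G + q k * ?A" for k
    unfolding c_def[abs_def] s_def[abs_def] q_def by (rule coherent_norm[OF \<phi>(1)])+
  have main: "(\<Sum>k\<in>I. exp (- q k * t) * ((1 + t * q k) * (?A - (?G + q k * ?A) / ev n) - t * (?G + q k * ?A)))
      \<le> L ^ DIM('a) * (\<Sum>j. exp (- ev j * t))" if n: "ev n > 0" for n
  proof -
    let ?w = "\<lambda>k j. (ip (c k) (eigenbasis j))\<^sup>2 + (ip (s k) (eigenbasis j))\<^sup>2"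
    have "(\<Sum>k\<in>I. exp (- q k * t) * ((1 + t * q k) * (?A - (?G + q k * ?A) / ev n) - t * (?G + q k * ?A)))
        \<le> (\<Sum>k\<in>I. \<Sum>j<n. exp (- ev j * t) * ?w k j)"
    proof (rule sum_mono)
      fix k
      have "exp (- q k * t) * ((1 + t * q k) * (?A - (?G + q k * ?A) / ev n) - t * (?G + q k * ?A))
          = exp (- q k * t) * ((1 + t * q k) * (ip (c k) (c k) - en (c k) (c k) / ev n) - t * en (c k) (c k))
          + exp (- q k * t) * ((1 + t * q k) * (ip (s k) (s k) - en (s k) (s k) / ev n) - t * en (s k) (s k))"
        unfolding cn(4)[of k, symmetric] unfolding cn(3)[of k, symmetric]
        by (simp add: algebra_simps add_divide_distrib)
      also have "\<dots> \<le> (\<Sum>j<n. exp (- ev j * t) * (ip (c k) (eigenbasis j))\<^sup>2) + (\<Sum>j<n. exp (- ev j * t) * (ip (s k) (eigenbasis j))\<^sup>2)"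
        using t n by (intro add_mono trace_term_lower test_H10 cn(1,2)) (auto simp: q_def)
      also have "\<dots> = (\<Sum>j<n. exp (- ev j * t) * ?w k j)"
        by (simp add: sum.distrib distrib_left)
      finally show "exp (- q k * t) * ((1 + t * q k) * (?A - (?G + q k * ?A) / ev n) - t * (?G + q k * ?A))
          \<le> (\<Sum>j<n. exp (- ev j * t) * ?w k j)" .
    qed
    also have "\<dots> = (\<Sum>j<n. exp (- ev j * t) * (\<Sum>k\<in>I. ?w k j))"
      by (subst sum.swap) (simp add: sum_distrib_left)
    also have "\<dots> \<le> (\<Sum>j<n. exp (- ev j * t) * L ^ DIM('a))"
    proof (intro sum_mono mult_left_mono)
      fix j
      have "ip (eigenbasis j) (eigenbasis j) = 1"
        using eigenbasis_orthonormal[of UNIV] by (simp add: ip.orthonormal_def)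
      then show "(\<Sum>k\<in>I. ?w k j) \<le> L ^ DIM('a)"
        using coherent_bessel[OF L I \<phi> H10_L2[OF eigenbasis_H[of j]]] unfolding c_def[abs_def] s_def[abs_def] by simp
    qed simp
    also have "\<dots> = L ^ DIM('a) * (\<Sum>j<n. exp (- ev j * t))"
      by (simp add: sum_distrib_left mult.commute)
    also have "\<dots> \<le> L ^ DIM('a) * (\<Sum>j. exp (- ev j * t))"
      using L(1) by (intro mult_left_mono sum_le_suminf summable_exp t) auto
    finally show ?thesis .
  qed
  have inv: "(\<lambda>n. x / ev n) \<longlonglongrightarrow> 0" for x
    by (rule tendsto_divide_0[OF tendsto_const filterlim_at_top_imp_at_infinity[OF ev_at_top]])
  have "(\<lambda>n. \<Sum>k\<in>I. exp (- q k * t) * ((1 + t * q k) * (?A - (?G + q k * ?A) / ev n) - t * (?G + q k * ?A)))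
      \<longlonglongrightarrow> (\<Sum>k\<in>I. exp (- q k * t) * ((1 + t * q k) * (?A - 0) - t * (?G + q k * ?A)))"
    by (intro tendsto_intros inv)
  moreover have "eventually (\<lambda>n. ev n > 0) sequentially"
    using ev_at_top by (simp add: filterlim_at_top_dense)
  then have "\<exists>N. \<forall>n\<ge>N. (\<Sum>k\<in>I. exp (- q k * t) * ((1 + t * q k) * (?A - (?G + q k * ?A) / ev n) - t * (?G + q k * ?A)))
      \<le> L ^ DIM('a) * (\<Sum>j. exp (- ev j * t))"
    using main unfolding eventually_sequentially by blast
  ultimately have "(\<Sum>k\<in>I. exp (- q k * t) * ((1 + t * q k) * (?A - 0) - t * (?G + q k * ?A)))
      \<le> L ^ DIM('a) * (\<Sum>j. exp (- ev j * t))" by (rule LIMSEQ_le_const2)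
  \<comment> \<open>The terms \<open>t * q k * ?A\<close> cancel; this is the effect of placing the
    tangent at \<open>q k\<close>.\<close>
  also have "(\<Sum>k\<in>I. exp (- q k * t) * ((1 + t * q k) * (?A - 0) - t * (?G + q k * ?A)))
      = (\<Sum>k\<in>I. exp (- q k * t)) * (?A - t * ?G)"
    unfolding sum_distrib_right by (intro sum.cong refl arg_cong2[where f = "(*)"]) (simp add: algebra_simps)
  finally show ?thesis unfolding I_def q_def gaussian_wave_sum .
qed

theorem heat_trace_lower_test:
  assumes lst: "compact_form_listing (L2 M) (H10 \<Omega>) ip en C DIM('a) ev" and t: "t > 0"
    and \<phi>: "test_function \<Omega> \<phi>" "\<And>x. 0 \<le> \<phi> x \<and> \<phi> x \<le> 1"
  shows "((LINT x|M. (\<phi> x)\<^sup>2) - t * (LINT x|M. (norm (gradient \<phi> x))\<^sup>2)) * (1 / sqrt (4 * pi * t)) ^ DIM('a)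
    \<le> (\<Sum>j. exp (- ev j * t))"
proof -
  interpret compact_form_listing "L2 M" "H10 \<Omega>" ip en C "DIM('a)" ev by (rule lst)
  let ?a = "(LINT x|M. (\<phi> x)\<^sup>2) - t * (LINT x|M. (norm (gradient \<phi> x))\<^sup>2)" and ?T = "\<Sum>j. exp (- ev j * t)"
  have T0: "0 \<le> ?T" by (intro suminf_nonneg summable_exp t) simp
  show ?thesis
  proof (cases "?a \<le> 0")
    \<comment> \<open>Here nonnegativity of the trace suffices; in the other case the sign of
      \<open>?a\<close> permits multiplying it by lower bounds.\<close>
    case True
    then have "?a * (1 / sqrt (4 * pi * t)) ^ DIM('a) \<le> 0" using t by (intro mult_nonpos_nonneg) auto
    then show ?thesis using T0 by linarith
  next
    case False
    obtain B where B: "B \<longlonglongrightarrow> 1 / sqrt (4 * pi * t)" "\<And>n. B n \<le>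
      (\<Sum>m = - int ((Suc n)\<^sup>2)..int ((Suc n)\<^sup>2). exp (- (2 * pi * real_of_int m / real (Suc n))\<^sup>2 * t)) / real (Suc n)"
      using gaussian_theta_limit[OF t] by blast
    obtain \<rho> where \<rho>: "\<And>x. x \<in> \<Omega> \<Longrightarrow> norm x \<le> \<rho>" using bounded_\<Omega> by (meson bounded_iff)
    obtain n0 :: nat where n0: "real n0 \<ge> 2 * \<rho>" using real_arch_simple by blast
    have cube: "\<Omega> \<subseteq> centered_cube (real (Suc n))" if "n \<ge> n0" for n
    proof
      fix x assume x: "x \<in> \<Omega>"
      have "\<bar>x \<bullet> b\<bar> \<le> real (Suc n) / 2" if "b \<in> Basis" for b
      proof -
        have "\<bar>x \<bullet> b\<bar> \<le> L / 2" if "real n0 \<le> L" for L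
          using that Basis_le_norm[OF \<open>b \<in> Basis\<close>, of x] \<rho>[OF x] n0 by linarith
        then show ?thesis using \<open>n \<ge> n0\<close> by simp
      qed
      then show "x \<in> centered_cube (real (Suc n))" by (simp add: centered_cube_def)
    qed
    \<comment> \<open>Positivity is needed before the inequality for \<open>B n\<close> is raised to
      the power \<open>DIM('a)\<close>.\<close>
    have "eventually (\<lambda>n. 0 < B n) sequentially"
      by (rule order_tendstoD(1)[OF B(1)]) (use t in simp)
    moreover have "eventually (\<lambda>n. n \<ge> n0) sequentially" by (rule eventually_ge_at_top)
    ultimately have "eventually (\<lambda>n. ?a * B n ^ DIM('a) \<le> ?T) sequentially"
    proof eventually_elim
      case (elim n)
      let ?S = "\<Sum>m = - int ((Suc n)\<^sup>2)..int ((Suc n)\<^sup>2). exp (- (2 * pi * real_of_int m / real (Suc n))\<^sup>2 * t)"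
      have "?a * B n ^ DIM('a) \<le> ?a * (?S / real (Suc n)) ^ DIM('a)"
        using False elim(1) B(2)[of n] by (intro mult_left_mono power_mono) auto
      also have "\<dots> = ?S ^ DIM('a) * ?a / real (Suc n) ^ DIM('a)" by (simp add: power_divide)
      also have "\<dots> \<le> ?T"
        using heat_trace_lower_cube[OF lst t _ cube[OF elim(2)] \<phi>, of "(Suc n)\<^sup>2"]
        by (simp add: divide_le_eq mult.commute del: of_nat_Suc)
      finally show ?case .
    qed
    moreover have "(\<lambda>n. ?a * B n ^ DIM('a)) \<longlonglongrightarrow> ?a * (1 / sqrt (4 * pi * t)) ^ DIM('a)"
      by (intro tendsto_intros B)
    ultimately show ?thesis by (intro tendsto_upperbound[OF _ _ sequentially_bot])
  qed
qed

theorem heat_trace_lower: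
  assumes lst: "compact_form_listing (L2 M) (H10 \<Omega>) ip en C DIM('a) ev" and t: "t > 0"
  shows "(measure lebesgue \<Omega> - 2 * measure lebesgue (boundary_collar \<Omega> (sqrt t))) * (1 / sqrt (4 * pi * t)) ^ DIM('a)
    \<le> (\<Sum>j. exp (- ev j * t))"
proof -
  let ?w = "\<lambda>h. measure lebesgue (boundary_collar \<Omega> h)"
  have "(measure lebesgue \<Omega> - 2 * ?w (sqrt t + 1 / real (Suc n))) * (1 / sqrt (4 * pi * t)) ^ DIM('a)
    \<le> (\<Sum>j. exp (- ev j * t))" for n
  proof -
    obtain \<phi> where \<phi>: "test_function \<Omega> \<phi>" "\<And>x. 0 \<le> \<phi> x \<and> \<phi> x \<le> 1"
      "measure lebesgue \<Omega> - ?w (sqrt t + 1 / real (Suc n)) \<le> (LINT x|M. (\<phi> x)\<^sup>2)"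
      "(LINT x|M. (norm (gradient \<phi> x))\<^sup>2) \<le> ?w (sqrt t + 1 / real (Suc n)) / (sqrt t)\<^sup>2"
      using cutoff_exists[of "sqrt t" "1 / real (Suc n)"] t by (metis real_sqrt_gt_0_iff of_nat_0_less_iff zero_less_Suc zero_less_divide_1_iff)
    \<comment> \<open>The slope \<open>1 / sqrt t\<close> makes the factor \<open>t\<close> cancel,
      so the gradient costs exactly one further collar measure.\<close>
    have "t * (LINT x|M. (norm (gradient \<phi> x))\<^sup>2) \<le> ?w (sqrt t + 1 / real (Suc n))"
      using \<phi>(4) t by (simp add: le_divide_eq mult.commute)
    then have "measure lebesgue \<Omega> - 2 * ?w (sqrt t + 1 / real (Suc n))
        \<le> (LINT x|M. (\<phi> x)\<^sup>2) - t * (LINT x|M. (norm (gradient \<phi> x))\<^sup>2)" using \<phi>(3) by linarith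
    then have "(measure lebesgue \<Omega> - 2 * ?w (sqrt t + 1 / real (Suc n))) * (1 / sqrt (4 * pi * t)) ^ DIM('a)
        \<le> ((LINT x|M. (\<phi> x)\<^sup>2) - t * (LINT x|M. (norm (gradient \<phi> x))\<^sup>2)) * (1 / sqrt (4 * pi * t)) ^ DIM('a)"
      using t by (intro mult_right_mono) auto
    then show ?thesis using heat_trace_lower_test[OF lst t \<phi>(1,2)] by linarith
  qed
  moreover have "(\<lambda>n. (measure lebesgue \<Omega> - 2 * ?w (sqrt t + 1 / real (Suc n))) * (1 / sqrt (4 * pi * t)) ^ DIM('a))
      \<longlonglongrightarrow> (measure lebesgue \<Omega> - 2 * ?w (sqrt t)) * (1 / sqrt (4 * pi * t)) ^ DIM('a)"
    by (intro tendsto_intros collar_right_continuous)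
  ultimately show ?thesis by (intro LIMSEQ_le_const2) blast+
qed

end

section \<open>The stated inequality and the order of the remainder\<close>

lemma powr_half_eq_sqrt_power:
  assumes "x > 0"
  shows "x powr (real d / 2) = sqrt x ^ d"
proof -
  have "sqrt x ^ d = (x powr (1 / 2)) powr real d"
    using assms by (simp add: powr_half_sqrt powr_realpow)
  then show ?thesis using assms by (simp add: powr_powr)
qed

theorem corollary2p28:
  fixes \<Omega> :: "(real ^ 'n) set" and ev :: "nat \<Rightarrow> real"
    and d :: nat and S :: real and R :: "real \<Rightarrow> real"
  assumes d: "d = CARD('n)" "d \<ge> 2"
    and domain: "bounded_domain \<Omega>"
    and boundary_finite: "boundary_measure \<Omega> < \<infinity>"
    and S: "S = enn2real (boundary_measure \<Omega>)"
    and collar: "((\<lambda>h. measure lebesgue (boundary_collar \<Omega> h) / h) \<longlongrightarrow> S) (at_right 0)"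
    and eigenvalues: "dirichlet_eigenvalues \<Omega> ev"
    and R: "\<And>t. R t = 2 * (sqrt t * S - measure lebesgue (boundary_collar \<Omega> (sqrt t)))
                        / (4 * pi * t) powr (real d / 2)"
  shows "(\<forall>t. 0 < t \<and> t \<le> (inradius \<Omega>)\<^sup>2 \<longrightarrow>
            summable (\<lambda>j. exp (- ev j * t)) \<and>
            (\<Sum>j. exp (- ev j * t)) \<ge>
              measure lebesgue \<Omega> / (4 * pi * t) powr (real d / 2)
              - 2 * S * sqrt t / (4 * pi * t) powr (real d / 2) + R t)
         \<and> R \<in> o[at_right 0](\<lambda>t. t powr ((1 - real d) / 2))"
proof -
  interpret bounded_open \<Omega> using domain by unfold_locales (auto simp: bounded_domain_def)
  obtain C where lst: "compact_form_listing (L2 M) (H10 \<Omega>) ip en C DIM(real ^ 'n) ev"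
    using eigenvalue_listing[OF eigenvalues] by blast
  let ?w = "\<lambda>h. measure lebesgue (boundary_collar \<Omega> h)"
  have bound: "summable (\<lambda>j. exp (- ev j * t)) \<and> (\<Sum>j. exp (- ev j * t)) \<ge>
      measure lebesgue \<Omega> / (4 * pi * t) powr (real d / 2)
      - 2 * S * sqrt t / (4 * pi * t) powr (real d / 2) + R t" if t: "t > 0" for t
  proof -
    \<comment> \<open>The terms with \<open>S\<close> cancel against those inside
      \<open>R t\<close>, which leaves the left side of \<open>heat_trace_lower\<close>.\<close>
    have "measure lebesgue \<Omega> / (4 * pi * t) powr (real d / 2)
        - 2 * S * sqrt t / (4 * pi * t) powr (real d / 2) + R t
      = (measure lebesgue \<Omega> - 2 * ?w (sqrt t)) * (1 / sqrt (4 * pi * t)) ^ d"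
      unfolding R using t powr_half_eq_sqrt_power[of "4 * pi * t" d]
      by (simp add: power_divide diff_divide_distrib[symmetric] add_divide_distrib[symmetric] algebra_simps)
    then show ?thesis using heat_trace_lower[OF lst t] compact_form_listing.summable_exp[OF lst t] d(1) by simp
  qed
  have remainder: "R \<in> o[at_right 0](\<lambda>t. t powr ((1 - real d) / 2))"
  proof (rule smalloI_tendsto)
    \<comment> \<open>The collar hypothesis is used along \<open>sqrt t\<close>: the quotient of
      \<open>R t\<close> by the comparison power is a constant multiple of
      \<open>S - ?w (sqrt t) / sqrt t\<close>.\<close>
    have "filterlim sqrt (at_right 0) (at_right (0 :: real))"
      by real_asymp
    then have "((\<lambda>t. ?w (sqrt t) / sqrt t) \<longlongrightarrow> S) (at_right 0)" by (rule filterlim_compose[OF collar])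
    moreover have "4 * pi \<noteq> 0" using pi_gt_zero by linarith
    then have "(4 * pi) powr (real d / 2) \<noteq> 0" unfolding powr_eq_0_iff .
    ultimately have "((\<lambda>t. 2 * (S - ?w (sqrt t) / sqrt t) / (4 * pi) powr (real d / 2)) \<longlongrightarrow> 2 * (S - S) / (4 * pi) powr (real d / 2)) (at_right 0)"
      by (intro tendsto_intros)
    moreover have "eventually (\<lambda>t. 2 * (S - ?w (sqrt t) / sqrt t) / (4 * pi) powr (real d / 2)
        = R t / t powr ((1 - real d) / 2)) (at_right 0)"
      using eventually_at_right_less[of "0 :: real"]
    proof eventually_elim
      case (elim t)
      have 1: "(4 * pi * t) powr (real d / 2) = (4 * pi) powr (real d / 2) * t powr (real d / 2)"
        by (rule powr_mult)
      have 2: "t powr (real d / 2) * t powr ((1 - real d) / 2) = sqrt t"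
        using elim by (simp add: powr_add[symmetric] powr_half_sqrt[symmetric] diff_divide_distrib)
      have "R t / t powr ((1 - real d) / 2)
          = 2 * (sqrt t * S - ?w (sqrt t)) / ((4 * pi) powr (real d / 2) * (t powr (real d / 2) * t powr ((1 - real d) / 2)))"
        unfolding R 1 by (simp add: mult.assoc)
      also have "\<dots> = 2 * (S - ?w (sqrt t) / sqrt t) / (4 * pi) powr (real d / 2)"
        unfolding 2 using elim by (simp add: field_simps)
      finally show ?case by simp
    qed
    ultimately show "((\<lambda>t. R t / t powr ((1 - real d) / 2)) \<longlongrightarrow> 0) (at_right 0)"
      by (simp add: tendsto_cong[THEN iffD1])
  next
    show "eventually (\<lambda>t. t powr ((1 - real d) / 2) \<noteq> (0 :: real)) (at_right 0)"
      using eventually_at_right_less[of "0 :: real"] by eventually_elim simp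
  qed
  show ?thesis by (rule conjI[OF _ remainder], intro allI impI, erule conjE, rule bound)
qed

end
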